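(* Let $\Omega\subset\mathbb R^d$ be a bounded domain with smooth boundary, $T>0$, $\alpha\in(0,1)$, and let $x_0\in\Omega$ be fixed. Let $g\in\mathcal D((-\triangle)^\gamma)$ with $\gamma>\frac d4$, and for $\rho\in C[0,T]$ let $u$ be the solution to $$\begin{cases}(\partial_t^\alpha-\triangle)u(x,t)=g(x)\rho(t), & x\in\Omega,\ 0<t<T,\\ u(x,0)=0, & x\in\Omega,\\ u(x,t)=0, & x\in\partial\Omega,\ 0<t<T.\end{cases}$$ If $g(x_0)\ne0$, then there exists a constant $C>0$, independent of $\rho$, such that for every $\rho\in C[0,T]$, $$C^{-1}\|\partial_t^\alpha u(x_0,\,\cdot\,)\|_{L^\infty(0,T)}\le\|\rho\|_{C[0,T]}\le C\|\partial_t^\alpha u(x_0,\,\cdot\,)\|_{L^\infty(0,T)}.$$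
   Context: All functions are real-valued. $\triangle=\sum_{j=1}^d\partial_j^2$ is the Laplacian in space, and $-\triangle$ is regarded as an operator in $L^2(\Omega)$ with domain $\mathcal D(-\triangle)=H^2(\Omega)\cap H^1_0(\Omega)$. Let $\{(\lambda_n,\varphi_n)\}_{n=1}^\infty$ be its eigensystem: $0<\lambda_1<\lambda_2\le\cdots$ (repeated according to multiplicity), $-\triangle\varphi_n=\lambda_n\varphi_n$, and $\{\varphi_n\}$ is a complete orthonormal system of $L^2(\Omega)$ with scalar product $(f,h)=\int_\Omega f(x)h(x)\,\mathrm dx$. For $\gamma\ge0$, $$\mathcal D((-\triangle)^\gamma)=\Big\{f\in L^2(\Omega):\ \sum_{n=1}^\infty|\lambda_n^\gamma(f,\varphi_n)|^2<\infty\Big\},\qquad (-\triangle)^\gamma f=\sum_{n=1}^\infty\lambda_n^\gamma(f,\varphi_n)\varphi_n,$$ with norm $\|f\|_{\mathcal D((-\triangle)^\gamma)}=\big(\sum_{n}|\lambda_n^\gamma(f,\varphi_n)|^2\big)^{1/2}$. For $\gamma>\frac d4$ one has the Sobolev embedding $\mathcal D((-\triangle)^\gamma)\subset C(\overline\Omega)$, so that point values such as $g(x_0)$ refer to the continuous representative. The Caputo derivative is $\partial_t^\alpha f(t)=\frac1{\Gamma(1-\alpha)}\int_0^t(t-s)^{-\alpha}\frac{\mathrm df}{\mathrm ds}(s)\,\mathrm ds$. The Mittag-Leffler function is $E_{\alpha,\beta}(z)=\sum_{k=0}^\infty\frac{z^k}{\Gamma(\alpha k+\beta)}$. The solution $u$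 is understood in the following class: for $\rho\in C[0,T]$ and $g\in\mathcal D((-\triangle)^\gamma)$, $u$ is the unique solution in $\bigcap_{0<\varepsilon\le1}L^\infty(0,T;\mathcal D((-\triangle)^{\gamma+1-\varepsilon}))$, given by $$u(\,\cdot\,,t)=\sum_{n=1}^\infty\left(\int_0^t s^{\alpha-1}E_{\alpha,\alpha}(-\lambda_ns^\alpha)\rho(t-s)\,\mathrm ds\right)(g,\varphi_n)\varphi_n.$$ Since $\rho$ is only continuous, $\partial_t^\alpha u$ is understood through the governing equation, i.e. $\partial_t^\alpha u=\triangle u+g\rho$. It belongs to $L^\infty(0,T;\mathcal D((-\triangle)^{\gamma-\varepsilon}))$ for every small $\varepsilon>0$, so by the Sobolev embedding it can be evaluated at $x=x_0$ for almost every $t$. *)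

theory Defs
  imports "HOL-Analysis.Analysis" "HOL-Probability.Essential_Supremum"
begin

section \<open>Smooth functions and smooth domains\<close>

definition dir_deriv :: "'a::euclidean_space \<Rightarrow> ('a \<Rightarrow> real) \<Rightarrow> 'a \<Rightarrow> real" where
  "dir_deriv v f x = frechet_derivative f (at x) v"

text \<open>All iterated partial derivatives exist and are differentiable (hence continuous).\<close>

definition smooth :: "('a::euclidean_space \<Rightarrow> real) \<Rightarrow> bool" where
  "smooth f \<longleftrightarrow> (\<forall>vs x. set vs \<subseteq> Basis \<longrightarrow> foldr dir_deriv vs f differentiable at x)"

text \<open>Near each boundary point, the domain is the region on one side of the graph of a smooth
  function over the hyperplane orthogonal to some unit vector \<open>\<nu>\<close>; \<open>x - (x \<bullet> \<nu>) *\<^sub>R \<nu>\<close> is the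
  orthogonal projection onto that hyperplane.\<close>

definition smooth_boundary :: "'a::euclidean_space set \<Rightarrow> bool" where
  "smooth_boundary \<Omega> \<longleftrightarrow>
     (\<forall>p\<in>frontier \<Omega>. \<exists>r>0. \<exists>\<nu> h. norm \<nu> = 1 \<and> smooth h \<and>
        \<Omega> \<inter> ball p r = {x \<in> ball p r. h (x - (x \<bullet> \<nu>) *\<^sub>R \<nu>) < x \<bullet> \<nu>})"

definition smooth_bounded_domain :: "'a::euclidean_space set \<Rightarrow> bool" where
  "smooth_bounded_domain \<Omega> \<longleftrightarrow>
     open \<Omega> \<and> connected \<Omega> \<and> \<Omega> \<noteq> {} \<and> bounded \<Omega> \<and> smooth_boundary \<Omega>"

definition test_function :: "'a::euclidean_space set \<Rightarrow> ('a \<Rightarrow> real) \<Rightarrow> bool" where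
  "test_function \<Omega> \<psi> \<longleftrightarrow> smooth \<psi> \<and> (\<exists>K. compact K \<and> K \<subseteq> \<Omega> \<and> (\<forall>x. x \<notin> K \<longrightarrow> \<psi> x = 0))"

section \<open>Lebesgue and Sobolev spaces\<close>

text \<open>Elements of \<open>L\<^sup>2\<close> are represented by functions; all notions below are invariant under
  changes on null sets.\<close>

definition L2 :: "'a::euclidean_space set \<Rightarrow> ('a \<Rightarrow> real) set" where
  "L2 \<Omega> = {f. f \<in> borel_measurable (lebesgue_on \<Omega>) \<and> integrable (lebesgue_on \<Omega>) (\<lambda>x. (f x)\<^sup>2)}"

definition l2_inner :: "'a::euclidean_space set \<Rightarrow> ('a \<Rightarrow> real) \<Rightarrow> ('a \<Rightarrow> real) \<Rightarrow> real" where
  "l2_inner \<Omega> f h = (LINT x|lebesgue_on \<Omega>. f x * h x)"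

definition l2_norm :: "'a::euclidean_space set \<Rightarrow> ('a \<Rightarrow> real) \<Rightarrow> real" where
  "l2_norm \<Omega> f = sqrt (l2_inner \<Omega> f f)"

definition has_weak_partial ::
  "'a::euclidean_space set \<Rightarrow> 'a \<Rightarrow> ('a \<Rightarrow> real) \<Rightarrow> ('a \<Rightarrow> real) \<Rightarrow> bool" where
  "has_weak_partial \<Omega> i f w \<longleftrightarrow>
     (\<forall>\<psi>. test_function \<Omega> \<psi> \<longrightarrow> l2_inner \<Omega> f (dir_deriv i \<psi>) = - l2_inner \<Omega> w \<psi>)"

text \<open>The weak derivative is unique up to a null set; \<open>SOME\<close> picks a representative.\<close>

definition weak_partial :: "'a::euclidean_space set \<Rightarrow> 'a \<Rightarrow> ('a \<Rightarrow> real) \<Rightarrow> 'a \<Rightarrow> real" where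
  "weak_partial \<Omega> i f = (SOME w. w \<in> L2 \<Omega> \<and> has_weak_partial \<Omega> i f w)"

definition H1 :: "'a::euclidean_space set \<Rightarrow> ('a \<Rightarrow> real) set" where
  "H1 \<Omega> = {f \<in> L2 \<Omega>. \<forall>i\<in>Basis. \<exists>w\<in>L2 \<Omega>. has_weak_partial \<Omega> i f w}"

definition H2 :: "'a::euclidean_space set \<Rightarrow> ('a \<Rightarrow> real) set" where
  "H2 \<Omega> = {f \<in> H1 \<Omega>. \<forall>i\<in>Basis. weak_partial \<Omega> i f \<in> H1 \<Omega>}"

text \<open>The closure of the test functions in the \<open>H\<^sup>1\<close> norm.\<close>

definition H10 :: "'a::euclidean_space set \<Rightarrow> ('a \<Rightarrow> real) set" where
  "H10 \<Omega> = {f \<in> H1 \<Omega>. \<exists>\<psi>. (\<forall>k. test_function \<Omega> (\<psi> k)) \<and>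
       (\<lambda>k::nat. l2_norm \<Omega> (\<lambda>x. \<psi> k x - f x)) \<longlonglongrightarrow> 0 \<and>
       (\<forall>i\<in>Basis. (\<lambda>k. l2_norm \<Omega> (\<lambda>x. dir_deriv i (\<psi> k) x - weak_partial \<Omega> i f x)) \<longlonglongrightarrow> 0)}"

text \<open>Meaningful for \<open>f \<in> H\<^sup>2(\<Omega>)\<close>.\<close>

definition laplacian :: "'a::euclidean_space set \<Rightarrow> ('a \<Rightarrow> real) \<Rightarrow> 'a \<Rightarrow> real" where
  "laplacian \<Omega> f x = (\<Sum>i\<in>Basis. weak_partial \<Omega> i (weak_partial \<Omega> i f) x)"

section \<open>The Dirichlet Laplacian and its fractional powers\<close>

definition dirichlet_domain :: "'a::euclidean_space set \<Rightarrow> ('a \<Rightarrow> real) set" where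
  "dirichlet_domain \<Omega> = H2 \<Omega> \<inter> H10 \<Omega>"

text \<open>Indices start at 0, so \<open>lam n\<close> is the eigenvalue usually written with index \<open>n + 1\<close>.\<close>

definition dirichlet_eigensystem ::
  "'a::euclidean_space set \<Rightarrow> (nat \<Rightarrow> real) \<Rightarrow> (nat \<Rightarrow> 'a \<Rightarrow> real) \<Rightarrow> bool" where
  "dirichlet_eigensystem \<Omega> lam \<phi> \<longleftrightarrow>
     0 < lam 0 \<and> lam 0 < lam 1 \<and> mono lam \<and>
     (\<forall>n. \<phi> n \<in> dirichlet_domain \<Omega> \<and>
          (AE x in lebesgue_on \<Omega>. - laplacian \<Omega> (\<phi> n) x = lam n * \<phi> n x)) \<and>
     (\<forall>m n. l2_inner \<Omega> (\<phi> m) (\<phi> n) = (if m = n then 1 else 0)) \<and>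
     (\<forall>f\<in>L2 \<Omega>. \<forall>e>0. \<exists>N c. l2_norm \<Omega> (\<lambda>x. f x - (\<Sum>n<N. c n * \<phi> n x)) < e)"

definition frac_domain ::
  "'a::euclidean_space set \<Rightarrow> (nat \<Rightarrow> real) \<Rightarrow> (nat \<Rightarrow> 'a \<Rightarrow> real) \<Rightarrow> real \<Rightarrow> ('a \<Rightarrow> real) set" where
  "frac_domain \<Omega> lam \<phi> \<gamma> =
     {f \<in> L2 \<Omega>. summable (\<lambda>n. (lam n powr \<gamma> * l2_inner \<Omega> f (\<phi> n))\<^sup>2)}"

definition frac_norm ::
  "'a::euclidean_space set \<Rightarrow> (nat \<Rightarrow> real) \<Rightarrow> (nat \<Rightarrow> 'a \<Rightarrow> real) \<Rightarrow> real \<Rightarrow> ('a \<Rightarrow> real) \<Rightarrow> real" where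
  "frac_norm \<Omega> lam \<phi> \<gamma> f = sqrt (\<Sum>n. (lam n powr \<gamma> * l2_inner \<Omega> f (\<phi> n))\<^sup>2)"

text \<open>The space \<open>L\<^sup>\<infinity>(0,T; D((-\<Delta>)\<^sup>\<gamma>))\<close>. As \<open>D((-\<Delta>)\<^sup>\<gamma>)\<close> is a separable Hilbert space, strong
  measurability amounts to measurability of all Fourier coefficients.\<close>

definition Linfty_frac ::
  "'a::euclidean_space set \<Rightarrow> (nat \<Rightarrow> real) \<Rightarrow> (nat \<Rightarrow> 'a \<Rightarrow> real) \<Rightarrow> real \<Rightarrow> real
     \<Rightarrow> (real \<Rightarrow> 'a \<Rightarrow> real) set" where
  "Linfty_frac \<Omega> lam \<phi> T \<gamma> =
     {u. (\<forall>n. (\<lambda>t. l2_inner \<Omega> (u t) (\<phi> n)) \<in> borel_measurable (lebesgue_on {0<..<T})) \<and>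
         (\<exists>M. AE t in lebesgue_on {0<..<T}.
            u t \<in> frac_domain \<Omega> lam \<phi> \<gamma> \<and> frac_norm \<Omega> lam \<phi> \<gamma> (u t) \<le> M)}"

text \<open>The value at \<open>x \<in> \<Omega>\<close> of the continuous representative of \<open>f\<close>. For open \<open>\<Omega>\<close> a continuous
  representative on \<open>\<Omega>\<close> is unique, so it is the restriction of the representative in
  \<open>C(closure \<Omega>)\<close> whenever the latter exists.\<close>

definition point_value :: "'a::euclidean_space set \<Rightarrow> ('a \<Rightarrow> real) \<Rightarrow> 'a \<Rightarrow> real" where
  "point_value \<Omega> f x =
     (THE y. \<exists>h. continuous_on \<Omega> h \<and> (AE z in lebesgue_on \<Omega>. f z = h z) \<and> h x = y)"

section \<open>The time-fractional diffusion equation\<close>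

definition mittag_leffler :: "real \<Rightarrow> real \<Rightarrow> real \<Rightarrow> real" where
  "mittag_leffler \<alpha> \<beta> z = (\<Sum>k. z ^ k / Gamma (\<alpha> * real k + \<beta>))"

definition duhamel_coeff :: "real \<Rightarrow> real \<Rightarrow> (real \<Rightarrow> real) \<Rightarrow> real \<Rightarrow> real" where
  "duhamel_coeff \<alpha> l \<rho> t =
     (LINT s|lebesgue_on {0..t}.
        s powr (\<alpha> - 1) * mittag_leffler \<alpha> \<alpha> (- l * s powr \<alpha>) * \<rho> (t - s))"

text \<open>\<open>u\<close> is the solution of \<open>(\<partial>\<^sub>t\<^sup>\<alpha> - \<Delta>) u = g \<rho>\<close> on \<open>\<Omega> \<times> (0,T)\<close> with zero initial value and
  homogeneous Dirichlet boundary values. Membership in \<open>dirichlet_domain\<close> carries the boundary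
  condition; the equation itself appears as the representation formula, with the series
  converging in \<open>L\<^sup>2(\<Omega>)\<close>, since for merely continuous \<open>\<rho>\<close> the Caputo derivative of \<open>u\<close>
  is given a meaning only through the equation (see \<open>caputo_deriv_sol\<close>).\<close>

definition is_solution ::
  "'a::euclidean_space set \<Rightarrow> (nat \<Rightarrow> real) \<Rightarrow> (nat \<Rightarrow> 'a \<Rightarrow> real) \<Rightarrow> real \<Rightarrow> real \<Rightarrow> real
     \<Rightarrow> ('a \<Rightarrow> real) \<Rightarrow> (real \<Rightarrow> real) \<Rightarrow> (real \<Rightarrow> 'a \<Rightarrow> real) \<Rightarrow> bool" where
  "is_solution \<Omega> lam \<phi> T \<alpha> \<gamma> g \<rho> u \<longleftrightarrow>
     (\<forall>\<epsilon>. 0 < \<epsilon> \<and> \<epsilon> \<le> 1 \<longrightarrow> u \<in> Linfty_frac \<Omega> lam \<phi> T (\<gamma> + 1 - \<epsilon>)) \<and>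
     (AE x in lebesgue_on \<Omega>. u 0 x = 0) \<and>
     (AE t in lebesgue_on {0<..<T}.
        u t \<in> dirichlet_domain \<Omega> \<and>
        (\<lambda>N. l2_norm \<Omega> (\<lambda>x. u t x -
           (\<Sum>n<N. duhamel_coeff \<alpha> (lam n) \<rho> t * l2_inner \<Omega> g (\<phi> n) * \<phi> n x))) \<longlonglongrightarrow> 0)"

text \<open>\<open>\<partial>\<^sub>t\<^sup>\<alpha> u = \<Delta> u + g \<rho>\<close>.\<close>

definition caputo_deriv_sol ::
  "'a::euclidean_space set \<Rightarrow> ('a \<Rightarrow> real) \<Rightarrow> (real \<Rightarrow> real) \<Rightarrow> (real \<Rightarrow> 'a \<Rightarrow> real)
     \<Rightarrow> real \<Rightarrow> 'a \<Rightarrow> real" where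
  "caputo_deriv_sol \<Omega> g \<rho> u t x = laplacian \<Omega> (u t) x + g x * \<rho> t"

definition sup_norm_on :: "real set \<Rightarrow> (real \<Rightarrow> real) \<Rightarrow> real" where
  "sup_norm_on A \<rho> = (SUP t\<in>A. \<bar>\<rho> t\<bar>)"

definition Linfty_norm :: "real \<Rightarrow> (real \<Rightarrow> real) \<Rightarrow> ereal" where
  "Linfty_norm T v = esssup (lebesgue_on {0<..<T}) (\<lambda>t. ereal \<bar>v t\<bar>)"

end

theory Submission
  imports Defs
begin

text \<open>Expanding in eigenfunctions, \<open>\<partial>\<^sub>t\<^sup>\<alpha> u(x\<^sub>0,t) = \<Sum>\<^sub>n (\<rho>(t) - (k\<^sub>n * \<rho>)(t)) (g,\<phi>\<^sub>n) \<phi>\<^sub>n(x\<^sub>0)\<close> with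
  \<open>k\<^sub>n(s) = \<lambda>\<^sub>n s\<^sup>\<alpha>\<^sup>-\<^sup>1 E\<^sub>\<alpha>\<^sub>,\<^sub>\<alpha>(-\<lambda>\<^sub>n s\<^sup>\<alpha>)\<close>.  The kernels are nonnegative with \<open>\<integral> k\<^sub>n \<le> 1\<close>, and
  \<open>\<Sum>\<^sub>n (g,\<phi>\<^sub>n) \<phi>\<^sub>n(x\<^sub>0)\<close> converges absolutely to \<open>g(x\<^sub>0)\<close>, which gives the first inequality.  For the second,
  \<open>\<rho>(t) g(x\<^sub>0)\<close> is \<open>\<partial>\<^sub>t\<^sup>\<alpha> u(x\<^sub>0,t)\<close> plus a convolution of \<open>\<rho>\<close>; in the norm \<open>sup\<^sub>t e\<^sup>-\<^sup>m\<^sup>t |\<rho>(t)|\<close> with \<open>m\<close> large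
  the convolution has norm at most \<open>|g(x\<^sub>0)|/2\<close> and is absorbed.

  Only the interior case of the Sobolev embedding is needed.  Weighted means
  of an eigenfunction over a ball of radius \<open>\<surd>\<tau>\<close>, with weights \<open>(\<tau> - |y - x|\<^sup>2)\<^sup>k\<close>, satisfy a three-term recurrence
  in \<open>k\<close> and converge as \<open>k \<rightarrow> \<infinity>\<close> to a continuous representative.  If \<open>\<lambda>\<^sub>n \<tau> \<le> 1\<close> its value at \<open>x\<close> is bounded by twice the
  mean with \<open>k = 2\<close>, a scalar product of \<open>\<phi>\<^sub>n\<close> with a kernel independent of \<open>n\<close>.  So Bessel's inequality
  gives \<open>\<Sum> \<phi>\<^sub>n(x)\<^sup>2 \<le> C \<tau>\<^sup>-\<^sup>d\<^sup>/\<^sup>2\<close> over \<open>\<lambda>\<^sub>n \<le> 1/\<tau>\<close>, whence \<open>\<Sum>\<^sub>n \<lambda>\<^sub>n\<^sup>-\<^sup>2\<^sup>\<gamma> \<phi>\<^sub>n(x)\<^sup>2\<close> is locally bounded for \<open>\<gamma> > d/4\<close>.\<close>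

section \<open>Square-integrable functions\<close>

text \<open>Two uniformity questions shape the argument in time. The solution class leaves
  \<open>\<partial>_t^\<alpha> u\<close> short of order \<open>\<gamma>\<close> by an arbitrarily
  small amount; but its coefficients arise from those of \<open>g\<close> by factors bounded
  uniformly in \<open>n\<close>, so it has order \<open>\<gamma>\<close> exactly and the point-value
  series of \<open>g\<close> applies to it as well. The sign of the kernels is essential here: it
  turns the explicit value of \<open>\<integral> k_n\<close> into a bound for
  \<open>\<integral> |k_n|\<close>. In contrast, \<open>\<integral> e^(-m s) k_n(s) ds\<close> is
  not small uniformly in \<open>n\<close> for any fixed \<open>m\<close>, because the mass of
  \<open>k_n\<close> moves towards \<open>s = 0\<close> as \<open>\<lambda>_n\<close> grows.
  Smallness appears only after summation against the absolutely convergent series, so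
  \<open>m\<close> depends on \<open>g\<close> and \<open>x0\<close>, but not on
  \<open>\<rho>\<close>. In space, bounding each \<open>\<phi>_n(x)\<close> separately by a power of
  \<open>\<lambda>_n\<close> and then counting eigenvalues would require
  \<open>\<gamma> > d/2\<close>; only the bound for a whole spectral window reaches
  \<open>d/4\<close>.\<close>

lemma L2_D: "f \<in> L2 \<Omega> \<Longrightarrow> f \<in> borel_measurable (lebesgue_on \<Omega>)"
  "f \<in> L2 \<Omega> \<Longrightarrow> integrable (lebesgue_on \<Omega>) (\<lambda>x. (f x)\<^sup>2)"
  by (auto simp: L2_def)

lemma L2_mult_integrable:
  assumes "f \<in> L2 \<Omega>" "h \<in> L2 \<Omega>"
  shows "integrable (lebesgue_on \<Omega>) (\<lambda>x. f x * h x)"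
proof (rule Bochner_Integration.integrable_bound)
  show "integrable (lebesgue_on \<Omega>) (\<lambda>x. (f x)\<^sup>2 + (h x)\<^sup>2)"
    using assms by (auto dest: L2_D)
  show "(\<lambda>x. f x * h x) \<in> borel_measurable (lebesgue_on \<Omega>)"
    using L2_D(1)[OF assms(1)] L2_D(1)[OF assms(2)] by measurable
  have "\<bar>a * b\<bar> \<le> a\<^sup>2 + b\<^sup>2" for a b :: real
  proof -
    have "2 * \<bar>a * b\<bar> \<le> a\<^sup>2 + b\<^sup>2"
      using sum_squares_bound[of "\<bar>a\<bar>" "\<bar>b\<bar>"] by (simp add: abs_mult)
    then show ?thesis using abs_ge_zero[of "a * b"] by linarith
  qed
  then show "AE x in lebesgue_on \<Omega>. norm (f x * h x) \<le> norm ((f x)\<^sup>2 + (h x)\<^sup>2)"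
    by auto
qed

lemma L2_add:
  assumes "f \<in> L2 \<Omega>" "h \<in> L2 \<Omega>"
  shows "(\<lambda>x. f x + h x) \<in> L2 \<Omega>"
proof -
  have "(\<lambda>x. f x + h x) \<in> borel_measurable (lebesgue_on \<Omega>)"
    using L2_D(1)[OF assms(1)] L2_D(1)[OF assms(2)] by measurable
  moreover have "integrable (lebesgue_on \<Omega>) (\<lambda>x. (f x)\<^sup>2 + (h x)\<^sup>2 + 2 * (f x * h x))"
    using L2_mult_integrable[OF assms] L2_D(2)[OF assms(1)] L2_D(2)[OF assms(2)] by simp
  ultimately show ?thesis
    by (simp add: L2_def power2_sum mult.assoc)
qed

lemma L2_cmult: "f \<in> L2 \<Omega> \<Longrightarrow> (\<lambda>x. c * f x) \<in> L2 \<Omega>"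
  by (auto simp: L2_def power_mult_distrib)

lemma L2_diff: "f \<in> L2 \<Omega> \<Longrightarrow> h \<in> L2 \<Omega> \<Longrightarrow> (\<lambda>x. f x - h x) \<in> L2 \<Omega>"
  using L2_add[of f \<Omega> "\<lambda>x. -1 * h x"] L2_cmult[of h \<Omega> "-1"] by simp

lemma L2_sum:
  assumes "\<And>i. i \<in> I \<Longrightarrow> f i \<in> L2 \<Omega>"
  shows "(\<lambda>x. \<Sum>i\<in>I. f i x) \<in> L2 \<Omega>"
  using assms
proof (induction I rule: infinite_finite_induct)
  case (insert i I)
  then show ?case using L2_add[of "f i" \<Omega> "\<lambda>x. \<Sum>i\<in>I. f i x"] by simp
qed (simp_all add: L2_def)

lemma l2_inner_commute: "l2_inner \<Omega> f h = l2_inner \<Omega> h f"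
  by (simp add: l2_inner_def mult.commute)

lemma l2_inner_add_left:
  "f \<in> L2 \<Omega> \<Longrightarrow> g \<in> L2 \<Omega> \<Longrightarrow> h \<in> L2 \<Omega> \<Longrightarrow>
     l2_inner \<Omega> (\<lambda>x. f x + g x) h = l2_inner \<Omega> f h + l2_inner \<Omega> g h"
  by (simp add: l2_inner_def distrib_right L2_mult_integrable)

lemma l2_inner_diff_left:
  "f \<in> L2 \<Omega> \<Longrightarrow> g \<in> L2 \<Omega> \<Longrightarrow> h \<in> L2 \<Omega> \<Longrightarrow>
     l2_inner \<Omega> (\<lambda>x. f x - g x) h = l2_inner \<Omega> f h - l2_inner \<Omega> g h"
  by (simp add: l2_inner_def left_diff_distrib L2_mult_integrable)

lemma l2_inner_cmult_left: "l2_inner \<Omega> (\<lambda>x. c * f x) h = c * l2_inner \<Omega> f h"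
  by (simp add: l2_inner_def mult.assoc)

lemma l2_inner_sum_left:
  assumes "\<And>i. i \<in> I \<Longrightarrow> f i \<in> L2 \<Omega>" "h \<in> L2 \<Omega>"
  shows "l2_inner \<Omega> (\<lambda>x. \<Sum>i\<in>I. f i x) h = (\<Sum>i\<in>I. l2_inner \<Omega> (f i) h)"
  using assms by (simp add: l2_inner_def sum_distrib_right L2_mult_integrable)

lemma l2_inner_cong_AE_left:
  assumes "f \<in> borel_measurable (lebesgue_on \<Omega>)" "f' \<in> borel_measurable (lebesgue_on \<Omega>)"
    "h \<in> borel_measurable (lebesgue_on \<Omega>)" "AE x in lebesgue_on \<Omega>. f x = f' x"
  shows "l2_inner \<Omega> f h = l2_inner \<Omega> f' h"
  unfolding l2_inner_def by (rule integral_cong_AE) (use assms in auto)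

lemma l2_inner_self_nonneg: "0 \<le> l2_inner \<Omega> f f"
  by (simp add: l2_inner_def)

lemma l2_norm_nonneg: "0 \<le> l2_norm \<Omega> f"
  by (simp add: l2_norm_def l2_inner_self_nonneg)

lemma l2_norm_power2: "(l2_norm \<Omega> f)\<^sup>2 = l2_inner \<Omega> f f"
  by (simp add: l2_norm_def l2_inner_self_nonneg)

lemma l2_inner_diff_self:
  assumes "f \<in> L2 \<Omega>" "h \<in> L2 \<Omega>"
  shows "l2_inner \<Omega> (\<lambda>x. f x - h x) (\<lambda>x. f x - h x)
    = l2_inner \<Omega> f f - 2 * l2_inner \<Omega> f h + l2_inner \<Omega> h h"
proof -
  note d = L2_diff[OF assms]
  have "l2_inner \<Omega> (\<lambda>x. f x - h x) (\<lambda>x. f x - h x)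
     = l2_inner \<Omega> (\<lambda>x. f x - h x) f - l2_inner \<Omega> (\<lambda>x. f x - h x) h"
    using l2_inner_diff_left[OF assms d]
    by (simp add: l2_inner_commute[of \<Omega> "\<lambda>x. f x - h x" f] l2_inner_commute[of \<Omega> "\<lambda>x. f x - h x" h])
  then show ?thesis
    using assms by (simp add: l2_inner_diff_left l2_inner_commute[of \<Omega> h f])
qed

lemma l2_Cauchy_Schwarz:
  assumes "f \<in> L2 \<Omega>" "h \<in> L2 \<Omega>"
  shows "\<bar>l2_inner \<Omega> f h\<bar> \<le> l2_norm \<Omega> f * l2_norm \<Omega> h"
proof -
  define A B C where "A = l2_inner \<Omega> f f" and "B = l2_inner \<Omega> f h" and "C = l2_inner \<Omega> h h"
  have q: "0 \<le> A - 2 * s * B + s\<^sup>2 * C" for s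
    using l2_inner_diff_self[OF assms(1) L2_cmult[OF assms(2)], of s]
      l2_inner_self_nonneg[of \<Omega> "\<lambda>x. f x - s * h x"]
    by (simp add: A_def B_def C_def l2_inner_cmult_left l2_inner_commute[of \<Omega> _ "\<lambda>x. s * h x"]
        power2_eq_square l2_inner_commute[of \<Omega> h f] mult.assoc)
  have C0: "C \<ge> 0" and A0: "A \<ge> 0" by (auto simp: C_def A_def l2_inner_self_nonneg)
  have "B\<^sup>2 \<le> A * C"
  proof (cases "C = 0")
    case True
    \<comment> \<open>At this \<open>s\<close> the quadratic equals \<open>A - (A + 1) = -1\<close>,
      contradicting \<open>q\<close>.\<close>
    then have "B = 0"
      using q[of "(A + 1) / (2 * B)"] by (cases "B = 0") (auto simp: field_simps)
    then show ?thesis using True by simp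
  next
    case False
    then show ?thesis using q[of "B / C"] C0 by (simp add: field_simps power2_eq_square)
  qed
  then have "sqrt (B\<^sup>2) \<le> sqrt (A * C)" by (rule real_sqrt_le_mono)
  then show ?thesis by (simp add: A_def B_def C_def l2_norm_def real_sqrt_mult)
qed

lemma l2_inner_tendsto:
  assumes "\<And>k. f k \<in> L2 \<Omega>" "F \<in> L2 \<Omega>" "h \<in> L2 \<Omega>"
    and "(\<lambda>k. l2_norm \<Omega> (\<lambda>x. f k x - F x)) \<longlonglongrightarrow> 0"
  shows "(\<lambda>k. l2_inner \<Omega> (f k) h) \<longlonglongrightarrow> l2_inner \<Omega> F h"
proof -
  have "(\<lambda>k. l2_inner \<Omega> (f k) h - l2_inner \<Omega> F h) \<longlonglongrightarrow> 0"
  proof (rule Lim_null_comparison)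
    show "\<forall>\<^sub>F k in sequentially. norm (l2_inner \<Omega> (f k) h - l2_inner \<Omega> F h)
        \<le> l2_norm \<Omega> (\<lambda>x. f k x - F x) * l2_norm \<Omega> h"
      using l2_Cauchy_Schwarz[OF L2_diff[OF assms(1,2)] assms(3)]
      by (auto simp: l2_inner_diff_left[OF assms(1,2,3)])
    show "(\<lambda>k. l2_norm \<Omega> (\<lambda>x. f k x - F x) * l2_norm \<Omega> h) \<longlonglongrightarrow> 0"
      using tendsto_mult_right[OF assms(4), of "l2_norm \<Omega> h"] by simp
  qed
  then show ?thesis by (simp add: LIM_zero_iff)
qed

section \<open>Orthonormal systems, Bessel's inequality and Fourier series\<close>

definition orthonormal :: "'a::euclidean_space set \<Rightarrow> (nat \<Rightarrow> 'a \<Rightarrow> real) \<Rightarrow> bool" where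
  "orthonormal \<Omega> \<phi> \<longleftrightarrow> (\<forall>n. \<phi> n \<in> L2 \<Omega>) \<and> (\<forall>m n. l2_inner \<Omega> (\<phi> m) (\<phi> n) = (if m = n then 1 else 0))"

lemma orthonormal_L2: "orthonormal \<Omega> \<phi> \<Longrightarrow> \<phi> n \<in> L2 \<Omega>"
  by (simp add: orthonormal_def)

lemma orthonormal_comb_L2: "orthonormal \<Omega> \<phi> \<Longrightarrow> (\<lambda>x. \<Sum>n\<in>I. c n * \<phi> n x) \<in> L2 \<Omega>"
  by (intro L2_sum L2_cmult orthonormal_L2)

lemma orthonormal_comb_inner:
  assumes "orthonormal \<Omega> \<phi>" "finite I"
  shows "l2_inner \<Omega> (\<lambda>x. \<Sum>n\<in>I. c n * \<phi> n x) (\<phi> m) = (if m \<in> I then c m else 0)"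
proof -
  have "l2_inner \<Omega> (\<lambda>x. \<Sum>n\<in>I. c n * \<phi> n x) (\<phi> m) = (\<Sum>n\<in>I. c n * l2_inner \<Omega> (\<phi> n) (\<phi> m))"
    by (subst l2_inner_sum_left) (auto intro: L2_cmult orthonormal_L2 assms simp: l2_inner_cmult_left)
  also have "\<dots> = (\<Sum>n\<in>I. if m = n then c n else 0)"
    by (rule sum.cong) (use assms(1) in \<open>auto simp: orthonormal_def\<close>)
  finally show ?thesis using assms(2) by simp
qed

lemma orthonormal_comb_inner':
  assumes "orthonormal \<Omega> \<phi>" "f \<in> L2 \<Omega>"
  shows "l2_inner \<Omega> f (\<lambda>x. \<Sum>n\<in>I. c n * \<phi> n x) = (\<Sum>n\<in>I. c n * l2_inner \<Omega> f (\<phi> n))"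
proof -
  have "l2_inner \<Omega> (\<lambda>x. \<Sum>n\<in>I. c n * \<phi> n x) f = (\<Sum>n\<in>I. l2_inner \<Omega> (\<lambda>x. c n * \<phi> n x) f)"
    by (rule l2_inner_sum_left) (auto intro: L2_cmult orthonormal_L2 assms)
  then show ?thesis
    by (simp add: l2_inner_cmult_left l2_inner_commute[of \<Omega> f])
qed

text \<open>Completing the square in the coefficients. Bessel's inequality and the optimality of the
  Fourier coefficients are both read off from this identity.\<close>

lemma orthonormal_dist:
  assumes "orthonormal \<Omega> \<phi>" "finite I" "f \<in> L2 \<Omega>"
  shows "(l2_norm \<Omega> (\<lambda>x. f x - (\<Sum>n\<in>I. c n * \<phi> n x)))\<^sup>2
    = l2_inner \<Omega> f f - (\<Sum>n\<in>I. (l2_inner \<Omega> f (\<phi> n))\<^sup>2) + (\<Sum>n\<in>I. (c n - l2_inner \<Omega> f (\<phi> n))\<^sup>2)"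
proof -
  note S = orthonormal_comb_L2[OF assms(1), of c I]
  have "(l2_norm \<Omega> (\<lambda>x. f x - (\<Sum>n\<in>I. c n * \<phi> n x)))\<^sup>2
     = l2_inner \<Omega> f f - 2 * (\<Sum>n\<in>I. c n * l2_inner \<Omega> f (\<phi> n)) + (\<Sum>n\<in>I. c n * c n)"
    using assms by (simp add: l2_norm_power2 l2_inner_diff_self[OF assms(3) S]
        orthonormal_comb_inner'[OF assms(1) S] orthonormal_comb_inner'[OF assms(1,3)]
        orthonormal_comb_inner[OF assms(1,2)])
  also have "\<dots> = l2_inner \<Omega> f f - (\<Sum>n\<in>I. (l2_inner \<Omega> f (\<phi> n))\<^sup>2)
       + (\<Sum>n\<in>I. (c n - l2_inner \<Omega> f (\<phi> n))\<^sup>2)"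
    by (simp add: power2_eq_square algebra_simps sum.distrib sum_subtractf sum_distrib_left)
  finally show ?thesis .
qed

lemma Bessel_inequality:
  assumes "orthonormal \<Omega> \<phi>" "finite I" "f \<in> L2 \<Omega>"
  shows "(\<Sum>n\<in>I. (l2_inner \<Omega> f (\<phi> n))\<^sup>2) \<le> l2_inner \<Omega> f f"
  using orthonormal_dist[OF assms, of "\<lambda>n. l2_inner \<Omega> f (\<phi> n)"]
    zero_le_power2[of "l2_norm \<Omega> (\<lambda>x. f x - (\<Sum>n\<in>I. l2_inner \<Omega> f (\<phi> n) * \<phi> n x))"]
  by simp

text \<open>Among all combinations of the first \<open>N\<close> functions the Fourier partial sum
  is closest to \<open>f\<close>, and further terms do not increase the distance. One good
  approximation with arbitrary coefficients therefore controls all later partial sums.\<close>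

lemma Fourier_expansion:
  assumes "orthonormal \<Omega> \<phi>" "f \<in> L2 \<Omega>"
    and dense: "\<And>e. 0 < e \<Longrightarrow> \<exists>N c. l2_norm \<Omega> (\<lambda>x. f x - (\<Sum>n<N::nat. c n * \<phi> n x)) < e"
  shows "(\<lambda>N. l2_norm \<Omega> (\<lambda>x. f x - (\<Sum>n<N. l2_inner \<Omega> f (\<phi> n) * \<phi> n x))) \<longlonglongrightarrow> 0"
proof (rule LIMSEQ_I)
  fix e :: real assume "0 < e"
  then obtain N c where Nc: "l2_norm \<Omega> (\<lambda>x. f x - (\<Sum>n<N. c n * \<phi> n x)) < e"
    using dense by blast
  have "l2_norm \<Omega> (\<lambda>x. f x - (\<Sum>n<m. l2_inner \<Omega> f (\<phi> n) * \<phi> n x)) < e" if "N \<le> m" for m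
  proof -
    have "(\<Sum>n<N. (l2_inner \<Omega> f (\<phi> n))\<^sup>2) \<le> (\<Sum>n<m. (l2_inner \<Omega> f (\<phi> n))\<^sup>2)"
      using that by (intro sum_mono2) auto
    then have "(l2_norm \<Omega> (\<lambda>x. f x - (\<Sum>n<m. l2_inner \<Omega> f (\<phi> n) * \<phi> n x)))\<^sup>2
       \<le> (l2_norm \<Omega> (\<lambda>x. f x - (\<Sum>n<N. c n * \<phi> n x)))\<^sup>2"
      by (simp add: orthonormal_dist[OF assms(1) _ assms(2)]) (smt (verit) sum_nonneg zero_le_power2)
    then show ?thesis
      using Nc l2_norm_nonneg power2_le_imp_le by (smt (verit, best))
  qed
  then show "\<exists>no. \<forall>n\<ge>no. norm (l2_norm \<Omega> (\<lambda>x. f x - (\<Sum>n<n. l2_inner \<Omega> f (\<phi> n) * \<phi> n x)) - 0) < e"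
    by (auto simp: l2_norm_nonneg)
qed

section \<open>Positivity of the Mittag-Leffler kernel\<close>

text \<open>Euler's integral restricted to \<open>{R..R+1}\<close>, with the power estimated at the
  left end and the exponential at the right end. As \<open>R\<close> is free, \<open>Gamma\<close>
  outgrows every geometric sequence, which makes the Mittag-Leffler series converge for all
  arguments.\<close>

lemma Gamma_ge_powr:
  fixes x R :: real
  assumes "1 \<le> x" "0 < R"
  shows "R powr (x - 1) / exp (R + 1) \<le> Gamma x"
proof -
  have G: "((\<lambda>t. t powr (x - 1) / exp t) has_integral Gamma x) {0..}"
    using assms by (intro Gamma_integral_real) auto
  have C: "((\<lambda>t::real. R powr (x - 1) / exp (R + 1)) has_integral (R powr (x - 1) / exp (R + 1))) {R..R+1}"
    using has_integral_const_real[of "R powr (x - 1) / exp (R + 1)" R "R + 1"] by simp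
  have I: "(\<lambda>t. t powr (x - 1) / exp t) integrable_on {R..R+1}"
    by (rule integrable_on_subinterval[of _ "{0..}"]) (use G assms in auto)
  have "R powr (x - 1) / exp (R + 1) \<le> integral {R..R+1} (\<lambda>t. t powr (x - 1) / exp t)"
    by (rule has_integral_le[OF C integrable_integral[OF I]])
       (use assms in \<open>auto intro!: frac_le powr_mono2\<close>)
  also have "\<dots> \<le> integral {0..} (\<lambda>t. t powr (x - 1) / exp t)"
    by (rule integral_subset_le) (use I G assms in auto)
  finally show ?thesis using G by (simp add: integral_unique)
qed

lemma mittag_leffler_summable:
  fixes \<alpha> \<beta> z :: real
  assumes "0 < \<alpha>"
  shows "summable (\<lambda>k. z ^ k / Gamma (\<alpha> * real k + \<beta>))"
proof -
  \<comment> \<open>Chosen so that \<open>R powr \<alpha>\<close> is at least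
    \<open>2 * |z|\<close>, which makes the terms decay like \<open>(1/2)^k\<close>; the
    \<open>max 1\<close> keeps \<open>R\<close> positive for \<open>z = 0\<close>.\<close>
  define R where "R = max 1 ((2 * \<bar>z\<bar>) powr (1 / \<alpha>))"
  have R1: "R \<ge> 1" by (simp add: R_def)
  have "2 * \<bar>z\<bar> = ((2 * \<bar>z\<bar>) powr (1 / \<alpha>)) powr \<alpha>"
    using assms by (simp add: powr_powr)
  also have "\<dots> \<le> R powr \<alpha>"
    using assms by (intro powr_mono2) (auto simp: R_def)
  finally have zR: "2 * \<bar>z\<bar> \<le> R powr \<alpha>" .
  define K where "K = exp (R + 1) * R powr (1 - \<beta>)"
  have "filterlim (\<lambda>k. \<alpha> * real k + \<beta>) at_top sequentially"
    using assms by real_asymp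
  then have ev: "\<forall>\<^sub>F k in sequentially. 1 \<le> \<alpha> * real k + \<beta>"
    by (simp add: filterlim_at_top)
  show ?thesis
  proof (rule summable_comparison_test_ev)
    show "summable (\<lambda>k. K * (1 / 2) ^ k)"
      by (intro summable_mult summable_geometric) auto
    show "\<forall>\<^sub>F k in sequentially. norm (z ^ k / Gamma (\<alpha> * real k + \<beta>)) \<le> K * (1 / 2) ^ k"
      using ev
    proof eventually_elim
      case (elim k)
      define x where "x = \<alpha> * real k + \<beta>"
      have G: "R powr (x - 1) / exp (R + 1) \<le> Gamma x"
        using Gamma_ge_powr[of x R] elim R1 by (simp add: x_def)
      have Gp: "Gamma x > 0" using elim by (intro Gamma_real_pos) (simp add: x_def)
      have e: "R powr (x - 1) = (R powr \<alpha>) ^ k * R powr (\<beta> - 1)"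
        using R1 by (simp add: x_def powr_add[symmetric] powr_realpow[symmetric] powr_powr algebra_simps)
      have "norm (z ^ k / Gamma x) = \<bar>z\<bar> ^ k / Gamma x"
        using Gp by (simp add: power_abs)
      also have "\<dots> \<le> \<bar>z\<bar> ^ k / (R powr (x - 1) / exp (R + 1))"
        by (intro divide_left_mono G mult_pos_pos Gp) (use R1 in auto)
      also have "\<dots> = \<bar>z\<bar> ^ k * exp (R + 1) / ((R powr \<alpha>) ^ k * R powr (\<beta> - 1))"
        by (simp add: e)
      also have "\<dots> = K * (\<bar>z\<bar> / R powr \<alpha>) ^ k"
        by (simp add: K_def power_divide powr_diff field_simps)
      also have "\<dots> \<le> K * (1 / 2) ^ k"
        using zR R1 by (intro mult_left_mono power_mono) (auto simp: K_def field_simps)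
      finally show ?case by (simp add: x_def)
    qed
  qed
qed

lemma mittag_leffler_conv_powser:
  "mittag_leffler \<alpha> \<beta> = (\<lambda>z. \<Sum>k. (1 / Gamma (\<alpha> * real k + \<beta>)) * z ^ k)"
  by (simp add: mittag_leffler_def fun_eq_iff)

lemma mittag_leffler_0: "mittag_leffler \<alpha> \<beta> 0 = 1 / Gamma \<beta>"
  unfolding mittag_leffler_conv_powser by (subst powser_zero) simp

lemma mittag_leffler_has_derivative:
  assumes "0 < \<alpha>"
  shows "\<exists>D. (mittag_leffler \<alpha> \<beta> has_real_derivative D) (at z)"
  unfolding mittag_leffler_conv_powser
  by (rule exI, rule termdiffs_strong_converges_everywhere)
     (use mittag_leffler_summable[OF assms] in simp)

lemma continuous_on_mittag_leffler:
  assumes "0 < \<alpha>" shows "continuous_on A (mittag_leffler \<alpha> \<beta>)"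
proof (rule continuous_at_imp_continuous_on, rule ballI)
  fix z show "isCont (mittag_leffler \<alpha> \<beta>) z"
    using mittag_leffler_has_derivative[OF assms, of \<beta> z] DERIV_isCont by blast
qed

text \<open>With \<open>x = \<alpha> (k + 1)\<close>, the functional equation
  \<open>Gamma (x + 1) = x * Gamma x\<close> cancels the factor \<open>k + 1\<close> produced by
  differentiation and leaves \<open>1 / \<alpha>\<close>.\<close>

lemma mittag_leffler_deriv:
  assumes "0 < \<alpha>"
  shows "(mittag_leffler \<alpha> 1 has_real_derivative mittag_leffler \<alpha> \<alpha> z / \<alpha>) (at z)"
proof -
  define c where "c k = 1 / Gamma (\<alpha> * real k + 1)" for k :: nat
  have s: "summable (\<lambda>k. c k * y ^ k)" for y
    using mittag_leffler_summable[OF assms, of y 1] by (simp add: c_def)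
  have d: "diffs c k = 1 / Gamma (\<alpha> * real k + \<alpha>) / \<alpha>" for k
  proof -
    define x where "x = \<alpha> * real k + \<alpha>"
    have x0: "x > 0" using assms by (simp add: x_def add_nonneg_pos)
    have "Gamma (x + 1) = x * Gamma x"
      using x0 by (intro Gamma_plus1) (auto elim!: nonpos_Ints_cases)
    moreover have x: "x = \<alpha> * real (Suc k)" by (simp add: x_def algebra_simps)
    moreover have "diffs c k = real (Suc k) / Gamma (x + 1)"
      by (simp add: diffs_def c_def x del: of_nat_Suc)
    ultimately have "diffs c k = real (Suc k) / ((\<alpha> * real (Suc k)) * Gamma x)"
      by metis
    also have "\<dots> = 1 / Gamma x / \<alpha>"
      by (simp del: of_nat_Suc)
    finally show ?thesis by (simp add: x_def)
  qed
  have "((\<lambda>z. \<Sum>k. c k * z ^ k) has_real_derivative (\<Sum>k. diffs c k * z ^ k)) (at z)"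
    by (rule termdiffs_strong_converges_everywhere[OF s])
  moreover have "(\<Sum>k. diffs c k * z ^ k) = (\<Sum>k. z ^ k / Gamma (\<alpha> * real k + \<alpha>)) / \<alpha>"
    by (subst suminf_divide[symmetric]) (use mittag_leffler_summable[OF assms] in \<open>auto simp: d mult.commute\<close>)
  ultimately show ?thesis
    by (simp add: mittag_leffler_conv_powser c_def)
qed

section \<open>The Mittag-Leffler kernel, its primitive and its convolution with a power\<close>

definition ml_kernel :: "real \<Rightarrow> real \<Rightarrow> real \<Rightarrow> real" where
  "ml_kernel \<alpha> l s = s powr (\<alpha> - 1) * mittag_leffler \<alpha> \<alpha> (- l * s powr \<alpha>)"

lemma mittag_leffler_powr_deriv:
  assumes "0 < \<alpha>" "0 < t"
  shows "((\<lambda>t. mittag_leffler \<alpha> 1 (- l * t powr \<alpha>)) has_real_derivative - l * ml_kernel \<alpha> l t) (at t)"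
proof -
  have "((\<lambda>t. - l * t powr \<alpha>) has_real_derivative - l * (\<alpha> * t powr (\<alpha> - 1))) (at t)"
    using assms by (auto intro!: derivative_eq_intros)
  from DERIV_chain2[OF mittag_leffler_deriv[OF assms(1)] this]
  show ?thesis using assms by (simp add: ml_kernel_def mult_ac)
qed

text \<open>For \<open>\<alpha> < 1\<close> the kernel is singular at \<open>0\<close> like
  \<open>s powr (\<alpha> - 1)\<close>, while its primitive is still continuous there; hence the
  fundamental theorem with derivatives in the interior only.\<close>

lemma ml_kernel_has_integral:
  assumes "0 < \<alpha>" "0 \<le> t"
  shows "((\<lambda>s. l * ml_kernel \<alpha> l s) has_integral 1 - mittag_leffler \<alpha> 1 (- l * t powr \<alpha>)) {0..t}"
proof -
  have "continuous_on {0..t} (\<lambda>t. - l * t powr \<alpha>)"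
    by (intro continuous_intros continuous_on_powr') (use assms in auto)
  then have c: "continuous_on {0..t} (\<lambda>t. mittag_leffler \<alpha> 1 (- l * t powr \<alpha>))"
    by (rule continuous_on_compose2[OF continuous_on_mittag_leffler[OF assms(1), of UNIV]]) auto
  have "((\<lambda>s. - l * ml_kernel \<alpha> l s) has_integral
      mittag_leffler \<alpha> 1 (- l * t powr \<alpha>) - mittag_leffler \<alpha> 1 (- l * 0 powr \<alpha>)) {0..t}"
    by (rule fundamental_theorem_of_calculus_interior[OF assms(2) c])
       (use mittag_leffler_powr_deriv[OF assms(1)] in \<open>auto simp: has_real_derivative_iff_has_vector_derivative\<close>)
  from has_integral_neg[OF this] show ?thesis by (simp add: mittag_leffler_0)
qed

lemma Beta_integral_scaled:
  fixes a b t :: real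
  assumes "0 < a" "0 < b" "0 < t"
  shows "((\<lambda>s. s powr (a - 1) * (t - s) powr (b - 1)) has_integral t powr (a + b - 1) * Beta a b) {0..t}"
proof -
  have "((\<lambda>s. (1/t * s + 0) powr (a - 1) * (1 - (1/t * s + 0)) powr (b - 1)) has_integral
      (1 / \<bar>1/t\<bar> ^ DIM(real)) *\<^sub>R Beta a b) ((\<lambda>x. (1 / (1/t)) *\<^sub>R x + - ((1 / (1/t)) *\<^sub>R 0)) ` cbox 0 1)"
    using has_integral_affinity[of "\<lambda>t. t powr (a - 1) * (1 - t) powr (b - 1)" "Beta a b" 0 1 "1/t" 0]
      has_integral_Beta_real[OF assms(1,2)] assms(3) by simp
  moreover have "(\<lambda>x. (1 / (1/t)) *\<^sub>R x + - ((1 / (1/t)) *\<^sub>R 0)) ` cbox 0 1 = {0..t}"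
    using assms(3) by (auto simp: image_mult_atLeastAtMost)
  ultimately have *: "((\<lambda>s. (s / t) powr (a - 1) * (1 - s / t) powr (b - 1)) has_integral t * Beta a b) {0..t}"
    using assms(3) by simp
  have h: "((\<lambda>s. t powr (a + b - 2) * ((s / t) powr (a - 1) * (1 - s / t) powr (b - 1))) has_integral
     t powr (a + b - 2) * (t * Beta a b)) {0..t}"
    by (rule has_integral_mult_right[OF *])
  moreover have v: "t powr (a + b - 2) * (t * Beta a b) = t powr (a + b - 1) * Beta a b"
    using assms(3) powr_mult_base[of t "a + b - 2"] by (simp add: algebra_simps)
  moreover have p: "t powr (a + b - 2) * ((s / t) powr (a - 1) * (1 - s / t) powr (b - 1))
      = s powr (a - 1) * (t - s) powr (b - 1)" if "s \<in> {0..t}" for s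
  proof -
    have "1 - s / t = (t - s) / t" using assms(3) by (simp add: field_simps)
    moreover have "t powr (a + b - 2) = t powr (a - 1) * t powr (b - 1)"
      by (simp add: powr_add[symmetric])
    ultimately show ?thesis
      using that assms(3) by (simp add: powr_divide)
  qed
  ultimately show ?thesis using has_integral_eq[OF p h] by (simp only: v)
qed

text \<open>Up to the factor \<open>Gamma (1 - \<alpha>)\<close> this is the fractional integral of
  order \<open>1 - \<alpha>\<close>. By the Beta integral it sends \<open>s^(\<alpha> j + \<alpha> -
  1) / Gamma (\<alpha> j + \<alpha>)\<close> to
  \<open>t^(\<alpha> j) / Gamma (\<alpha> j + 1)\<close>, term by term from the series of
  \<open>E_(\<alpha>,\<alpha>)\<close> to that of \<open>E_(\<alpha>,1)\<close>. The absolute values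
  sum to the same series at a positive argument, which justifies the exchange.\<close>

lemma ml_kernel_convolution:
  fixes \<alpha> t :: real
  assumes "0 < \<alpha>" "\<alpha> < 1" "0 < t"
  shows "((\<lambda>s. (t - s) powr (- \<alpha>) * ml_kernel \<alpha> 1 s) has_integral
            Gamma (1 - \<alpha>) * mittag_leffler \<alpha> 1 (- (t powr \<alpha>))) {0..t}"
proof -
  let ?M = "lebesgue_on {0..t}"
  define f where "f j s = (-1) ^ j / Gamma (\<alpha> * real j + \<alpha>) *
     (s powr (\<alpha> * real j + \<alpha> - 1) * (t - s) powr (- \<alpha>))" for j :: nat and s
  define B where "B j = t powr (\<alpha> * real j) * Gamma (1 - \<alpha>) / Gamma (\<alpha> * real j + 1)" for j :: nat
  have pos: "0 < \<alpha> * real j + \<alpha>" for j using assms by (simp add: add_nonneg_pos)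
  have Gpos: "0 < Gamma (\<alpha> * real j + \<alpha>)" for j using pos by (rule Gamma_real_pos)
  have hi: "((\<lambda>s. s powr (\<alpha> * real j + \<alpha> - 1) * (t - s) powr (- \<alpha>)) has_integral
      Gamma (\<alpha> * real j + \<alpha>) * B j) {0..t}" for j
  proof -
    have "t powr (\<alpha> * real j + \<alpha> + (1 - \<alpha>) - 1) * Beta (\<alpha> * real j + \<alpha>) (1 - \<alpha>)
       = Gamma (\<alpha> * real j + \<alpha>) * B j"
      by (simp add: B_def Beta_def add.assoc)
    then show ?thesis
      using Beta_integral_scaled[of "\<alpha> * real j + \<alpha>" "1 - \<alpha>" t] pos[of j] assms by simp
  qed
  have ai: "(\<lambda>s. s powr (\<alpha> * real j + \<alpha> - 1) * (t - s) powr (- \<alpha>)) absolutely_integrable_on {0..t}" for j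
    by (rule nonnegative_absolutely_integrable_1) (use hi[of j] in auto)
  have int0: "integrable ?M (\<lambda>s. s powr (\<alpha> * real j + \<alpha> - 1) * (t - s) powr (- \<alpha>))" for j
    using ai[of j] by (simp add: integrable_restrict_space set_integrable_def)
  have val0: "(LINT s|?M. s powr (\<alpha> * real j + \<alpha> - 1) * (t - s) powr (- \<alpha>)) = Gamma (\<alpha> * real j + \<alpha>) * B j" for j
    using lebesgue_integral_eq_integral[OF int0[of j]] hi[of j] by (simp add: integral_unique)
  have int: "integrable ?M (f j)" for j
    unfolding f_def by (intro integrable_mult_right int0)
  have val: "integral\<^sup>L ?M (f j) = (-1) ^ j * B j" for j
    using Gpos[of j] by (simp add: f_def[abs_def] val0)
  have nrm: "norm (f j s) = 1 / Gamma (\<alpha> * real j + \<alpha>) *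
     (s powr (\<alpha> * real j + \<alpha> - 1) * (t - s) powr (- \<alpha>))" for j s
    using Gpos[of j] by (simp add: f_def abs_mult)
  have valn: "(LINT s|?M. norm (f j s)) = B j" for j
    using Gpos[of j] by (simp only: nrm) (simp add: val0)
  have tp: "t powr (\<alpha> * real j) = (t powr \<alpha>) ^ j" for j
    using assms by (simp add: powr_powr[symmetric] powr_realpow)
  have sB: "summable B"
    using summable_mult2[OF mittag_leffler_summable[OF assms(1), of "t powr \<alpha>" 1], of "Gamma (1 - \<alpha>)"]
    by (simp add: B_def[abs_def] tp)
  have fs: "f j s = ((t - s) powr (- \<alpha>) * s powr (\<alpha> - 1)) * ((- (s powr \<alpha>)) ^ j / Gamma (\<alpha> * real j + \<alpha>))"
    if "s \<in> {0..t}" for j s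
  \<comment> \<open>At \<open>s = 0\<close> both sides vanish, since \<open>0 powr a = 0\<close>
    also for negative \<open>a\<close>.\<close>
  proof (cases "s = 0")
    case False
    then have s: "s > 0" using that by simp
    have "s powr (\<alpha> * real j + \<alpha> - 1) = s powr (\<alpha> * real j) * s powr (\<alpha> - 1)"
      by (simp add: powr_add[symmetric] algebra_simps)
    also have "s powr (\<alpha> * real j) = (s powr \<alpha>) ^ j"
      using s by (simp add: powr_powr[symmetric] powr_realpow)
    finally show ?thesis by (simp add: f_def power_minus[of "s powr \<alpha>"])
  qed (simp add: f_def)
  have sm: "summable (\<lambda>j. (- (s powr \<alpha>)) ^ j / Gamma (\<alpha> * real j + \<alpha>))" for s
    by (rule mittag_leffler_summable[OF assms(1)])
  have sumf: "(\<Sum>j. f j s) = (t - s) powr (- \<alpha>) * ml_kernel \<alpha> 1 s" if "s \<in> {0..t}" for s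
    using suminf_mult[OF sm[of s], of "(t - s) powr (- \<alpha>) * s powr (\<alpha> - 1)"] that
    by (simp add: fs ml_kernel_def mittag_leffler_def mult.assoc)
  have AEs: "AE s in ?M. summable (\<lambda>j. norm (f j s))"
  proof (rule AE_I2)
    fix s assume "s \<in> space ?M"
    then have s: "s \<in> {0..t}" by simp
    have "norm (f j s) = ((t - s) powr (- \<alpha>) * s powr (\<alpha> - 1)) * ((s powr \<alpha>) ^ j / Gamma (\<alpha> * real j + \<alpha>))" for j
      using fs[OF s, of j] Gpos[of j] by (simp add: abs_mult power_abs)
    then show "summable (\<lambda>j. norm (f j s))"
      using summable_mult[OF mittag_leffler_summable[OF assms(1), of "s powr \<alpha>" \<alpha>]] by simp
  qed
  have sn: "summable (\<lambda>j. LINT s|?M. norm (f j s))" using sB by (simp only: valn)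
  note sm' = integral_suminf[OF int AEs sn] and i' = integrable_suminf[OF int AEs sn]
  have i2: "integrable ?M (\<lambda>s. (t - s) powr (- \<alpha>) * ml_kernel \<alpha> 1 s)"
    by (rule Bochner_Integration.integrable_cong[THEN iffD1, OF refl _ i']) (simp add: sumf)
  have "(LINT s|?M. (t - s) powr (- \<alpha>) * ml_kernel \<alpha> 1 s) = (LINT s|?M. (\<Sum>j. f j s))"
    by (rule Bochner_Integration.integral_cong) (simp_all add: sumf)
  also have "\<dots> = (\<Sum>j. (-1) ^ j * B j)" by (simp add: sm' val)
  also have "\<dots> = (\<Sum>j. Gamma (1 - \<alpha>) * ((- (t powr \<alpha>)) ^ j / Gamma (\<alpha> * real j + 1)))"
    by (simp add: B_def tp power_minus[of "t powr \<alpha>"] mult_ac)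
  also have "\<dots> = Gamma (1 - \<alpha>) * mittag_leffler \<alpha> 1 (- (t powr \<alpha>))"
    unfolding mittag_leffler_def by (rule suminf_mult[OF mittag_leffler_summable[OF assms(1)]])
  finally show ?thesis
    using has_integral_integral_lebesgue_on[OF i2] by simp
qed

text \<open>Mean value theorem. The common upper bound \<open>b\<close> gives a rate of decrease of
  \<open>x powr (- \<alpha>)\<close> that does not depend on the two points; it quantifies how much
  the weights drop in \<open>mittag_leffler_neg_pos\<close>.\<close>

lemma powr_minus_diff_ge:
  fixes \<alpha> x y b :: real
  assumes "0 < \<alpha>" "0 < x" "x < y" "y \<le> b"
  shows "\<alpha> * b powr (- \<alpha> - 1) * (y - x) \<le> x powr (- \<alpha>) - y powr (- \<alpha>)"
proof -
  have "\<exists>z. x < z \<and> z < y \<and> y powr (- \<alpha>) - x powr (- \<alpha>) = (y - x) * (- \<alpha> * z powr (- \<alpha> - 1))"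
    by (rule MVT2[OF assms(3)]) (use assms in \<open>auto intro!: derivative_eq_intros\<close>)
  then obtain z where z: "x < z" "z < y" "y powr (- \<alpha>) - x powr (- \<alpha>) = (y - x) * (- \<alpha> * z powr (- \<alpha> - 1))"
    by blast
  have "b powr (- \<alpha> - 1) \<le> z powr (- \<alpha> - 1)"
    using z assms by (intro powr_mono2') auto
  then have "\<alpha> * b powr (- \<alpha> - 1) * (y - x) \<le> \<alpha> * z powr (- \<alpha> - 1) * (y - x)"
    using assms by (intro mult_right_mono mult_left_mono) auto
  then show ?thesis using z(3) by (simp add: algebra_simps)
qed

text \<open>At a first zero \<open>t\<^sub>1\<close> of the kernel \<open>k(t) = t\<^sup>\<alpha>\<^sup>-\<^sup>1 E\<^sub>\<alpha>\<^sub>,\<^sub>\<alpha>(-t\<^sup>\<alpha>)\<close> the convolution of \<open>k\<close> with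
  \<open>t\<^sup>-\<^sup>\<alpha>\<close> would be strictly decreasing, as the weights decrease and \<open>k > 0\<close> before \<open>t\<^sub>1\<close>; but its
  derivative is a multiple of \<open>k\<close>, which vanishes at \<open>t\<^sub>1\<close>.\<close>

lemma mittag_leffler_neg_pos:
  fixes \<alpha> x :: real
  assumes a: "0 < \<alpha>" "\<alpha> < 1" and x: "0 \<le> x"
  shows "0 < mittag_leffler \<alpha> \<alpha> (- x)"
proof (rule ccontr)
  assume neg: "\<not> 0 < mittag_leffler \<alpha> \<alpha> (- x)"
  define e where "e x = mittag_leffler \<alpha> \<alpha> (- x)" for x
  define m where "m t = mittag_leffler \<alpha> 1 (- (t powr \<alpha>))" for t
  define k where "k = ml_kernel \<alpha> 1"
  have ce: "continuous_on A e" for A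
    unfolding e_def
    by (rule continuous_on_compose2[OF continuous_on_mittag_leffler[OF a(1), of UNIV]]) (auto intro!: continuous_intros)
  have e0: "e 0 > 0" using a Gamma_real_pos[of \<alpha>] by (simp add: e_def mittag_leffler_0)
  \<comment> \<open>The least element of this compact set is the first zero of
    \<open>e\<close>.\<close>
  define Z where "Z = {z \<in> {0..x}. e z \<le> 0}"
  have "Z = {0..x} \<inter> {z. e z \<le> 0}" by (auto simp: Z_def)
  then have "closed Z"
    by (auto intro!: closed_Int closed_Collect_le ce)
  moreover have "bounded Z" by (rule bounded_subset[OF bounded_closed_interval[of 0 x]]) (auto simp: Z_def)
  ultimately have "compact Z" by (simp add: compact_eq_bounded_closed)
  moreover have "Z \<noteq> {}" using neg x by (auto simp: Z_def e_def)
  ultimately have "\<exists>z\<in>Z. \<forall>y\<in>Z. z \<le> y" by (rule compact_attains_inf)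
  then obtain z where z: "z \<in> Z" "\<And>y. y \<in> Z \<Longrightarrow> z \<le> y" by blast
  have z0: "z > 0" using z(1) e0 by (cases "z = 0") (auto simp: Z_def)
  have before: "e y > 0" if "0 \<le> y" "y < z" for y
  proof (rule ccontr)
    assume "\<not> e y > 0"
    then have "y \<in> Z" using that z(1) by (auto simp: Z_def)
    then show False using z(2) that by force
  qed
  have ez: "e z = 0"
  proof (rule antisym)
    show "e z \<le> 0" using z by (simp add: Z_def)
    have "closure {0..<z} = {0..z}" using z0 by simp
    moreover have "\<And>y. y \<in> {0..<z} \<Longrightarrow> 0 \<le> e y" using before by (auto intro: less_imp_le)
    ultimately show "0 \<le> e z"
      using continuous_ge_on_closure[of "{0..<z}" e z 0] ce z0 by auto
  qed
  define t1 where "t1 = z powr (1 / \<alpha>)"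
  have t1: "t1 > 0" "t1 powr \<alpha> = z" using z0 a by (auto simp: t1_def powr_powr)
  have k: "k s = s powr (\<alpha> - 1) * e (s powr \<alpha>)" for s by (simp add: k_def ml_kernel_def e_def)
  have kpos: "k s > 0" if "0 < s" "s < t1" for s
    using that t1 a by (auto simp: k intro!: mult_pos_pos before powr_less_mono2 simp flip: t1(2))
  have kt1: "k t1 = 0" by (simp add: k t1 ez)
  have knn: "k s \<ge> 0" if "0 \<le> s" "s \<le> t1" for s
    using that kpos[of s] kt1 by (cases "s = 0"; cases "s = t1") (auto simp: k)
  have "\<exists>D. (k has_real_derivative D) (at t1)"
  proof -
    obtain D where D: "(mittag_leffler \<alpha> \<alpha> has_real_derivative D) (at (- (t1 powr \<alpha>)))"
      using mittag_leffler_has_derivative[OF a(1)] by blast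
    have "((\<lambda>t. - (t powr \<alpha>)) has_real_derivative - (\<alpha> * t1 powr (\<alpha> - 1))) (at t1)"
      using t1 by (auto intro!: derivative_eq_intros)
    from DERIV_chain2[OF D this] obtain D' where D': "((\<lambda>s. e (s powr \<alpha>)) has_real_derivative D') (at t1)"
      unfolding e_def by blast
    have "((\<lambda>t. t powr (\<alpha> - 1)) has_real_derivative ((\<alpha> - 1) * t1 powr (\<alpha> - 1 - 1))) (at t1)"
      using t1 by (auto intro!: derivative_eq_intros)
    from DERIV_mult[OF this D'] show ?thesis unfolding k[abs_def] by blast
  qed
  then obtain D where D: "(k has_real_derivative D) (at t1)" by blast
  \<comment> \<open>Any slope above \<open>|D|\<close> would do. Since \<open>k\<close> vanishes at
    \<open>t1\<close>, it is at most \<open>L * (t1 - s)\<close> just before, which tames the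
    singular weight \<open>(t1 - s) powr (- \<alpha>)\<close> there.\<close>
  define L where "L = \<bar>D\<bar> + 1"
  have "((\<lambda>s. (k s - k t1) / (s - t1)) \<longlongrightarrow> D) (at t1)"
    using D by (simp add: has_field_derivative_iff)
  then have "((\<lambda>s. \<bar>k s / (s - t1)\<bar>) \<longlongrightarrow> \<bar>D\<bar>) (at t1)"
    using tendsto_rabs kt1 by fastforce
  then have "\<forall>\<^sub>F s in at t1. \<bar>k s / (s - t1)\<bar> < L"
    by (rule order_tendstoD) (simp add: L_def)
  then obtain d where d: "d > 0" "\<And>s. s \<noteq> t1 \<Longrightarrow> \<bar>s - t1\<bar> < d \<Longrightarrow> \<bar>k s / (s - t1)\<bar> < L"
    by (auto simp: eventually_at dist_real_def)
  have kL: "k s \<le> L * (t1 - s)" if "t1 - d < s" "s \<le> t1" for s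
  proof (cases "s = t1")
    case False
    then have "\<bar>k s\<bar> < L * \<bar>s - t1\<bar>" using d(2)[of s] that by (simp add: divide_less_eq abs_divide)
    then show ?thesis using that by simp
  qed (simp add: kt1)
  have m': "(m has_real_derivative - k t) (at t)" if "t > 0" for t
    using mittag_leffler_powr_deriv[OF a(1) that, of 1] by (simp add: m_def[abs_def] k_def)
  have kint: "(k has_integral 1 - m t) {0..t}" if "0 \<le> t" for t
    using ml_kernel_has_integral[OF a(1) that, of 1] by (simp add: m_def k_def)
  \<comment> \<open>The mass of \<open>k\<close> on the first half of the interval: a fixed positive
    lower bound for its mass on \<open>{0..t}\<close> when \<open>t > t1 / 2\<close>.\<close>
  define K where "K = 1 - m (t1 / 2)"
  have "m (t1 / 2) < m (t1 / 4)"
  proof (rule DERIV_neg_imp_decreasing[where f = m])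
    fix s assume "t1 / 4 \<le> s" "s \<le> t1 / 2"
    then show "\<exists>y. (m has_real_derivative y) (at s) \<and> y < 0"
      using m'[of s] kpos[of s] t1 by (intro exI[of _ "- k s"]) auto
  qed (use t1 in auto)
  moreover have "0 \<le> 1 - m (t1 / 4)"
    by (rule has_integral_nonneg[OF kint]) (use t1 knn in auto)
  ultimately have K: "K > 0" by (simp add: K_def)
  define c where "c = \<alpha> * t1 powr (- \<alpha> - 1)"
  have c: "c > 0" using a t1 by (simp add: c_def)
  define \<Gamma> where "\<Gamma> = Gamma (1 - \<alpha>)"
  have \<Gamma>: "\<Gamma> > 0" using a by (auto simp: \<Gamma>_def intro!: Gamma_real_pos)
  have conv: "((\<lambda>s. (t - s) powr (- \<alpha>) * k s) has_integral \<Gamma> * m t) {0..t}" if "0 < t" for t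
    using ml_kernel_convolution[OF a that] by (simp add: \<Gamma>_def m_def k_def)
  \<comment> \<open>Comparison of the convolutions at \<open>t\<close> and \<open>t1\<close>. On
    \<open>{0..t}\<close> each weight drops by at least \<open>c * (t1 - t)\<close>, so the integral
    drops by at least \<open>c * (t1 - t) * K\<close>; the piece over \<open>{t..t1}\<close>
    contributes only the order \<open>(t1 - t) powr (2 - \<alpha>)\<close>.\<close>
  have main: "\<Gamma> * m t - \<Gamma> * m t1 \<ge> (t1 - t) * (c * K - L * (t1 - t) powr (1 - \<alpha>))"
    if t: "t1 - d < t" "t1 / 2 < t" "t < t1" for t
  proof -
    let ?g = "\<lambda>s. (t1 - s) powr (- \<alpha>) * k s"
    have t0: "0 < t" using t t1 by simp
    have i: "?g integrable_on {0..t1}" using conv[OF t1(1)] by blast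
    have i1: "?g integrable_on {0..t}" and i2: "?g integrable_on {t..t1}"
      by (rule integrable_on_subinterval[OF i]; use t t0 in auto)+
    have split: "\<Gamma> * m t1 = integral {0..t} ?g + integral {t..t1} ?g"
      using Henstock_Kurzweil_Integration.integral_combine[OF _ _ i, of t] t t0 conv[OF t1(1)]
      by (simp add: integral_unique)
    have "integral {t..t1} ?g \<le> integral {t..t1} (\<lambda>s. L * (t1 - t) powr (1 - \<alpha>))"
    proof (rule integral_le[OF i2])
      fix s assume s: "s \<in> {t..t1}"
      have "?g s \<le> (t1 - s) powr (- \<alpha>) * (L * (t1 - s))"
        using s t by (intro mult_left_mono kL) auto
      also have "\<dots> = L * (t1 - s) powr (1 - \<alpha>)"
        using s powr_mult_base[of "t1 - s" "- \<alpha>"] by (simp add: mult_ac)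
      also have "\<dots> \<le> L * (t1 - t) powr (1 - \<alpha>)"
        using s a by (intro mult_left_mono powr_mono2) (auto simp: L_def)
      finally show "?g s \<le> L * (t1 - t) powr (1 - \<alpha>)" .
    qed (auto intro: integrable_continuous_interval)
    also have "\<dots> = (t1 - t) * (L * (t1 - t) powr (1 - \<alpha>))"
      using t by simp
    finally have A: "integral {t..t1} ?g \<le> (t1 - t) * (L * (t1 - t) powr (1 - \<alpha>))" .
    have "((\<lambda>s. (t - s) powr (- \<alpha>) * k s - ?g s) has_integral \<Gamma> * m t - integral {0..t} ?g) {0..t}"
      by (rule has_integral_diff[OF conv[OF t0] integrable_integral[OF i1]])
    \<comment> \<open>At \<open>s = t\<close> the convention \<open>0 powr (- \<alpha>) = 0\<close>
      breaks the pointwise comparison of the weights, hence the open interval.\<close>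
    then have h1: "((\<lambda>s. (t - s) powr (- \<alpha>) * k s - ?g s) has_integral \<Gamma> * m t - integral {0..t} ?g) {0<..<t}"
      by (simp add: has_integral_Icc_iff_Ioo)
    have "((\<lambda>s. c * (t1 - t) * k s) has_integral c * (t1 - t) * (1 - m t)) {0..t}"
      by (rule has_integral_mult_right[OF kint]) (use t0 in simp)
    then have h2: "((\<lambda>s. c * (t1 - t) * k s) has_integral c * (t1 - t) * (1 - m t)) {0<..<t}"
      by (simp add: has_integral_Icc_iff_Ioo)
    have "c * (t1 - t) * (1 - m t) \<le> \<Gamma> * m t - integral {0..t} ?g"
    proof (rule has_integral_le[OF h2 h1])
      fix s assume s: "s \<in> {0<..<t}"
      have "c * (t1 - t) \<le> (t - s) powr (- \<alpha>) - (t1 - s) powr (- \<alpha>)"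
        using powr_minus_diff_ge[of \<alpha> "t - s" "t1 - s" t1] s t a by (simp add: c_def)
      then have "c * (t1 - t) * k s \<le> ((t - s) powr (- \<alpha>) - (t1 - s) powr (- \<alpha>)) * k s"
        using s t by (intro mult_right_mono knn) auto
      then show "c * (t1 - t) * k s \<le> (t - s) powr (- \<alpha>) * k s - ?g s"
        by (simp add: algebra_simps)
    qed
    moreover have "K \<le> 1 - m t"
    proof -
      have "integral {0..t1/2} k \<le> integral {0..t} k"
        by (rule integral_subset_le) (use t t1 kint[of "t1/2"] kint[of t] knn in \<open>auto\<close>)
      then show ?thesis using kint[of "t1/2"] kint[of t] t t1 by (simp add: K_def integral_unique)
    qed
    then have "c * (t1 - t) * K \<le> c * (t1 - t) * (1 - m t)"
      using c t by (intro mult_left_mono) auto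
    ultimately show ?thesis using A split by (simp add: algebra_simps)
  qed
  have "((\<lambda>t. (m t - m t1) / (t - t1)) \<longlongrightarrow> 0) (at t1)"
    using m'[OF t1(1)] kt1 by (simp add: has_field_derivative_iff)
  then have "((\<lambda>t. (m t - m t1) / (t - t1)) \<longlongrightarrow> 0) (at_left t1)"
    by (rule tendsto_within_subset) simp
  then have lim1: "((\<lambda>t. - \<Gamma> * ((m t - m t1) / (t - t1))) \<longlongrightarrow> - \<Gamma> * 0) (at_left t1)"
    by (rule tendsto_mult_left)
  have ev: "\<forall>\<^sub>F x in at_left t1. 0 \<le> t1 - x"
    using eventually_at_left_real[OF t1(1)] by eventually_elim auto
  have "((\<lambda>t. (t1 - t) powr (1 - \<alpha>)) \<longlongrightarrow> (t1 - t1) powr (1 - \<alpha>)) (at_left t1)"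
    using a by (intro tendsto_powr2[OF tendsto_diff[OF tendsto_const tendsto_ident_at] tendsto_const ev]) simp
  then have "((\<lambda>t. c * K - L * (t1 - t) powr (1 - \<alpha>)) \<longlongrightarrow> c * K - L * (t1 - t1) powr (1 - \<alpha>)) (at_left t1)"
    by (intro tendsto_diff tendsto_mult tendsto_const)
  then have lim2: "((\<lambda>t. c * K - L * (t1 - t) powr (1 - \<alpha>)) \<longlongrightarrow> c * K) (at_left t1)" by simp
  \<comment> \<open>After division by \<open>t1 - t\<close> the comparison passes to the limit from
    the left: the quotient tends to a multiple of \<open>k t1 = 0\<close>, its lower bound to
    \<open>c * K > 0\<close>.\<close>
  have "c * K \<le> - \<Gamma> * 0"
  proof (rule tendsto_le[OF _ lim1 lim2])
    have "\<forall>\<^sub>F t in at_left t1. t \<in> {max (t1 - d) (t1 / 2)<..<t1}"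
      by (rule eventually_at_left_real) (use d t1 in auto)
    then show "\<forall>\<^sub>F t in at_left t1. c * K - L * (t1 - t) powr (1 - \<alpha>) \<le> - \<Gamma> * ((m t - m t1) / (t - t1))"
    proof eventually_elim
      case (elim t)
      then have "t1 - d < t" "t1 / 2 < t" "t < t1" by auto
      from main[OF this] this(3)
      have "c * K - L * (t1 - t) powr (1 - \<alpha>) \<le> (\<Gamma> * m t - \<Gamma> * m t1) / (t1 - t)"
        by (intro mult_imp_le_div_pos) (simp_all only: mult.commute diff_gt_0_iff_gt)
      also have "\<dots> = - \<Gamma> * ((m t - m t1) / (t - t1))"
        using minus_divide_divide[of "\<Gamma> * m t1 - \<Gamma> * m t" "t - t1"] by (simp add: right_diff_distrib')
      finally show ?case .
    qed
  qed simp
  then show False using c K by (simp add: mult_le_0_iff)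
qed

lemma ml_kernel_nonneg: "0 < \<alpha> \<Longrightarrow> \<alpha> < 1 \<Longrightarrow> 0 \<le> l \<Longrightarrow> 0 \<le> ml_kernel \<alpha> l s"
  unfolding ml_kernel_def
  using mittag_leffler_neg_pos[of \<alpha> "l * s powr \<alpha>"] by (intro mult_nonneg_nonneg) auto

text \<open>Once \<open>l\<close> is absorbed into the time variable,
  \<open>ml_kernel_convolution\<close> exhibits a positive multiple of the value as the integral of
  a nonnegative function.\<close>

lemma mittag_leffler_one_neg_nonneg:
  assumes "0 < \<alpha>" "\<alpha> < 1" "0 < l" "0 < t"
  shows "0 \<le> mittag_leffler \<alpha> 1 (- l * t powr \<alpha>)"
proof -
  define r where "r = l powr (1 / \<alpha>) * t"
  have r0: "r > 0" using assms by (simp add: r_def)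
  have r: "r powr \<alpha> = l * t powr \<alpha>" using assms by (simp add: r_def powr_mult powr_powr)
  have "0 \<le> Gamma (1 - \<alpha>) * mittag_leffler \<alpha> 1 (- (r powr \<alpha>))"
  proof (rule has_integral_nonneg[OF ml_kernel_convolution[OF assms(1,2) r0]])
    show "0 \<le> (r - s) powr (- \<alpha>) * ml_kernel \<alpha> 1 s" for s
      using ml_kernel_nonneg[OF assms(1,2), of 1 s] by simp
  qed
  moreover have "0 < Gamma (1 - \<alpha>)" using assms by (intro Gamma_real_pos) simp
  ultimately have "0 \<le> mittag_leffler \<alpha> 1 (- (r powr \<alpha>))" by (simp add: zero_le_mult_iff)
  then show ?thesis by (simp add: r)
qed

text \<open>The sign of the kernel upgrades the gauge integral of
  \<open>ml_kernel_has_integral\<close> to Lebesgue integrability, and the mass is \<open>1\<close>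
  minus a nonnegative number.\<close>

lemma ml_kernel_integrable:
  assumes "0 < \<alpha>" "\<alpha> < 1" "0 < l" "0 < t"
  shows "integrable (lebesgue_on {0..t}) (\<lambda>s. l * ml_kernel \<alpha> l s)"
    and "(LINT s|lebesgue_on {0..t}. l * ml_kernel \<alpha> l s) \<le> 1"
proof -
  note h = ml_kernel_has_integral[OF assms(1) less_imp_le[OF assms(4)], of l]
  have "(\<lambda>s. l * ml_kernel \<alpha> l s) absolutely_integrable_on {0..t}"
  proof (rule nonnegative_absolutely_integrable_1)
    show "(\<lambda>s. l * ml_kernel \<alpha> l s) integrable_on {0..t}" using h by blast
    show "0 \<le> l * ml_kernel \<alpha> l s" for s
      using ml_kernel_nonneg[OF assms(1,2), of l s] assms(3) by simp
  qed
  then show i: "integrable (lebesgue_on {0..t}) (\<lambda>s. l * ml_kernel \<alpha> l s)"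
    unfolding set_integrable_def by (subst integrable_restrict_space) auto
  show "(LINT s|lebesgue_on {0..t}. l * ml_kernel \<alpha> l s) \<le> 1"
    using lebesgue_integral_eq_integral[OF i] integral_unique[OF h] mittag_leffler_one_neg_nonneg[OF assms]
    by (simp del: integral_mult_right_zero integral_mult_right Henstock_Kurzweil_Integration.integral_mult_right)
qed

section \<open>Power means of eigenfunctions\<close>

definition bump_profile :: "real \<Rightarrow> nat \<Rightarrow> real \<Rightarrow> real" where
  "bump_profile \<delta> m t = (if t > 0 then exp (- \<delta> / t) * (1 / t) ^ m else 0)"

lemma bump_profile_tendsto_0:
  assumes "\<delta> > 0"
  shows "(bump_profile \<delta> m \<longlongrightarrow> 0) (at 0)"
proof -
  have "((\<lambda>t. (\<delta> / t) ^ m / exp (\<delta> / t)) \<longlongrightarrow> 0) (at_right 0)"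
  proof (rule filterlim_compose[OF tendsto_power_div_exp_0])
    show "filterlim (\<lambda>t. \<delta> / t) at_top (at_right 0)"
      using assms by (simp add: divide_inverse filterlim_tendsto_pos_mult_at_top[OF tendsto_const _ filterlim_inverse_at_top_right])
  qed
  then have "((\<lambda>t. (1 / \<delta>) ^ m * ((\<delta> / t) ^ m / exp (\<delta> / t))) \<longlongrightarrow> (1 / \<delta>) ^ m * 0) (at_right 0)"
    by (rule tendsto_mult_left)
  then have "((\<lambda>t. (1 / \<delta>) ^ m * ((\<delta> / t) ^ m / exp (\<delta> / t))) \<longlongrightarrow> 0) (at_right 0)" by simp
  then have R: "(bump_profile \<delta> m \<longlongrightarrow> 0) (at_right 0)"
  proof (rule Lim_transform_eventually)
    show "\<forall>\<^sub>F t in at_right 0. (1 / \<delta>) ^ m * ((\<delta> / t) ^ m / exp (\<delta> / t)) = bump_profile \<delta> m t"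
      using eventually_at_right_less[of 0]
      by eventually_elim (use assms in \<open>simp add: bump_profile_def power_divide exp_minus field_simps\<close>)
  qed
  have L: "(bump_profile \<delta> m \<longlongrightarrow> 0) (at_left 0)"
  proof (rule Lim_transform_eventually[OF tendsto_const])
    show "\<forall>\<^sub>F t in at_left 0. 0 = bump_profile \<delta> m t"
      using eventually_at_left_real[of "-1" 0] by (auto elim!: eventually_mono simp: bump_profile_def)
  qed
  from L R show ?thesis by (simp add: filterlim_split_at)
qed

text \<open>The factors \<open>(1 / t) ^ m\<close> are carried along so that the family is closed
  under differentiation. At \<open>t = 0\<close> the difference quotient is the next member of the
  family, and the exponential beats every power.\<close>

lemma bump_profile_has_derivative:
  assumes "\<delta> > 0"
  shows "(bump_profile \<delta> m has_real_derivative
      \<delta> * bump_profile \<delta> (m + 2) t - real m * bump_profile \<delta> (m + 1) t) (at t)"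
proof -
  consider "t > 0" | "t < 0" | "t = 0" by linarith
  then show ?thesis
  proof cases
    case 1
    have "((\<lambda>t. exp (- \<delta> / t) * (1 / t) ^ m) has_real_derivative
        exp (- \<delta> / t) * (\<delta> / t\<^sup>2) * (1 / t) ^ m + exp (- \<delta> / t) * (real m * (1 / t) ^ (m - 1) * (- (1 / t\<^sup>2)))) (at t)"
      using 1 by (auto intro!: derivative_eq_intros simp: power2_eq_square)
    also have "exp (- \<delta> / t) * (\<delta> / t\<^sup>2) * (1 / t) ^ m + exp (- \<delta> / t) * (real m * (1 / t) ^ (m - 1) * (- (1 / t\<^sup>2)))
        = \<delta> * bump_profile \<delta> (m + 2) t - real m * bump_profile \<delta> (m + 1) t"
      using 1 by (cases m) (simp_all add: bump_profile_def power2_eq_square power_add mult_ac)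
    finally show ?thesis
      by (rule has_field_derivative_transform_within_open[of _ _ _ "{0<..}"])
         (use 1 in \<open>auto simp: bump_profile_def\<close>)
  next
    case 2
    then have "\<delta> * bump_profile \<delta> (m + 2) t - real m * bump_profile \<delta> (m + 1) t = 0"
      by (simp add: bump_profile_def)
    moreover have "(bump_profile \<delta> m has_real_derivative 0) (at t)"
      by (rule has_field_derivative_transform_within_open[OF DERIV_const, of "{..<0}" _ 0])
         (use 2 in \<open>auto simp: bump_profile_def\<close>)
    ultimately show ?thesis by simp
  next
    case 3
    have "((\<lambda>h. (bump_profile \<delta> m (0 + h) - bump_profile \<delta> m 0) / h) \<longlongrightarrow> 0) (at 0)"
    proof (rule Lim_transform_eventually[OF bump_profile_tendsto_0[OF assms, of "m + 1"]])
      show "\<forall>\<^sub>F h in at 0. bump_profile \<delta> (m + 1) h = (bump_profile \<delta> m (0 + h) - bump_profile \<delta> m 0) / h"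
        by (auto simp: bump_profile_def eventually_at_filter)
    qed
    then show ?thesis using 3 by (simp add: DERIV_def bump_profile_def)
  qed
qed

lemma real_polynomial_function_has_derivative:
  fixes p :: "'a::euclidean_space \<Rightarrow> real"
  assumes "real_polynomial_function p"
  shows "\<exists>p'. (\<forall>y. (p has_derivative p' y) (at y)) \<and> (\<forall>v. real_polynomial_function (\<lambda>y. p' y v))"
  using assms
proof induction
  case (linear f)
  then show ?case
    by (intro exI[of _ "\<lambda>y. f"]) (auto intro: bounded_linear_imp_has_derivative real_polynomial_function.intros(2))
next
  case (const c)
  then show ?case
    by (intro exI[of _ "\<lambda>y v. 0"]) (auto intro: real_polynomial_function.intros(2))
next
  case (add f g)
  then obtain f' g' where "\<forall>y. (f has_derivative f' y) (at y)" "\<forall>v. real_polynomial_function (\<lambda>y. f' y v)"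
    "\<forall>y. (g has_derivative g' y) (at y)" "\<forall>v. real_polynomial_function (\<lambda>y. g' y v)" by blast
  then show ?case
    by (intro exI[of _ "\<lambda>y v. f' y v + g' y v"])
       (auto intro!: has_derivative_add real_polynomial_function.intros(3))
next
  case (mult f g)
  then obtain f' g' where "\<forall>y. (f has_derivative f' y) (at y)" "\<forall>v. real_polynomial_function (\<lambda>y. f' y v)"
    "\<forall>y. (g has_derivative g' y) (at y)" "\<forall>v. real_polynomial_function (\<lambda>y. g' y v)" by blast
  with mult.hyps show ?case
    by (intro exI[of _ "\<lambda>y v. f y * g' y v + f' y v * g y"])
       (auto intro!: has_derivative_mult real_polynomial_function.intros(3) real_polynomial_function.intros(4))
qed

text \<open>\<open>smooth\<close> speaks about arbitrary iterated partial derivatives. Instead of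
  computing them, a class of differentiable functions is fixed that is closed under
  \<open>dir_deriv\<close>; sums are a separate rule because one derivative of a basic function
  produces three terms.\<close>

inductive radial_bump :: "real \<Rightarrow> real \<Rightarrow> 'a::euclidean_space \<Rightarrow> ('a \<Rightarrow> real) \<Rightarrow> bool"
  for \<delta> \<tau> x0 where
  base: "real_polynomial_function p \<Longrightarrow> radial_bump \<delta> \<tau> x0 (\<lambda>y. p y * bump_profile \<delta> m (\<tau> - (norm (y - x0))\<^sup>2))"
| add: "radial_bump \<delta> \<tau> x0 f \<Longrightarrow> radial_bump \<delta> \<tau> x0 g \<Longrightarrow> radial_bump \<delta> \<tau> x0 (\<lambda>y. f y + g y)"

lemma dir_deriv_eqI: "(f has_derivative f') (at y) \<Longrightarrow> dir_deriv v f y = f' v"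
  by (simp add: dir_deriv_def frechet_derivative_at[symmetric])

lemma radial_has_derivative:
  fixes x0 y :: "'a::euclidean_space"
  assumes "(h has_real_derivative h') (at (\<tau> - (norm (y - x0))\<^sup>2))"
  shows "((\<lambda>y. h (\<tau> - (norm (y - x0))\<^sup>2)) has_derivative (\<lambda>v. h' * (- 2 * ((y - x0) \<bullet> v)))) (at y)"
proof -
  have q: "((\<lambda>y. \<tau> - (y - x0) \<bullet> (y - x0)) has_derivative (\<lambda>v. - 2 * ((y - x0) \<bullet> v))) (at y)"
    by (auto intro!: derivative_eq_intros simp: inner_commute)
  show ?thesis
    unfolding power2_norm_eq_inner
    by (rule has_derivative_eq_rhs[OF has_derivative_compose[OF q, of h "\<lambda>v. h' * v"]])
       (use assms in \<open>auto simp: has_field_derivative_def power2_norm_eq_inner fun_eq_iff\<close>)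
qed

lemma radial_bump_deriv:
  assumes "\<delta> > 0" "radial_bump \<delta> \<tau> x0 f"
  shows "(\<forall>y. f differentiable (at y)) \<and> (\<forall>v. radial_bump \<delta> \<tau> x0 (dir_deriv v f))"
  using assms(2)
proof induction
  case (base p m)
  obtain p' where p': "\<And>y. (p has_derivative p' y) (at y)" "\<And>v. real_polynomial_function (\<lambda>y. p' y v)"
    using real_polynomial_function_has_derivative[OF base] by blast
  let ?q = "\<lambda>y. \<tau> - (norm (y - x0))\<^sup>2"
  have D: "((\<lambda>y. p y * bump_profile \<delta> m (?q y)) has_derivative
     (\<lambda>v. p y * ((\<delta> * bump_profile \<delta> (m + 2) (?q y) - real m * bump_profile \<delta> (m + 1) (?q y)) * (- 2 * ((y - x0) \<bullet> v)))
        + p' y v * bump_profile \<delta> m (?q y))) (at y)" for y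
    by (rule has_derivative_mult[OF p'(1) radial_has_derivative[OF bump_profile_has_derivative[OF assms(1)]]])
  have pol: "real_polynomial_function (\<lambda>y. p y * (c * (- 2 * ((y - x0) \<bullet> v))))" for c v
  proof -
    have "real_polynomial_function (\<lambda>y. (y - x0) \<bullet> v)"
      unfolding inner_diff_left
      by (intro real_polynomial_function_diff real_polynomial_function.intros(1) real_polynomial_function.intros(2)
          bounded_linear_inner_left)
    then show ?thesis
      by (intro real_polynomial_function.intros(4) real_polynomial_function.intros(2) base)
  qed
  have "radial_bump \<delta> \<tau> x0 (\<lambda>y. (p y * (\<delta> * (- 2 * ((y - x0) \<bullet> v)))) * bump_profile \<delta> (m + 2) (?q y)
      + (p y * (- real m * (- 2 * ((y - x0) \<bullet> v)))) * bump_profile \<delta> (m + 1) (?q y)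
      + p' y v * bump_profile \<delta> m (?q y))" for v
    by (intro radial_bump.add radial_bump.base pol p')
  moreover have "dir_deriv v (\<lambda>y. p y * bump_profile \<delta> m (?q y)) =
     (\<lambda>y. (p y * (\<delta> * (- 2 * ((y - x0) \<bullet> v)))) * bump_profile \<delta> (m + 2) (?q y)
      + (p y * (- real m * (- 2 * ((y - x0) \<bullet> v)))) * bump_profile \<delta> (m + 1) (?q y)
      + p' y v * bump_profile \<delta> m (?q y))" for v
    by (rule ext, subst dir_deriv_eqI[OF D]) (simp add: algebra_simps)
  ultimately show ?case using D by (auto simp: differentiable_def)
next
  case (add f g)
  have "dir_deriv v (\<lambda>y. f y + g y) = (\<lambda>y. dir_deriv v f y + dir_deriv v g y)" for v
  proof
    fix y
    have "(f has_derivative frechet_derivative f (at y)) (at y)" "(g has_derivative frechet_derivative g (at y)) (at y)"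
      using add.IH by (auto simp: frechet_derivative_works)
    from has_derivative_add[OF this] show "dir_deriv v (\<lambda>y. f y + g y) y = dir_deriv v f y + dir_deriv v g y"
      by (simp add: dir_deriv_eqI) (simp add: dir_deriv_def)
  qed
  then show ?case using add.IH by (auto intro: radial_bump.add)
qed

lemma radial_bump_smooth:
  assumes "\<delta> > 0" "radial_bump \<delta> \<tau> x0 f"
  shows "smooth f"
proof -
  have "radial_bump \<delta> \<tau> x0 (foldr dir_deriv vs f)" for vs
  proof (induction vs)
    case (Cons v vs)
    then have "radial_bump \<delta> \<tau> x0 (foldr dir_deriv vs f)" by simp
    from radial_bump_deriv[OF assms(1) this] show ?case by simp
  qed (use assms in simp)
  then show ?thesis unfolding smooth_def using radial_bump_deriv[OF assms(1)] by blast
qed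

section \<open>Smoothed powers and Laplacians of radial profiles\<close>

definition reg_power :: "real \<Rightarrow> nat \<Rightarrow> real \<Rightarrow> real" where
  "reg_power \<delta> k t = t ^ k * bump_profile \<delta> 0 t"

text \<open>Differentiating the exponential produces \<open>\<delta> / t^2\<close>, absorbed by
  \<open>t ^ k\<close> once \<open>k \<ge> 2\<close>. The derivative thus stays within the family,
  up to a term with factor \<open>\<delta>\<close> that disappears in the limit.\<close>

lemma reg_power_has_derivative:
  assumes "\<delta> > 0" "2 \<le> k"
  shows "(reg_power \<delta> k has_real_derivative
      real k * reg_power \<delta> (k - 1) t + \<delta> * reg_power \<delta> (k - 2) t) (at t)"
proof -
  have "(reg_power \<delta> k has_real_derivative
     (real k * t ^ (k - Suc 0) * bump_profile \<delta> 0 t + (\<delta> * bump_profile \<delta> (0 + 2) t - real 0 * bump_profile \<delta> (0 + 1) t) * t ^ k)) (at t)"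
    unfolding reg_power_def[abs_def]
    using DERIV_mult[OF DERIV_pow[of k t] bump_profile_has_derivative[OF assms(1), of 0 t]] by simp
  moreover have "bump_profile \<delta> 2 t * t ^ k = t ^ (k - 2) * bump_profile \<delta> 0 t"
  proof -
    have "t ^ k = t ^ (k - 2) * t ^ 2" using assms(2) by (simp only: power_add[symmetric] le_add_diff_inverse2)
    then show ?thesis by (simp add: bump_profile_def power_divide)
  qed
  ultimately show ?thesis by (simp add: reg_power_def mult.assoc numeral_2_eq_2)
qed

lemma radial_reg_power_test_function:
  assumes "\<delta> > 0" "cball x0 (sqrt \<tau>) \<subseteq> \<Omega>" "\<tau> > 0"
  shows "test_function \<Omega> (\<lambda>y. reg_power \<delta> k (\<tau> - (norm (y - x0))\<^sup>2))"
proof -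
  have "(\<lambda>y. \<tau> - (norm (y - x0))\<^sup>2) = (\<lambda>y. \<tau> - (\<Sum>i\<in>Basis. ((y \<bullet> i - x0 \<bullet> i))\<^sup>2))"
    unfolding power2_norm_eq_inner by (subst euclidean_inner) (simp add: inner_diff_left power2_eq_square)
  moreover have "real_polynomial_function (\<lambda>y. \<tau> - (\<Sum>i\<in>Basis. ((y \<bullet> i - x0 \<bullet> i))\<^sup>2))"
    by (intro real_polynomial_function_diff real_polynomial_function_sum real_polynomial_function_power
        real_polynomial_function.intros(1) real_polynomial_function.intros(2) bounded_linear_inner_left) auto
  ultimately have "real_polynomial_function (\<lambda>y. (\<tau> - (norm (y - x0))\<^sup>2) ^ k)"
    by (intro real_polynomial_function_power) simp
  then have "radial_bump \<delta> \<tau> x0 (\<lambda>y. (\<tau> - (norm (y - x0))\<^sup>2) ^ k * bump_profile \<delta> 0 (\<tau> - (norm (y - x0))\<^sup>2))"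
    by (rule radial_bump.base)
  then have "smooth (\<lambda>y. reg_power \<delta> k (\<tau> - (norm (y - x0))\<^sup>2))"
    unfolding reg_power_def by (rule radial_bump_smooth[OF assms(1)])
  moreover have "reg_power \<delta> k (\<tau> - (norm (y - x0))\<^sup>2) = 0" if "y \<notin> cball x0 (sqrt \<tau>)" for y
  proof -
    have "sqrt \<tau> < norm (y - x0)" using that by (simp add: dist_norm norm_minus_commute)
    then have "(sqrt \<tau>)\<^sup>2 < (norm (y - x0))\<^sup>2" using assms(3) by (intro power_strict_mono) auto
    then have "\<tau> < (norm (y - x0))\<^sup>2" using assms(3) by simp
    then show ?thesis by (simp add: reg_power_def bump_profile_def)
  qed
  ultimately show ?thesis
    unfolding test_function_def using assms(2) by (intro conjI exI[of _ "cball x0 (sqrt \<tau>)"]) auto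
qed

lemma radial_laplacian:
  fixes x0 :: "'a::euclidean_space"
  assumes 1: "\<And>t. (h has_real_derivative h' t) (at t)" and 2: "\<And>t. (h' has_real_derivative h'' t) (at t)"
  shows "(\<Sum>i\<in>Basis. dir_deriv i (dir_deriv i (\<lambda>y. h (\<tau> - (norm (y - x0))\<^sup>2))) y)
    = 4 * (norm (y - x0))\<^sup>2 * h'' (\<tau> - (norm (y - x0))\<^sup>2) - 2 * real DIM('a) * h' (\<tau> - (norm (y - x0))\<^sup>2)"
proof -
  \<comment> \<open>What follows is the chain rule for \<open>h (q y)\<close>, where
    \<open>q\<close> has gradient \<open>-2 (y - x0)\<close> and Laplacian
    \<open>-2 d\<close>.\<close>
  define q where "q y = \<tau> - (norm (y - x0))\<^sup>2" for y
  have D1: "dir_deriv i (\<lambda>y. h (q y)) = (\<lambda>y. h' (q y) * (- 2 * ((y - x0) \<bullet> i)))" for i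
    unfolding q_def by (rule ext, rule dir_deriv_eqI, rule radial_has_derivative, rule 1)
  have D2: "dir_deriv i (dir_deriv i (\<lambda>y. h (q y))) y
      = h' (q y) * (- 2 * (i \<bullet> i)) + h'' (q y) * (- 2 * ((y - x0) \<bullet> i)) * (- 2 * ((y - x0) \<bullet> i))" for i
  proof -
    have "((\<lambda>y. - 2 * ((y - x0) \<bullet> i)) has_derivative (\<lambda>v. - 2 * (v \<bullet> i))) (at y)"
      by (auto intro!: derivative_eq_intros)
    moreover have "((\<lambda>y. h' (q y)) has_derivative (\<lambda>v. h'' (q y) * (- 2 * ((y - x0) \<bullet> v)))) (at y)"
      unfolding q_def by (rule radial_has_derivative[OF 2])
    ultimately have "((\<lambda>y. h' (q y) * (- 2 * ((y - x0) \<bullet> i))) has_derivative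
        (\<lambda>v. h' (q y) * (- 2 * (v \<bullet> i)) + h'' (q y) * (- 2 * ((y - x0) \<bullet> v)) * (- 2 * ((y - x0) \<bullet> i)))) (at y)"
      by (intro has_derivative_mult)
    then show ?thesis unfolding D1 by (rule dir_deriv_eqI)
  qed
  have "(\<Sum>i\<in>Basis. dir_deriv i (dir_deriv i (\<lambda>y. h (q y))) y)
     = (\<Sum>i\<in>Basis. - 2 * h' (q y) + 4 * h'' (q y) * (((y - x0) \<bullet> i) * ((y - x0) \<bullet> i)))"
    unfolding D2 by (intro sum.cong) auto
  also have "\<dots> = real DIM('a) * (- 2 * h' (q y)) + 4 * h'' (q y) * (norm (y - x0))\<^sup>2"
    by (simp only: sum.distrib sum_distrib_left[symmetric] euclidean_inner[symmetric] power2_norm_eq_inner sum_constant)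
  finally show ?thesis by (simp add: q_def)
qed

definition reg_power' :: "real \<Rightarrow> nat \<Rightarrow> real \<Rightarrow> real" where
  "reg_power' \<delta> k t = real k * reg_power \<delta> (k - 1) t + \<delta> * reg_power \<delta> (k - 2) t"

definition reg_power'' :: "real \<Rightarrow> nat \<Rightarrow> real \<Rightarrow> real" where
  "reg_power'' \<delta> k t = real k * reg_power' \<delta> (k - 1) t + \<delta> * reg_power' \<delta> (k - 2) t"

text \<open>\<open>4 \<le> k\<close> because the previous rule is applied to the exponents
  \<open>k - 1\<close> and \<open>k - 2\<close>, both of which have to be at least \<open>2\<close>.
  For the same reason the recurrence for the means starts at index \<open>2\<close>.\<close>

lemma reg_power'_has_derivative:
  assumes "\<delta> > 0" "4 \<le> k"
  shows "(reg_power' \<delta> k has_real_derivative reg_power'' \<delta> k t) (at t)"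
  using assms reg_power_has_derivative[OF assms(1), of "k - 1" t] reg_power_has_derivative[OF assms(1), of "k - 2" t]
  unfolding reg_power'_def[of \<delta> k, abs_def] reg_power''_def
  by (intro DERIV_add DERIV_cmult) (auto simp only: reg_power'_def)


text \<open>As the value at \<open>t \<le> 0\<close> is \<open>0\<close> for every \<open>k\<close>,
  the case \<open>k = 0\<close> is the indicator of the positive half-line, and the moments can
  start from the volume of a ball.\<close>

definition pos_power :: "nat \<Rightarrow> real \<Rightarrow> real" where
  "pos_power k t = (if t > 0 then t ^ k else 0)"

lemma reg_power_tendsto: "(\<lambda>n. reg_power (1 / real (Suc n)) k t) \<longlonglongrightarrow> pos_power k t"
proof (cases "t > 0")
  case True
  have "(\<lambda>n. exp (- (1 / real (Suc n)) / t)) \<longlonglongrightarrow> exp (- 0 / t)"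
    using LIMSEQ_inverse_real_of_nat True by (intro tendsto_intros) (simp_all add: inverse_eq_divide)
  from tendsto_mult[OF tendsto_const[of "t ^ k"] this] show ?thesis
    using True by (simp add: reg_power_def bump_profile_def pos_power_def)
qed (simp add: reg_power_def bump_profile_def pos_power_def)

lemma reg_power'_tendsto: "(\<lambda>n. reg_power' (1 / real (Suc n)) k t) \<longlonglongrightarrow> real k * pos_power (k - 1) t"
proof -
  have "(\<lambda>n. reg_power' (1 / real (Suc n)) k t) \<longlonglongrightarrow> real k * pos_power (k - 1) t + 0 * pos_power (k - 2) t"
    unfolding reg_power'_def using LIMSEQ_inverse_real_of_nat
    by (intro tendsto_intros reg_power_tendsto) (simp add: inverse_eq_divide)
  then show ?thesis by simp
qed

lemma reg_power''_tendsto: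
  "(\<lambda>n. reg_power'' (1 / real (Suc n)) k t) \<longlonglongrightarrow> real k * (real (k - 1) * pos_power (k - 2) t)"
proof -
  have "(\<lambda>n. reg_power'' (1 / real (Suc n)) k t) \<longlonglongrightarrow>
     real k * (real (k - 1) * pos_power (k - 1 - 1) t) + 0 * (real (k - 2) * pos_power (k - 2 - 1) t)"
    unfolding reg_power''_def using LIMSEQ_inverse_real_of_nat
    by (intro tendsto_intros reg_power'_tendsto) (simp add: inverse_eq_divide)
  then show ?thesis by (simp add: numeral_2_eq_2)
qed

text \<open>A bound independent of \<open>\<delta>\<close> and common to all exponents up to
  \<open>k\<close>, for use in dominated convergence; \<open>max 1 \<tau>\<close> makes the powers
  monotone in the exponent.\<close>

lemma abs_reg_power_le:
  assumes "\<delta> > 0" "t \<le> \<tau>" "j \<le> k"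
  shows "\<bar>reg_power \<delta> j t\<bar> \<le> (max 1 \<tau>) ^ k"
proof (cases "t > 0")
  case True
  have "\<bar>reg_power \<delta> j t\<bar> = t ^ j * exp (- \<delta> / t)"
    using True by (simp add: reg_power_def bump_profile_def abs_mult)
  also have "\<dots> \<le> (max 1 \<tau>) ^ j * 1"
    using True assms by (intro mult_mono power_mono) auto
  also have "\<dots> \<le> (max 1 \<tau>) ^ k"
    using assms by (simp add: power_increasing)
  finally show ?thesis .
qed (simp add: reg_power_def bump_profile_def)

lemma abs_reg_power'_le:
  assumes "0 < \<delta>" "\<delta> \<le> 1" "t \<le> \<tau>" "j \<le> k"
  shows "\<bar>reg_power' \<delta> j t\<bar> \<le> (real k + 1) * (max 1 \<tau>) ^ k"
proof -
  have "\<bar>reg_power' \<delta> j t\<bar> \<le> real j * \<bar>reg_power \<delta> (j - 1) t\<bar> + \<delta> * \<bar>reg_power \<delta> (j - 2) t\<bar>"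
    using abs_triangle_ineq[of "real j * reg_power \<delta> (j - 1) t" "\<delta> * reg_power \<delta> (j - 2) t"] assms(1)
    by (simp only: reg_power'_def abs_mult abs_of_nat abs_of_pos)
  also have "\<dots> \<le> real k * (max 1 \<tau>) ^ k + 1 * (max 1 \<tau>) ^ k"
    using assms by (intro add_mono mult_mono abs_reg_power_le) auto
  finally show ?thesis by (simp add: algebra_simps)
qed

lemma abs_reg_power''_le:
  assumes "0 < \<delta>" "\<delta> \<le> 1" "t \<le> \<tau>" "j \<le> k"
  shows "\<bar>reg_power'' \<delta> j t\<bar> \<le> (real k + 1) * ((real k + 1) * (max 1 \<tau>) ^ k)"
proof -
  have "\<bar>reg_power'' \<delta> j t\<bar> \<le> real j * \<bar>reg_power' \<delta> (j - 1) t\<bar> + \<delta> * \<bar>reg_power' \<delta> (j - 2) t\<bar>"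
    using abs_triangle_ineq[of "real j * reg_power' \<delta> (j - 1) t" "\<delta> * reg_power' \<delta> (j - 2) t"] assms(1)
    by (simp only: reg_power''_def abs_mult abs_of_nat abs_of_pos)
  also have "\<dots> \<le> real k * ((real k + 1) * (max 1 \<tau>) ^ k) + 1 * ((real k + 1) * (max 1 \<tau>) ^ k)"
    using assms by (intro add_mono mult_mono abs_reg_power'_le) auto
  finally show ?thesis by (simp add: algebra_simps)
qed

section \<open>Weak eigenfunctions and the recurrence for their power means\<close>

lemma L2_integrable:
  assumes "bounded \<Omega>" "\<Omega> \<in> sets lebesgue" "f \<in> L2 \<Omega>"
  shows "integrable (lebesgue_on \<Omega>) f"
proof -
  have "finite_measure (lebesgue_on \<Omega>)"
    by (rule finite_measure_lebesgue_on[OF bounded_set_imp_lmeasurable[OF assms(1,2)]])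
  then have "(\<lambda>x. 1) \<in> L2 \<Omega>" by (simp add: L2_def finite_measure.integrable_const)
  from L2_mult_integrable[OF assms(3) this] show ?thesis by simp
qed

text \<open>Both derivatives fall on the test function, so that only the interior equation is
  recorded and \<open>\<phi>\<close> may be merely square integrable.\<close>

definition weak_eigenfunction :: "'a::euclidean_space set \<Rightarrow> real \<Rightarrow> ('a \<Rightarrow> real) \<Rightarrow> bool" where
  "weak_eigenfunction \<Omega> l \<phi> \<longleftrightarrow> \<phi> \<in> L2 \<Omega> \<and>
     (\<forall>\<psi>. test_function \<Omega> \<psi> \<longrightarrow>
        l2_inner \<Omega> \<phi> (\<lambda>y. \<Sum>i\<in>Basis. dir_deriv i (dir_deriv i \<psi>) y) = - l * l2_inner \<Omega> \<phi> \<psi>)"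

definition power_mean :: "'a::euclidean_space set \<Rightarrow> ('a \<Rightarrow> real) \<Rightarrow> real \<Rightarrow> nat \<Rightarrow> 'a \<Rightarrow> real" where
  "power_mean \<Omega> \<phi> \<tau> k x = (LINT y|lebesgue_on \<Omega>. \<phi> y * pos_power k (\<tau> - (norm (y - x))\<^sup>2))"

lemma pos_power_measurable [measurable]: "pos_power k \<in> borel_measurable borel"
  unfolding pos_power_def[abs_def] by measurable

lemma abs_pos_power_le: "t \<le> \<tau> \<Longrightarrow> \<bar>pos_power k t\<bar> \<le> (max 1 \<tau>) ^ k"
  using power_mono[of t "max 1 \<tau>" k] by (auto simp: pos_power_def)

lemma borel_lebesgue_on: "f \<in> borel_measurable borel \<Longrightarrow> f \<in> borel_measurable (lebesgue_on \<Omega>)"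
  by (intro measurable_restrict_space1 measurable_completion) simp

lemma integrable_mult_pos_power:
  assumes "integrable (lebesgue_on \<Omega>) \<phi>"
  shows "integrable (lebesgue_on \<Omega>) (\<lambda>y. \<phi> y * pos_power k (\<tau> - (norm (y - x))\<^sup>2))"
proof (rule Bochner_Integration.integrable_bound)
  show "integrable (lebesgue_on \<Omega>) (\<lambda>y. \<phi> y * (max 1 \<tau>) ^ k)" using assms by simp
  have "(\<lambda>y. pos_power k (\<tau> - (norm (y - x))\<^sup>2)) \<in> borel_measurable borel" by measurable
  then have "(\<lambda>y. pos_power k (\<tau> - (norm (y - x))\<^sup>2)) \<in> borel_measurable (lebesgue_on \<Omega>)" by (rule borel_lebesgue_on)
  then show "(\<lambda>y. \<phi> y * pos_power k (\<tau> - (norm (y - x))\<^sup>2)) \<in> borel_measurable (lebesgue_on \<Omega>)"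
    using assms by (intro borel_measurable_times) auto
  show "AE y in lebesgue_on \<Omega>. norm (\<phi> y * pos_power k (\<tau> - (norm (y - x))\<^sup>2)) \<le> norm (\<phi> y * (max 1 \<tau>) ^ k)"
    using abs_pos_power_le[of "\<tau> - (norm (_ - x))\<^sup>2" \<tau> k] by (intro AE_I2) (auto simp: abs_mult intro!: mult_left_mono)
qed

text \<open>Testing the equation with \<open>(\<tau> - |y - x|\<^sup>2)\<^sub>+\<^sup>k\<close>, whose Laplacian is again a combination of such powers,
  gives the Bessel recurrence.  These powers are not smooth and are approximated by
  \<open>t\<^sup>k e\<^sup>-\<^sup>\<delta>\<^sup>/\<^sup>t\<close>.\<close>

lemma power_mean_recurrence:
  fixes x :: "'a::euclidean_space"
  assumes w: "weak_eigenfunction \<Omega> l \<phi>" and i: "integrable (lebesgue_on \<Omega>) \<phi>"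
    and \<tau>: "\<tau> > 0" and cb: "cball x (sqrt \<tau>) \<subseteq> \<Omega>" and k: "4 \<le> k"
  shows "real k * (4 * real (k - 1) * \<tau> * power_mean \<Omega> \<phi> \<tau> (k - 2) x
      - (4 * real (k - 1) + 2 * real DIM('a)) * power_mean \<Omega> \<phi> \<tau> (k - 1) x)
    = - l * power_mean \<Omega> \<phi> \<tau> k x"
proof -
  define q where "q y = \<tau> - (norm (y - x))\<^sup>2" for y
  define \<delta> where "\<delta> n = 1 / real (Suc n)" for n :: nat
  have \<delta>: "\<delta> n > 0" "\<delta> n \<le> 1" for n by (auto simp: \<delta>_def)
  have q\<tau>: "q y \<le> \<tau>" for y by (simp add: q_def)
  have qm: "q \<in> borel_measurable borel" unfolding q_def[abs_def] by measurable
  have \<phi>m: "\<phi> \<in> borel_measurable (lebesgue_on \<Omega>)" using i by simp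
  have rm: "(\<lambda>y. reg_power d j (q y)) \<in> borel_measurable (lebesgue_on \<Omega>)" for d j
    by (rule borel_lebesgue_on) (use qm in \<open>unfold reg_power_def bump_profile_def, measurable\<close>)
  have pm: "(\<lambda>y. pos_power j (q y)) \<in> borel_measurable (lebesgue_on \<Omega>)" for j
    by (rule borel_lebesgue_on) (use qm in measurable)
  have qm': "q \<in> borel_measurable (lebesgue_on \<Omega>)" by (rule borel_lebesgue_on[OF qm])
  define D where "D = real DIM('a)"
  \<comment> \<open>The Laplacian of the \<open>n\<close>-th test function, with
    \<open>|y - x|^2\<close> written as \<open>\<tau> - q y\<close>; \<open>G\<close> is its
    pointwise limit.\<close>
  define F where "F n y = 4 * (\<tau> - q y) * reg_power'' (\<delta> n) k (q y) - 2 * D * reg_power' (\<delta> n) k (q y)" for n y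
  define G where "G y = 4 * (\<tau> - q y) * (real k * (real (k - 1) * pos_power (k - 2) (q y)))
      - 2 * D * (real k * pos_power (k - 1) (q y))" for y
  have lap: "(\<Sum>i\<in>Basis. dir_deriv i (dir_deriv i (\<lambda>y. reg_power (\<delta> n) k (q y))) y) = F n y" for n y
    unfolding F_def q_def D_def
    by (subst radial_laplacian[where h' = "reg_power' (\<delta> n) k" and h'' = "reg_power'' (\<delta> n) k"])
       (use k \<delta>(1)[of n] reg_power_has_derivative[of "\<delta> n" k] reg_power'_has_derivative[of "\<delta> n" k]
         in \<open>auto simp: reg_power'_def\<close>)
  have eq: "l2_inner \<Omega> \<phi> (F n) = - l * l2_inner \<Omega> \<phi> (\<lambda>y. reg_power (\<delta> n) k (q y))" for n
  proof -
    have "test_function \<Omega> (\<lambda>y. reg_power (\<delta> n) k (q y))"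
      unfolding q_def by (rule radial_reg_power_test_function[OF \<delta>(1) cb \<tau>])
    then show ?thesis using w unfolding weak_eigenfunction_def lap[symmetric] by blast
  qed
  define M where "M = (max 1 \<tau>) ^ k"
  have M0: "M \<ge> 0" by (simp add: M_def)
  have lim1: "(\<lambda>n. l2_inner \<Omega> \<phi> (\<lambda>y. reg_power (\<delta> n) k (q y))) \<longlonglongrightarrow> power_mean \<Omega> \<phi> \<tau> k x"
    unfolding l2_inner_def power_mean_def
  proof (rule integral_dominated_convergence)
    show "integrable (lebesgue_on \<Omega>) (\<lambda>y. \<bar>\<phi> y\<bar> * M)" using i by simp
    show "AE y in lebesgue_on \<Omega>. (\<lambda>n. \<phi> y * reg_power (\<delta> n) k (q y)) \<longlonglongrightarrow> \<phi> y * pos_power k (\<tau> - (norm (y - x))\<^sup>2)"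
      unfolding \<delta>_def q_def by (intro AE_I2 tendsto_intros reg_power_tendsto)
    show "AE y in lebesgue_on \<Omega>. norm (\<phi> y * reg_power (\<delta> n) k (q y)) \<le> \<bar>\<phi> y\<bar> * M" for n
      unfolding M_def using abs_reg_power_le[OF \<delta>(1) q\<tau>, of k k] by (intro AE_I2) (auto simp: abs_mult intro!: mult_left_mono)
  qed (use \<phi>m rm pm in \<open>auto simp: q_def[symmetric] intro!: borel_measurable_times\<close>)
  have "(\<lambda>n. l2_inner \<Omega> \<phi> (F n)) \<longlonglongrightarrow> l2_inner \<Omega> \<phi> G"
    unfolding l2_inner_def
  proof (rule integral_dominated_convergence)
    show "integrable (lebesgue_on \<Omega>) (\<lambda>y. \<bar>\<phi> y\<bar> * (4 * \<tau> * ((real k + 1) * ((real k + 1) * M)) + 2 * D * ((real k + 1) * M)))"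
      using i by simp
    show "AE y in lebesgue_on \<Omega>. (\<lambda>n. \<phi> y * F n y) \<longlonglongrightarrow> \<phi> y * G y"
      unfolding F_def G_def \<delta>_def by (intro AE_I2 tendsto_intros reg_power'_tendsto reg_power''_tendsto)
    show "AE y in lebesgue_on \<Omega>. norm (\<phi> y * F n y) \<le> \<bar>\<phi> y\<bar> * (4 * \<tau> * ((real k + 1) * ((real k + 1) * M)) + 2 * D * ((real k + 1) * M))" for n
    proof (rule AE_I2)
      fix y
      \<comment> \<open>Outside the ball the factor \<open>\<tau> - q y = |y - x|^2\<close> is at
        least \<open>\<tau>\<close>, but there the profile vanishes.\<close>
      have z: "reg_power'' (\<delta> n) k (q y) = 0" if "q y \<le> 0"
        using that by (simp add: reg_power''_def reg_power'_def reg_power_def bump_profile_def)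
      have "\<bar>4 * (\<tau> - q y) * reg_power'' (\<delta> n) k (q y)\<bar> \<le> 4 * \<tau> * ((real k + 1) * ((real k + 1) * M))"
      proof (cases "q y \<le> 0")
        case False
        then have "\<bar>\<tau> - q y\<bar> \<le> \<tau>" using q\<tau>[of y] by simp
        then have "\<bar>4 * (\<tau> - q y)\<bar> * \<bar>reg_power'' (\<delta> n) k (q y)\<bar> \<le> (4 * \<tau>) * ((real k + 1) * ((real k + 1) * M))"
          unfolding M_def by (intro mult_mono abs_reg_power''_le \<delta> q\<tau>) (use \<tau> in auto)
        then show ?thesis by (simp only: abs_mult)
      qed (use z \<tau> M0 in simp)
      moreover have "\<bar>2 * D * reg_power' (\<delta> n) k (q y)\<bar> \<le> 2 * D * ((real k + 1) * M)"
        using abs_reg_power'_le[OF \<delta> q\<tau>, of k k n y] by (simp add: abs_mult D_def M_def)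
      ultimately have "\<bar>F n y\<bar> \<le> 4 * \<tau> * ((real k + 1) * ((real k + 1) * M)) + 2 * D * ((real k + 1) * M)"
        unfolding F_def by linarith
      then show "norm (\<phi> y * F n y) \<le> \<bar>\<phi> y\<bar> * (4 * \<tau> * ((real k + 1) * ((real k + 1) * M)) + 2 * D * ((real k + 1) * M))"
        unfolding real_norm_def abs_mult by (rule mult_left_mono) simp
    qed
  qed (auto simp: F_def[abs_def] G_def[abs_def] reg_power''_def reg_power'_def
        intro!: borel_measurable_times borel_measurable_diff borel_measurable_add borel_measurable_const \<phi>m rm pm qm')
  moreover have "(\<lambda>n. l2_inner \<Omega> \<phi> (F n)) \<longlonglongrightarrow> - l * power_mean \<Omega> \<phi> \<tau> k x"
    unfolding eq by (intro tendsto_intros lim1)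
  ultimately have "l2_inner \<Omega> \<phi> G = - l * power_mean \<Omega> \<phi> \<tau> k x"
    by (rule LIMSEQ_unique)
  moreover have "l2_inner \<Omega> \<phi> G = real k * (4 * real (k - 1) * \<tau> * power_mean \<Omega> \<phi> \<tau> (k - 2) x
      - (4 * real (k - 1) + 2 * D) * power_mean \<Omega> \<phi> \<tau> (k - 1) x)"
  proof -
    have G: "\<phi> y * G y = (real k * (4 * real (k - 1) * \<tau>)) * (\<phi> y * pos_power (k - 2) (q y))
        - (real k * (4 * real (k - 1) + 2 * D)) * (\<phi> y * pos_power (k - 1) (q y))" for y
    proof -
      \<comment> \<open>This turns the factor \<open>|y - x|^2\<close> into a difference of
        consecutive powers, so that the Laplacian contributes only the means of index
        \<open>k - 2\<close> and \<open>k - 1\<close>.\<close>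
      have "q y * pos_power (k - 2) (q y) = pos_power (k - 1) (q y)"
      proof -
        have "k - 1 = Suc (k - 2)" using k by simp
        then show ?thesis by (simp only: pos_power_def) simp
      qed
      then have "(\<tau> - q y) * pos_power (k - 2) (q y) = \<tau> * pos_power (k - 2) (q y) - pos_power (k - 1) (q y)"
        by (simp add: left_diff_distrib)
      moreover have "G y = 4 * real k * real (k - 1) * ((\<tau> - q y) * pos_power (k - 2) (q y))
         - 2 * D * (real k * pos_power (k - 1) (q y))"
        by (simp only: G_def mult_ac)
      ultimately have Gy: "G y = 4 * real k * real (k - 1) * (\<tau> * pos_power (k - 2) (q y) - pos_power (k - 1) (q y))
         - 2 * D * (real k * pos_power (k - 1) (q y))"
        by (simp only:)
      show ?thesis unfolding Gy by algebra
    qed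
    have I: "integrable (lebesgue_on \<Omega>) (\<lambda>y. \<phi> y * pos_power j (q y))" for j
      unfolding q_def by (rule integrable_mult_pos_power[OF i])
    have "l2_inner \<Omega> \<phi> G = (real k * (4 * real (k - 1) * \<tau>)) * power_mean \<Omega> \<phi> \<tau> (k - 2) x
       - (real k * (4 * real (k - 1) + 2 * D)) * power_mean \<Omega> \<phi> \<tau> (k - 1) x"
      unfolding l2_inner_def G power_mean_def q_def[symmetric]
      by (subst Bochner_Integration.integral_diff) (use I in auto)
    then show ?thesis by (simp only: right_diff_distrib mult.assoc)
  qed
  ultimately show ?thesis by (simp add: D_def)
qed

section \<open>Moments of truncated powers over balls\<close>

primrec ball_moment :: "nat \<Rightarrow> nat \<Rightarrow> real" where
  "ball_moment d 0 = unit_ball_vol (real d)"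
| "ball_moment d (Suc k) = ball_moment d k * (real k + 1) / (real k + 1 + real d / 2)"

lemma ball_moment_pos: "ball_moment d k > 0"
  by (induction k) (auto intro!: divide_pos_pos mult_pos_pos add_pos_nonneg)

lemma sqrt_power_eq_powr: "\<tau> \<ge> 0 \<Longrightarrow> n > 0 \<Longrightarrow> sqrt \<tau> ^ n = \<tau> powr (real n / 2)"
  by (cases "\<tau> = 0") (auto simp: powr_half_sqrt[symmetric] powr_powr simp flip: powr_realpow)

text \<open>\<open>ball_moment d k\<close> is the integral of \<open>(1 - |y|^2)^k\<close> over the
  unit ball, in closed form \<open>pi^(d/2) k! / Gamma (k + 1 + d/2)\<close>. The induction step
  writes the next truncated power as the integral over \<open>s\<close> from \<open>0\<close> to
  \<open>\<tau>\<close> of \<open>k + 1\<close> times the previous one with \<open>s\<close> in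
  place of \<open>\<tau>\<close>, and exchanges the two integrals.\<close>

lemma nn_integral_pos_power:
  fixes x :: "'a::euclidean_space"
  assumes "\<tau> \<ge> 0"
  shows "(\<integral>\<^sup>+ y. ennreal (pos_power k (\<tau> - (norm (y - x))\<^sup>2)) \<partial>lborel)
     = ennreal (ball_moment DIM('a) k * \<tau> powr (real k + real DIM('a) / 2))"
  using assms
proof (induction k arbitrary: \<tau>)
  case 0
  have "(norm (y - x))\<^sup>2 < \<tau> \<longleftrightarrow> norm (y - x) < sqrt \<tau>" for y
    using 0 by (metis norm_ge_zero real_less_lsqrt real_less_rsqrt real_sqrt_less_iff real_sqrt_abs abs_norm_cancel)
  then have "(\<integral>\<^sup>+ y. ennreal (pos_power 0 (\<tau> - (norm (y - x))\<^sup>2)) \<partial>lborel) = (\<integral>\<^sup>+ y. indicator (ball x (sqrt \<tau>)) y \<partial>lborel)"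
    by (intro nn_integral_cong) (auto simp: pos_power_def indicator_def dist_norm norm_minus_commute)
  also have "\<dots> = ennreal (unit_ball_vol (real DIM('a)) * sqrt \<tau> ^ DIM('a))"
    using 0 by (simp add: emeasure_ball)
  finally show ?case using 0 by (simp add: sqrt_power_eq_powr)
next
  case (Suc k)
  define p where "p = real k + real DIM('a) / 2"
  have p: "p > 0" by (simp add: p_def add_nonneg_pos)
  have inner: "ennreal (pos_power (Suc k) (\<tau> - n)) =
     (\<integral>\<^sup>+ s. ennreal ((real k + 1) * pos_power k (s - n)) * indicator {0..\<tau>} s \<partial>lborel)" if "n \<ge> 0" for n
  proof (cases "n \<le> \<tau>")
    case True
    have "(\<integral>\<^sup>+ s. ennreal ((real k + 1) * pos_power k (s - n)) * indicator {0..\<tau>} s \<partial>lborel)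
       = (\<integral>\<^sup>+ s. ennreal ((real k + 1) * (s - n) ^ k) * indicator {n..\<tau>} s \<partial>lborel)"
    proof (rule nn_integral_cong_AE)
      \<comment> \<open>For \<open>k = 0\<close> the two integrands differ at \<open>s = n\<close>,
        where \<open>0 ^ 0 = 1\<close> but \<open>pos_power 0 0 = 0\<close>.\<close>
      have "AE s in lborel. s \<noteq> n" by (rule AE_lborel_singleton)
      then show "AE s in lborel. ennreal ((real k + 1) * pos_power k (s - n)) * indicator {0..\<tau>} s
          = ennreal ((real k + 1) * (s - n) ^ k) * indicator {n..\<tau>} s"
        by eventually_elim (use that in \<open>auto simp: pos_power_def indicator_def\<close>)
    qed
    also have "\<dots> = ennreal ((\<tau> - n) ^ Suc k - (n - n) ^ Suc k)"
    proof (rule nn_integral_FTC_Icc)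
      show "((\<lambda>s. (s - n) ^ Suc k) has_real_derivative (real k + 1) * (s - n) ^ k) (at s)" for s
        by (rule DERIV_cong[OF DERIV_power[OF DERIV_diff[OF DERIV_ident DERIV_const]]]) (simp add: add.commute)
    qed (use True in auto)
    finally show ?thesis using True by (auto simp: pos_power_def)
  next
    case False
    then have "(\<integral>\<^sup>+ s. ennreal ((real k + 1) * pos_power k (s - n)) * indicator {0..\<tau>} s \<partial>lborel) = (\<integral>\<^sup>+ (s::real). 0 \<partial>lborel)"
      by (intro nn_integral_cong) (auto simp: pos_power_def indicator_def)
    then show ?thesis using False by (simp add: pos_power_def)
  qed
  have "(\<integral>\<^sup>+ y. ennreal (pos_power (Suc k) (\<tau> - (norm (y - x))\<^sup>2)) \<partial>lborel)
     = (\<integral>\<^sup>+ y. \<integral>\<^sup>+ s. ennreal ((real k + 1) * pos_power k (s - (norm (y - x))\<^sup>2)) * indicator {0..\<tau>} s \<partial>lborel \<partial>lborel)"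
    by (intro nn_integral_cong inner) simp
  also have "\<dots> = (\<integral>\<^sup>+ s. \<integral>\<^sup>+ y. ennreal ((real k + 1) * pos_power k (s - (norm (y - x))\<^sup>2)) * indicator {0..\<tau>} s \<partial>lborel \<partial>lborel)"
    by (rule lborel_pair.Fubini'[symmetric]) measurable
  also have "\<dots> = (\<integral>\<^sup>+ s. ennreal (((real k + 1) * ball_moment DIM('a) k) * s powr p) * indicator {0..\<tau>} s \<partial>lborel)"
  proof (rule nn_integral_cong)
    fix s :: real
    show "(\<integral>\<^sup>+ y. ennreal ((real k + 1) * pos_power k (s - (norm (y - x))\<^sup>2)) * indicator {0..\<tau>} s \<partial>lborel)
        = ennreal (((real k + 1) * ball_moment DIM('a) k) * s powr p) * indicator {0..\<tau>} s"
    proof (cases "s \<in> {0..\<tau>}")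
      case True
      have "(\<integral>\<^sup>+ y. ennreal ((real k + 1) * pos_power k (s - (norm (y - x))\<^sup>2)) \<partial>lborel)
         = (\<integral>\<^sup>+ y. ennreal (real k + 1) * ennreal (pos_power k (s - (norm (y - x))\<^sup>2)) \<partial>lborel)"
        by (intro nn_integral_cong) (auto simp: ennreal_mult' pos_power_def)
      also have "\<dots> = ennreal (real k + 1) * ennreal (ball_moment DIM('a) k * s powr p)"
        using Suc.IH[of s] True by (subst nn_integral_cmult) (auto simp: p_def)
      also have "\<dots> = ennreal (((real k + 1) * ball_moment DIM('a) k) * s powr p)"
        using ball_moment_pos[of "DIM('a)" k] by (subst ennreal_mult'[symmetric]) (auto simp: mult.assoc)
      finally show ?thesis using True by simp
    qed simp
  qed
  also have "\<dots> = ennreal ((real k + 1) * ball_moment DIM('a) k * (\<tau> powr (p + 1) / (p + 1)))"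
    using ball_moment_pos[of "DIM('a)" k] p Suc.prems
    by (intro nn_integral_has_integral_lebesgue' has_integral_mult_right has_integral_powr_from_0) auto
  also have "(real k + 1) * ball_moment DIM('a) k * (\<tau> powr (p + 1) / (p + 1))
      = ball_moment DIM('a) (Suc k) * \<tau> powr (real (Suc k) + real DIM('a) / 2)"
    by (simp add: p_def algebra_simps)
  finally show ?case .
qed

lemma integral_pos_power:
  fixes x :: "'a::euclidean_space"
  assumes "\<tau> \<ge> 0"
  shows "integrable lborel (\<lambda>y. pos_power k (\<tau> - (norm (y - x))\<^sup>2))"
    and "(LINT y|lborel. pos_power k (\<tau> - (norm (y - x))\<^sup>2)) = ball_moment DIM('a) k * \<tau> powr (real k + real DIM('a) / 2)"
proof -
  have nn: "pos_power k t \<ge> 0" for t by (simp add: pos_power_def)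
  have "has_bochner_integral lborel (\<lambda>y. pos_power k (\<tau> - (norm (y - x))\<^sup>2))
     (ball_moment DIM('a) k * \<tau> powr (real k + real DIM('a) / 2))"
    by (rule has_bochner_integral_nn_integral[OF _ _ _ nn_integral_pos_power[OF assms]])
       (use nn ball_moment_pos[of "DIM('a)" k] in auto)
  then show "integrable lborel (\<lambda>y. pos_power k (\<tau> - (norm (y - x))\<^sup>2))"
    "(LINT y|lborel. pos_power k (\<tau> - (norm (y - x))\<^sup>2)) = ball_moment DIM('a) k * \<tau> powr (real k + real DIM('a) / 2)"
    by (auto simp: has_bochner_integral_iff)
qed

text \<open>Quotients of consecutive moments tend to \<open>1\<close>, so from some index on they
  exceed \<open>\<theta>\<close>. The moments thus decay more slowly than any geometric sequence;
  this excludes the growing solutions of the recurrence and also makes the kernels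
  concentrate.\<close>

lemma ball_moment_lower:
  assumes "0 < \<theta>" "\<theta> < 1"
  shows "\<exists>N. \<forall>k. ball_moment d N * \<theta> ^ k \<le> ball_moment d (N + k)"
proof -
  obtain N where N: "real N \<ge> real d / 2 * \<theta> / (1 - \<theta>)" using real_arch_simple by blast
  have "ball_moment d N * \<theta> ^ k \<le> ball_moment d (N + k)" for k
  proof (induction k)
    case (Suc k)
    have "\<theta> * (real d / 2) \<le> (1 - \<theta>) * (real (N + k) + 1)"
    proof -
      have "real d / 2 * \<theta> \<le> real N * (1 - \<theta>)" by (rule pos_divide_le_eq[THEN iffD1]) (use N assms in auto)
      also have "\<dots> \<le> (real (N + k) + 1) * (1 - \<theta>)" using assms by (intro mult_right_mono) auto
      finally show ?thesis by (simp add: mult_ac)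
    qed
    then have "\<theta> * (real (N + k) + 1 + real d / 2) \<le> real (N + k) + 1"
      by (simp add: algebra_simps)
    then have "\<theta> \<le> (real (N + k) + 1) / (real (N + k) + 1 + real d / 2)"
      by (subst pos_le_divide_eq) (auto intro: add_pos_nonneg)
    then have "ball_moment d N * \<theta> ^ k * \<theta> \<le> ball_moment d (N + k) * ((real (N + k) + 1) / (real (N + k) + 1 + real d / 2))"
      using Suc assms ball_moment_pos[of d "N + k"] by (intro mult_mono) auto
    then show ?case by (simp add: mult_ac)
  qed simp
  then show ?thesis by blast
qed

text \<open>Read backwards, the recurrence is stable and forces the sequence to be nearly constant;
  the other solutions grow faster than geometrically.\<close>

lemma three_term_sequence:
  fixes \<beta> c :: "nat \<Rightarrow> real"
  assumes rec: "\<And>i. \<beta> (Suc i) - \<beta> i = c i * \<beta> (Suc (Suc i))"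
    and c: "\<And>i. 0 \<le> c i" "\<And>n. (\<Sum>i<n. c i) \<le> 1 / 8"
    and growth: "\<And>i. N \<le> i \<Longrightarrow> \<bar>\<beta> i\<bar> \<le> K * (3 / 2) ^ i"
  shows "\<bar>\<beta> i\<bar> \<le> 2 * \<bar>\<beta> 0\<bar>" and "\<bar>\<beta> (Suc i) - \<beta> i\<bar> \<le> 8 * c i * \<bar>\<beta> 0\<bar>"
proof -
  have c8: "c i \<le> 1 / 8" for i
    using c(2)[of "Suc i"] sum_nonneg[of "{..<i}" c] c(1) by simp
  have double: "\<bar>\<beta> (Suc j)\<bar> \<le> 2 * \<bar>\<beta> j\<bar>" for j
  proof (rule ccontr)
    assume *: "\<not> \<bar>\<beta> (Suc j)\<bar> \<le> 2 * \<bar>\<beta> j\<bar>"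
    \<comment> \<open>If a term exceeds twice its predecessor, the recurrence with
      \<open>c \<le> 1 / 8\<close> makes the next one exceed even four times the term. Doubling
      therefore persists and violates the growth bound.\<close>
    have step: "2 * \<bar>\<beta> (j + i)\<bar> < \<bar>\<beta> (Suc (j + i))\<bar>" for i
    proof (induction i)
      case (Suc i)
      have "\<bar>\<beta> (Suc (j + i))\<bar> \<le> \<bar>\<beta> (j + i)\<bar> + c (j + i) * \<bar>\<beta> (Suc (Suc (j + i)))\<bar>"
        using rec[of "j + i"] c(1)[of "j + i"] by (metis abs_mult abs_of_nonneg abs_triangle_ineq diff_add_cancel add.commute)
      moreover have "c (j + i) * \<bar>\<beta> (Suc (Suc (j + i)))\<bar> \<le> 1 / 8 * \<bar>\<beta> (Suc (Suc (j + i)))\<bar>"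
        by (intro mult_right_mono c8) simp
      ultimately show ?case using Suc by simp
    qed (use * in simp)
    define a where "a = \<bar>\<beta> (Suc j)\<bar>"
    have a0: "a > 0" using * by (simp add: a_def) 
    have low: "a * 2 ^ i \<le> \<bar>\<beta> (Suc j + i)\<bar>" for i
    proof (induction i)
      case (Suc i)
      then show ?case using step[of "Suc i"] by simp
    qed (simp add: a_def)
    \<comment> \<open>\<open>4 / 3\<close> below is the ratio of the enforced growth
      \<open>2\<close> to the permitted growth \<open>3 / 2\<close>.\<close>
    define K' where "K' = \<bar>K\<bar> * (3 / 2) ^ Suc j / a"
    obtain n where n: "K' < (4 / 3) ^ n" using real_arch_pow[of "4 / 3" K'] by auto
    define i where "i = n + N"
    have "K' < (4 / 3) ^ i"
      by (rule less_le_trans[OF n power_increasing]) (auto simp: i_def)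
    then have "\<bar>K\<bar> * (3 / 2) ^ Suc j < a * (4 / 3) ^ i"
      using a0 unfolding K'_def by (simp add: pos_divide_less_eq mult_ac)
    then have "\<bar>K\<bar> * (3 / 2) ^ Suc j * (3 / 2) ^ i < a * (4 / 3) ^ i * (3 / 2) ^ i"
      by (intro mult_strict_right_mono) auto
    also have "\<dots> = a * 2 ^ i" by (simp add: power_mult_distrib[symmetric] mult.assoc)
    also have "\<dots> \<le> K * (3 / 2) ^ (Suc j + i)"
      using low[of i] growth[of "Suc j + i"] by (simp add: i_def)
    also have "\<dots> \<le> \<bar>K\<bar> * (3 / 2) ^ (Suc j + i)" by (intro mult_right_mono) auto
    finally show False by (simp add: power_add mult_ac)
  qed
  have diff: "\<bar>\<beta> (Suc j) - \<beta> j\<bar> \<le> 4 * c j * \<bar>\<beta> j\<bar>" for j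
  proof -
    have "\<bar>\<beta> (Suc j) - \<beta> j\<bar> = c j * \<bar>\<beta> (Suc (Suc j))\<bar>" using rec[of j] c(1)[of j] by (simp add: abs_mult)
    also have "\<dots> \<le> c j * (4 * \<bar>\<beta> j\<bar>)" using double[of j] double[of "Suc j"] c(1) by (intro mult_left_mono) auto
    finally show ?thesis by simp
  qed
  \<comment> \<open>Joint induction: the crude bound \<open>2 * |\<beta> 0|\<close> feeds the
    additive estimate, and that estimate together with \<open>\<Sum> c \<le> 1 / 8\<close> returns
    the crude bound.\<close>
  have bound: "\<bar>\<beta> i\<bar> \<le> \<bar>\<beta> 0\<bar> * (1 + 8 * (\<Sum>j<i. c j)) \<and> \<bar>\<beta> i\<bar> \<le> 2 * \<bar>\<beta> 0\<bar>" for i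
  proof (induction i)
    case (Suc i)
    have "\<bar>\<beta> (Suc i)\<bar> \<le> \<bar>\<beta> i\<bar> + 4 * c i * \<bar>\<beta> i\<bar>" using diff[of i] by linarith
    also have "\<dots> \<le> \<bar>\<beta> 0\<bar> * (1 + 8 * (\<Sum>j<i. c j)) + 4 * c i * (2 * \<bar>\<beta> 0\<bar>)"
      using Suc c(1)[of i] by (intro add_mono mult_left_mono) auto
    finally have 1: "\<bar>\<beta> (Suc i)\<bar> \<le> \<bar>\<beta> 0\<bar> * (1 + 8 * (\<Sum>j<Suc i. c j))" by (simp add: algebra_simps)
    also have "\<dots> \<le> \<bar>\<beta> 0\<bar> * 2" using c(2)[of "Suc i"] by (intro mult_left_mono) auto
    finally show ?case using 1 by simp
  qed simp
  show "\<bar>\<beta> i\<bar> \<le> 2 * \<bar>\<beta> 0\<bar>" using bound by blast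
  have "4 * c i * \<bar>\<beta> i\<bar> \<le> 4 * c i * (2 * \<bar>\<beta> 0\<bar>)" using bound[of i] c(1)[of i] by (intro mult_left_mono) auto
  then show "\<bar>\<beta> (Suc i) - \<beta> i\<bar> \<le> 8 * c i * \<bar>\<beta> 0\<bar>" using diff[of i] by simp
qed


section \<open>Inner parts of the domain and normalised means\<close>

definition inner_part :: "'a::euclidean_space set \<Rightarrow> real \<Rightarrow> 'a set" where
  "inner_part \<Omega> \<tau> = {x. sqrt \<tau> < infdist x (- \<Omega>)}"

lemma open_inner_part: "open (inner_part \<Omega> \<tau>)"
  unfolding inner_part_def by (intro open_Collect_less continuous_intros)

lemma cball_subset_inner_part:
  assumes "x \<in> inner_part \<Omega> \<tau>"
  shows "cball x (sqrt \<tau>) \<subseteq> \<Omega>"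
proof
  fix y assume y: "y \<in> cball x (sqrt \<tau>)"
  show "y \<in> \<Omega>"
  proof (rule ccontr)
    assume "y \<notin> \<Omega>"
    then have "infdist x (- \<Omega>) \<le> dist x y" by (intro infdist_le) simp
    with y assms show False by (simp add: inner_part_def)
  qed
qed

lemma inner_part_subset: "0 \<le> \<tau> \<Longrightarrow> inner_part \<Omega> \<tau> \<subseteq> \<Omega>"
  using cball_subset_inner_part by fastforce

lemma inner_part_antimono: "\<tau>' \<le> \<tau> \<Longrightarrow> inner_part \<Omega> \<tau> \<subseteq> inner_part \<Omega> \<tau>'"
  by (auto simp: inner_part_def intro: le_less_trans[OF real_sqrt_le_mono])

lemma inner_part_exhaust:
  assumes "open \<Omega>" "bounded \<Omega>" "x \<in> \<Omega>"
  shows "\<exists>\<tau>>0. x \<in> inner_part \<Omega> \<tau>"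
proof -
  \<comment> \<open>By convention \<open>infdist\<close> to the empty set is \<open>0\<close>, which
    would make the inner parts with \<open>\<tau> > 0\<close> empty.\<close>
  have "- \<Omega> \<noteq> {}" using assms(2) by (metis Compl_empty_eq double_compl not_bounded_UNIV)
  then have "infdist x (- \<Omega>) > 0"
    using assms in_closed_iff_infdist_zero[of "- \<Omega>" x] infdist_nonneg[of x "- \<Omega>"] by (auto simp: closed_Compl less_le)
  then show ?thesis
    by (intro exI[of _ "(infdist x (- \<Omega>) / 2)\<^sup>2"]) (simp add: inner_part_def)
qed

lemma continuous_pos_power: "1 \<le> k \<Longrightarrow> continuous_on A (pos_power k)"
proof -
  assume "1 \<le> k"
  then have "pos_power k = (\<lambda>t. (max 0 t) ^ k)" by (auto simp: pos_power_def fun_eq_iff max_def)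
  then show ?thesis by (auto intro!: continuous_intros)
qed

lemma power_mean_continuous:
  assumes i: "integrable (lebesgue_on \<Omega>) \<phi>" and k: "1 \<le> k"
  shows "continuous_on A (power_mean \<Omega> \<phi> \<tau> k)"
proof (rule continuous_at_imp_continuous_on, rule ballI)
  fix x
  show "isCont (power_mean \<Omega> \<phi> \<tau> k) x"
  proof (rule continuous_at_sequentiallyI)
    fix u assume u: "u \<longlonglongrightarrow> x"
    show "(\<lambda>n. power_mean \<Omega> \<phi> \<tau> k (u n)) \<longlonglongrightarrow> power_mean \<Omega> \<phi> \<tau> k x"
      unfolding power_mean_def
    proof (rule integral_dominated_convergence)
      show "integrable (lebesgue_on \<Omega>) (\<lambda>y. \<bar>\<phi> y\<bar> * (max 1 \<tau>) ^ k)" using i by simp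
      show "AE y in lebesgue_on \<Omega>. (\<lambda>n. \<phi> y * pos_power k (\<tau> - (norm (y - u n))\<^sup>2)) \<longlonglongrightarrow>
          \<phi> y * pos_power k (\<tau> - (norm (y - x))\<^sup>2)"
        using u by (intro AE_I2 tendsto_mult tendsto_const continuous_on_tendsto_compose[OF continuous_pos_power[OF k, of UNIV]] tendsto_intros) auto
      show "AE y in lebesgue_on \<Omega>. norm (\<phi> y * pos_power k (\<tau> - (norm (y - u n))\<^sup>2)) \<le> \<bar>\<phi> y\<bar> * (max 1 \<tau>) ^ k" for n
        using abs_pos_power_le[of "\<tau> - (norm (_ - u n))\<^sup>2" \<tau> k] by (intro AE_I2) (auto simp: abs_mult intro!: mult_left_mono)
    qed (use integrable_mult_pos_power[OF i] in \<open>auto dest: borel_measurable_integrable\<close>)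
  qed
qed

definition kernel_mass :: "'a::euclidean_space itself \<Rightarrow> real \<Rightarrow> nat \<Rightarrow> real" where
  "kernel_mass _ \<tau> k = ball_moment DIM('a) k * \<tau> powr (real k + real DIM('a) / 2)"

lemma kernel_mass_pos: "\<tau> > 0 \<Longrightarrow> kernel_mass TYPE('a::euclidean_space) \<tau> k > 0"
  using ball_moment_pos[of "DIM('a)" k] by (simp add: kernel_mass_def)

lemma kernel_mass_eq:
  "\<tau> > 0 \<Longrightarrow> kernel_mass TYPE('a::euclidean_space) \<tau> k = ball_moment DIM('a) k * \<tau> ^ k * \<tau> powr (real DIM('a) / 2)"
  by (simp add: kernel_mass_def powr_add powr_realpow)

lemma kernel_mass_Suc:
  "\<tau> > 0 \<Longrightarrow> kernel_mass TYPE('a::euclidean_space) \<tau> (Suc k) * (real k + 1 + real DIM('a) / 2)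
     = kernel_mass TYPE('a) \<tau> k * \<tau> * (real k + 1)"
proof -
  assume t: "\<tau> > 0"
  have "real k + 1 + real DIM('a) / 2 > 0" by (simp add: add_pos_nonneg)
  then have *: "ball_moment DIM('a) (Suc k) * (real k + 1 + real DIM('a) / 2) = ball_moment DIM('a) k * (real k + 1)"
    by simp
  have "kernel_mass TYPE('a) \<tau> (Suc k) * (real k + 1 + real DIM('a) / 2)
      = (ball_moment DIM('a) (Suc k) * (real k + 1 + real DIM('a) / 2)) * (\<tau> * \<tau> ^ k * \<tau> powr (real DIM('a) / 2))"
    unfolding kernel_mass_eq[OF t] power_Suc by (simp only: mult_ac)
  also have "\<dots> = kernel_mass TYPE('a) \<tau> k * \<tau> * (real k + 1)"
    unfolding * kernel_mass_eq[OF t] by (simp only: mult_ac)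
  finally show ?thesis .
qed

text \<open>For \<open>x\<close> in the inner part this is a mean with respect to a probability
  density that concentrates at \<open>x\<close> as \<open>k\<close> grows.\<close>

definition nmean :: "'a::euclidean_space set \<Rightarrow> ('a \<Rightarrow> real) \<Rightarrow> real \<Rightarrow> nat \<Rightarrow> 'a \<Rightarrow> real" where
  "nmean \<Omega> \<phi> \<tau> k x = power_mean \<Omega> \<phi> \<tau> k x / kernel_mass TYPE('a) \<tau> k"

lemma nmean_continuous:
  "integrable (lebesgue_on \<Omega>) \<phi> \<Longrightarrow> 1 \<le> k \<Longrightarrow> continuous_on A (nmean \<Omega> \<phi> \<tau> k)"
  unfolding nmean_def[abs_def] divide_inverse by (intro continuous_on_mult_right power_mean_continuous)

text \<open>The coefficient left after the recurrence for \<open>power_mean\<close> has been divided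
  by the masses. It is proportional to \<open>l * \<tau>\<close> and decays like
  \<open>1 / i^2\<close>, hence is summable.\<close>

definition mean_coeff :: "nat \<Rightarrow> real \<Rightarrow> real \<Rightarrow> nat \<Rightarrow> real" where
  "mean_coeff d l \<tau> i = l * \<tau> / 4 / ((real i + 3 + real d / 2) * (real i + 4 + real d / 2))"

text \<open>The arithmetic of this division, with \<open>a = j + 3\<close>,
  \<open>p = j + 3 + d/2\<close>, \<open>r = j + 4 + d/2\<close> and \<open>M2\<close>,
  \<open>M3\<close>, \<open>M4\<close> the masses for the indices \<open>j + 2\<close>,
  \<open>j + 3\<close>, \<open>j + 4\<close>.\<close>

lemma mean_recurrence_algebra:
  fixes a p r \<tau> l M2 M3 M4 b2 b3 b4 :: real
  assumes "a + 1 > 0" "p > 0" "r > 0" "M3 > 0"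
    and "M3 * p = M2 * \<tau> * a" and "M4 * r = M3 * \<tau> * (a + 1)"
    and "(a + 1) * (4 * a * \<tau> * (b2 * M2) - 4 * p * (b3 * M3)) = - l * (b4 * M4)"
  shows "b3 - b2 = l * \<tau> / 4 / (p * r) * b4"
proof -
  have "((a + 1) * M3) * (4 * (p * r) * (b3 - b2)) = ((a + 1) * M3) * (l * \<tau> * b4)"
    using assms(5-7) by algebra
  then have "4 * (p * r) * (b3 - b2) = l * \<tau> * b4" using assms by simp
  then show ?thesis using assms by (simp add: field_simps)
qed

lemma nmean_recurrence:
  fixes x :: "'a::euclidean_space"
  assumes w: "weak_eigenfunction \<Omega> l \<phi>" and i: "integrable (lebesgue_on \<Omega>) \<phi>"
    and \<tau>: "\<tau> > 0" and x: "x \<in> inner_part \<Omega> \<tau>"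
  shows "nmean \<Omega> \<phi> \<tau> (j + 3) x - nmean \<Omega> \<phi> \<tau> (j + 2) x = mean_coeff DIM('a) l \<tau> j * nmean \<Omega> \<phi> \<tau> (j + 4) x"
proof -
  define M where "M k = kernel_mass TYPE('a) \<tau> k" for k
  have M: "M k > 0" for k by (simp add: M_def kernel_mass_pos[OF \<tau>])
  have B: "power_mean \<Omega> \<phi> \<tau> k x = nmean \<Omega> \<phi> \<tau> k x * M k" for k
    using M[of k] by (simp add: nmean_def M_def)
  have S3: "M (j + 3) * (real j + 3 + real DIM('a) / 2) = M (j + 2) * \<tau> * (real j + 3)"
    using kernel_mass_Suc[OF \<tau>, of "j + 2", where 'a = 'a] by (simp add: M_def numeral_eq_Suc add_ac)
  have S4: "M (j + 4) * (real j + 4 + real DIM('a) / 2) = M (j + 3) * \<tau> * (real j + 3 + 1)"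
    using kernel_mass_Suc[OF \<tau>, of "j + 3", where 'a = 'a] by (simp add: M_def numeral_eq_Suc add_ac)
  have k: "j + 4 - 1 = j + 3" "j + 4 - 2 = j + 2" "real (j + 4) = real j + 3 + 1" "real (j + 3) = real j + 3" by simp_all
  have "(real j + 3 + 1) * (4 * (real j + 3) * \<tau> * (nmean \<Omega> \<phi> \<tau> (j + 2) x * M (j + 2))
      - 4 * (real j + 3 + real DIM('a) / 2) * (nmean \<Omega> \<phi> \<tau> (j + 3) x * M (j + 3)))
     = - l * (nmean \<Omega> \<phi> \<tau> (j + 4) x * M (j + 4))"
    using power_mean_recurrence[OF w i \<tau> cball_subset_inner_part[OF x], of "j + 4"]
    unfolding B k by (simp add: distrib_left)
  from mean_recurrence_algebra[OF _ _ _ M S3 S4 this]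
  show ?thesis by (simp add: mean_coeff_def add_pos_nonneg)
qed

text \<open>Partial fractions make the sum telescope to at most \<open>l * \<tau> / 12\<close>,
  which is below the \<open>1 / 8\<close> that \<open>three_term_sequence\<close> asks for.\<close>

lemma mean_coeff_sum:
  assumes "0 \<le> l * \<tau>" "l * \<tau> \<le> 1"
  shows "0 \<le> mean_coeff d l \<tau> i" "(\<Sum>i<n. mean_coeff d l \<tau> i) \<le> 1 / 8"
proof -
  define e where "e = real d / 2"
  have e: "e \<ge> 0" by (simp add: e_def)
  show "0 \<le> mean_coeff d l \<tau> i" using assms by (simp add: mean_coeff_def)
  have "mean_coeff d l \<tau> i = l * \<tau> / 4 * (1 / (real i + 3 + e) - 1 / (real (Suc i) + 3 + e))" for i
  proof -
    have "real i + 3 + e > 0" "real i + 4 + e > 0" using e by auto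
    then have "1 / (real i + 3 + e) - 1 / (real i + 4 + e) = 1 / ((real i + 3 + e) * (real i + 4 + e))"
      by (simp add: field_simps)
    then show ?thesis by (simp add: mean_coeff_def e_def add_ac)
  qed
  then have "(\<Sum>i<n. mean_coeff d l \<tau> i) = l * \<tau> / 4 * (\<Sum>i<n. 1 / (real i + 3 + e) - 1 / (real (Suc i) + 3 + e))"
    by (simp only: sum_distrib_left)
  also have "\<dots> = l * \<tau> / 4 * (1 / (3 + e) - 1 / (real n + 3 + e))"
    by (subst sum_lessThan_telescope') simp
  also have "\<dots> \<le> l * \<tau> / 4 * (1 / 3)"
  proof (rule mult_left_mono)
    have "1 / (3 + e) \<le> 1 / 3" using e by (intro divide_left_mono) auto
    moreover have "1 / (real n + 3 + e) \<ge> 0" using e by simp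
    ultimately show "1 / (3 + e) - 1 / (real n + 3 + e) \<le> 1 / 3" by linarith
  qed (use assms in simp)
  also have "\<dots> \<le> 1 / 8" using assms by linarith
  finally show "(\<Sum>i<n. mean_coeff d l \<tau> i) \<le> 1 / 8" .
qed

text \<open>A crude bound that may grow with \<open>k\<close>, but only like the reciprocals of the
  moments. That is enough to exclude the fast solutions of the recurrence.\<close>

lemma abs_nmean_le:
  fixes x :: "'a::euclidean_space"
  assumes i: "integrable (lebesgue_on \<Omega>) \<phi>" and \<tau>: "\<tau> > 0"
  shows "\<bar>nmean \<Omega> \<phi> \<tau> k x\<bar> \<le> (LINT y|lebesgue_on \<Omega>. \<bar>\<phi> y\<bar>) / \<tau> powr (real DIM('a) / 2) / ball_moment DIM('a) k"
proof -
  define A where "A = (LINT y|lebesgue_on \<Omega>. \<bar>\<phi> y\<bar>)"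
  have "\<bar>power_mean \<Omega> \<phi> \<tau> k x\<bar> \<le> (LINT y|lebesgue_on \<Omega>. \<bar>\<phi> y\<bar> * \<tau> ^ k)"
    unfolding power_mean_def
  proof (rule order_trans[OF integral_abs_bound], rule integral_mono)
    show "integrable (lebesgue_on \<Omega>) (\<lambda>y. \<bar>\<phi> y * pos_power k (\<tau> - (norm (y - x))\<^sup>2)\<bar>)"
      using integrable_mult_pos_power[OF i] by simp
    show "integrable (lebesgue_on \<Omega>) (\<lambda>y. \<bar>\<phi> y\<bar> * \<tau> ^ k)" using i by simp
    show "\<bar>\<phi> y * pos_power k (\<tau> - (norm (y - x))\<^sup>2)\<bar> \<le> \<bar>\<phi> y\<bar> * \<tau> ^ k" for y
      using \<tau> by (auto simp: abs_mult pos_power_def intro!: mult_left_mono power_mono)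
  qed
  also have "\<dots> = A * \<tau> ^ k" by (simp add: A_def)
  finally have "\<bar>nmean \<Omega> \<phi> \<tau> k x\<bar> \<le> A * \<tau> ^ k / kernel_mass TYPE('a) \<tau> k"
    using kernel_mass_pos[OF \<tau>, of k, where 'a = 'a] by (simp add: nmean_def abs_divide divide_right_mono)
  also have "\<dots> = A / \<tau> powr (real DIM('a) / 2) / ball_moment DIM('a) k"
    using \<tau> by (simp add: kernel_mass_eq)
  finally show ?thesis by (simp add: A_def)
qed

lemma nmean_bounds:
  fixes x :: "'a::euclidean_space"
  assumes w: "weak_eigenfunction \<Omega> l \<phi>" and i: "integrable (lebesgue_on \<Omega>) \<phi>"
    and \<tau>: "\<tau> > 0" "0 \<le> l" "l * \<tau> \<le> 1" and x: "x \<in> inner_part \<Omega> \<tau>"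
  shows "\<bar>nmean \<Omega> \<phi> \<tau> (j + 2) x\<bar> \<le> 2 * \<bar>nmean \<Omega> \<phi> \<tau> 2 x\<bar>"
    and "\<bar>nmean \<Omega> \<phi> \<tau> (j + 3) x - nmean \<Omega> \<phi> \<tau> (j + 2) x\<bar> \<le> 8 * mean_coeff DIM('a) l \<tau> j * \<bar>nmean \<Omega> \<phi> \<tau> 2 x\<bar>"
proof -
  define \<beta> where "\<beta> j = nmean \<Omega> \<phi> \<tau> (j + 2) x" for j
  have rec: "\<beta> (Suc j) - \<beta> j = mean_coeff DIM('a) l \<tau> j * \<beta> (Suc (Suc j))" for j
    using nmean_recurrence[OF w i \<tau>(1) x, of j] by (simp add: \<beta>_def numeral_eq_Suc)
  have l\<tau>: "0 \<le> l * \<tau>" using \<tau> by simp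
  \<comment> \<open>\<open>2 / 3\<close> is the reciprocal of the growth rate \<open>3 / 2\<close>
    permitted by \<open>three_term_sequence\<close>.\<close>
  obtain N where N: "\<And>k. ball_moment DIM('a) N * (2 / 3) ^ k \<le> ball_moment DIM('a) (N + k)"
    using ball_moment_lower[of "2/3" "DIM('a)"] by auto
  define A where "A = (LINT y|lebesgue_on \<Omega>. \<bar>\<phi> y\<bar>) / \<tau> powr (real DIM('a) / 2)"
  have A: "A \<ge> 0" by (simp add: A_def)
  have growth: "\<bar>\<beta> j\<bar> \<le> (A / ball_moment DIM('a) N * (3 / 2) ^ 2) * (3 / 2) ^ j" if "N \<le> j" for j
  proof -
    define k where "k = j + 2 - N"
    have k: "j + 2 = N + k" "k \<le> j + 2" using that by (auto simp: k_def)
    have bN: "ball_moment DIM('a) N > 0" by (rule ball_moment_pos)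
    have "\<bar>\<beta> j\<bar> \<le> A / ball_moment DIM('a) (j + 2)"
      using abs_nmean_le[OF i \<tau>(1), of "j + 2" x] by (simp add: \<beta>_def A_def)
    also have "\<dots> \<le> A / (ball_moment DIM('a) N * (2 / 3) ^ k)"
      unfolding k(1) using N A bN by (intro divide_left_mono mult_pos_pos ball_moment_pos) auto
    also have "\<dots> = A / ball_moment DIM('a) N * (3 / 2) ^ k"
      by (simp add: power_divide)
    also have "\<dots> \<le> A / ball_moment DIM('a) N * (3 / 2) ^ (j + 2)"
      using A bN k(2) by (intro mult_left_mono power_increasing) auto
    finally show ?thesis by (simp add: power_add power2_eq_square mult_ac)
  qed
  note T = three_term_sequence[of \<beta> "mean_coeff DIM('a) l \<tau>", OF rec mean_coeff_sum[OF l\<tau> \<tau>(3)] growth]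
  show "\<bar>nmean \<Omega> \<phi> \<tau> (j + 2) x\<bar> \<le> 2 * \<bar>nmean \<Omega> \<phi> \<tau> 2 x\<bar>"
    using T(1)[of N j] by (simp add: \<beta>_def numeral_2_eq_2)
  show "\<bar>nmean \<Omega> \<phi> \<tau> (j + 3) x - nmean \<Omega> \<phi> \<tau> (j + 2) x\<bar> \<le> 8 * mean_coeff DIM('a) l \<tau> j * \<bar>nmean \<Omega> \<phi> \<tau> 2 x\<bar>"
    using T(2)[of N j] by (simp add: \<beta>_def numeral_eq_Suc)
qed

text \<open>The increments are dominated by the summable coefficients \<open>mean_coeff\<close>,
  uniformly in \<open>x\<close> because the mean of index \<open>2\<close> is bounded by a
  constant.\<close>

lemma nmean_uniform_limit:
  assumes w: "weak_eigenfunction \<Omega> l \<phi>" and i: "integrable (lebesgue_on \<Omega>) \<phi>"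
    and \<tau>: "\<tau> > 0" "0 \<le> l" "l * \<tau> \<le> 1"
  obtains h where "uniform_limit (inner_part \<Omega> \<tau>) (\<lambda>j. nmean \<Omega> \<phi> \<tau> (j + 2)) h sequentially"
    "continuous_on (inner_part \<Omega> \<tau>) h" "\<And>x. x \<in> inner_part \<Omega> \<tau> \<Longrightarrow> \<bar>h x\<bar> \<le> 2 * \<bar>nmean \<Omega> \<phi> \<tau> 2 x\<bar>"
proof -
  let ?U = "inner_part \<Omega> \<tau>"
  let ?c = "mean_coeff DIM('a) l \<tau>"
  have l\<tau>: "0 \<le> l * \<tau>" using \<tau> by simp
  define K where "K = (LINT y|lebesgue_on \<Omega>. \<bar>\<phi> y\<bar>) / \<tau> powr (real DIM('a) / 2) / ball_moment DIM('a) 2"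
  have K: "\<bar>nmean \<Omega> \<phi> \<tau> 2 x\<bar> \<le> K" for x
    unfolding K_def by (rule abs_nmean_le[OF i \<tau>(1)])
  define f where "f j x = nmean \<Omega> \<phi> \<tau> (j + 3) x - nmean \<Omega> \<phi> \<tau> (j + 2) x" for j x
  have "uniform_limit ?U (\<lambda>n x. \<Sum>j<n. f j x) (\<lambda>x. \<Sum>j. f j x) sequentially"
  proof (rule Weierstrass_m_test)
    fix j x assume "x \<in> ?U"
    then have "\<bar>f j x\<bar> \<le> 8 * ?c j * \<bar>nmean \<Omega> \<phi> \<tau> 2 x\<bar>"
      unfolding f_def by (rule nmean_bounds(2)[OF w i \<tau>])
    also have "\<dots> \<le> 8 * ?c j * K" using mean_coeff_sum(1)[OF l\<tau> \<tau>(3)] K by (intro mult_left_mono) auto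
    finally show "norm (f j x) \<le> 8 * ?c j * K" by simp
  next
    have "summable ?c" by (rule summableI_nonneg_bounded[OF mean_coeff_sum[OF l\<tau> \<tau>(3)]])
    then show "summable (\<lambda>j. 8 * ?c j * K)" by (intro summable_mult summable_mult2)
  qed
  then have "uniform_limit ?U (\<lambda>n x. nmean \<Omega> \<phi> \<tau> 2 x + (\<Sum>j<n. f j x)) (\<lambda>x. nmean \<Omega> \<phi> \<tau> 2 x + (\<Sum>j. f j x)) sequentially"
    by (intro uniform_limit_add uniform_limit_const)
  moreover have "nmean \<Omega> \<phi> \<tau> 2 x + (\<Sum>j<n. f j x) = nmean \<Omega> \<phi> \<tau> (n + 2) x" for n x
    by (induction n) (simp_all add: f_def numeral_eq_Suc)
  ultimately have lim: "uniform_limit ?U (\<lambda>j. nmean \<Omega> \<phi> \<tau> (j + 2)) (\<lambda>x. nmean \<Omega> \<phi> \<tau> 2 x + (\<Sum>j. f j x)) sequentially"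
    by simp
  show thesis
  proof (rule that[OF lim])
    show "continuous_on ?U (\<lambda>x. nmean \<Omega> \<phi> \<tau> 2 x + (\<Sum>j. f j x))"
      by (rule uniform_limit_theorem[OF _ lim])
         (auto intro!: always_eventually nmean_continuous[OF i])
    fix x assume x: "x \<in> ?U"
    have "(\<lambda>j. \<bar>nmean \<Omega> \<phi> \<tau> (j + 2) x\<bar>) \<longlonglongrightarrow> \<bar>nmean \<Omega> \<phi> \<tau> 2 x + (\<Sum>j. f j x)\<bar>"
      by (intro tendsto_intros tendsto_uniform_limitI[OF lim x])
    then show "\<bar>nmean \<Omega> \<phi> \<tau> 2 x + (\<Sum>j. f j x)\<bar> \<le> 2 * \<bar>nmean \<Omega> \<phi> \<tau> 2 x\<bar>"
      by (rule LIMSEQ_le_const2) (use nmean_bounds(1)[OF w i \<tau> x] in blast)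
  qed
qed

section \<open>Continuous representatives of eigenfunctions\<close>

text \<open>A smoothed indicator of the box. The kernel is symmetric in its two points, so
  integrating the means over a box amounts to integrating \<open>\<phi>\<close> against this
  weight.\<close>

definition box_weight :: "'a::euclidean_space \<Rightarrow> 'a \<Rightarrow> real \<Rightarrow> nat \<Rightarrow> 'a \<Rightarrow> real" where
  "box_weight a b \<tau> k y =
     (LINT x|lborel. indicator (cbox a b) x * pos_power k (\<tau> - (norm (x - y))\<^sup>2)) / kernel_mass TYPE('a) \<tau> k"

lemma pos_power_nonneg: "0 \<le> pos_power k t"
  by (simp add: pos_power_def)

text \<open>The link between the limit of the means and \<open>\<phi>\<close>: convergence is tested
  on integrals over boxes, for which it suffices that the weights converge to an indicator.\<close>

lemma nmean_box_integral:
  fixes \<Omega> :: "'a::euclidean_space set"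
  assumes \<Omega>: "bounded \<Omega>" "\<Omega> \<in> sets lebesgue" and i: "integrable (lebesgue_on \<Omega>) \<phi>"
    and \<tau>: "\<tau> > 0" and k: "1 \<le> k"
  shows "integral (cbox a b) (nmean \<Omega> \<phi> \<tau> k) = (LINT y|lebesgue_on \<Omega>. \<phi> y * box_weight a b \<tau> k y)"
proof -
  let ?M = "lebesgue_on \<Omega>"
  interpret F: finite_measure ?M
    by (rule finite_measure_lebesgue_on[OF bounded_set_imp_lmeasurable[OF \<Omega>]])
  interpret P: pair_sigma_finite lborel ?M
    by (intro pair_sigma_finite.intro lborel.sigma_finite_measure_axioms F.sigma_finite_measure_axioms)
  define f where "f x y = indicator (cbox a b) x * (\<phi> y * pos_power k (\<tau> - (norm (y - x))\<^sup>2))" for x y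
  have \<phi>: "\<phi> \<in> borel_measurable ?M" using i by simp
  have idm: "(\<lambda>y. y) \<in> ?M \<rightarrow>\<^sub>M borel" by (rule borel_lebesgue_on) simp
  have [measurable]: "(\<lambda>z. \<phi> (snd z)) \<in> borel_measurable (lborel \<Otimes>\<^sub>M ?M)"
    by (rule measurable_compose[OF measurable_snd \<phi>])
  have [measurable]: "snd \<in> borel_measurable (lborel \<Otimes>\<^sub>M ?M)"
    by (rule measurable_compose[OF measurable_snd idm])
  have [measurable]: "fst \<in> borel_measurable (lborel \<Otimes>\<^sub>M ?M)"
    using measurable_fst[of lborel ?M] by simp
  have fm: "case_prod f \<in> borel_measurable (lborel \<Otimes>\<^sub>M ?M)"
    unfolding f_def case_prod_unfold by measurable
  have "integrable (lborel \<Otimes>\<^sub>M ?M) (case_prod f)"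
  proof (rule P.Fubini_integrable[OF fm])
    have "integrable lborel (\<lambda>x. indicator (cbox a b) x *\<^sub>R power_mean \<Omega> (\<lambda>y. \<bar>\<phi> y\<bar>) \<tau> k x)"
      by (rule borel_integrable_compact[OF compact_cbox power_mean_continuous[OF _ k]]) (use i in simp)
    moreover have "(LINT y|?M. norm (case_prod f (x, y))) = indicator (cbox a b) x *\<^sub>R power_mean \<Omega> (\<lambda>y. \<bar>\<phi> y\<bar>) \<tau> k x" for x
      by (simp add: f_def abs_mult power_mean_def abs_of_nonneg[OF pos_power_nonneg])
    ultimately show "integrable lborel (\<lambda>x. LINT y|?M. norm (case_prod f (x, y)))" by simp
    show "AE x in lborel. integrable ?M (\<lambda>y. case_prod f (x, y))"
      using integrable_mult_pos_power[OF i] by (simp add: f_def)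
  qed
  from P.Fubini_integral[OF this]
  have eq: "(LINT y|?M. (LINT x|lborel. f x y)) = (LINT x|lborel. (LINT y|?M. f x y))" .
  have "set_integrable lborel (cbox a b) (power_mean \<Omega> \<phi> \<tau> k)"
    unfolding set_integrable_def by (rule borel_integrable_compact[OF compact_cbox power_mean_continuous[OF i k]])
  then have "(LINT x:cbox a b|lborel. power_mean \<Omega> \<phi> \<tau> k x) = integral (cbox a b) (power_mean \<Omega> \<phi> \<tau> k)"
    by (rule set_borel_integral_eq_integral)
  moreover have "(LINT x|lborel. (LINT y|?M. f x y)) = (LINT x:cbox a b|lborel. power_mean \<Omega> \<phi> \<tau> k x)"
    by (simp add: f_def power_mean_def set_lebesgue_integral_def)
  moreover have "(LINT x|lborel. f x y) = \<phi> y * (LINT x|lborel. indicator (cbox a b) x * pos_power k (\<tau> - (norm (x - y))\<^sup>2))" for y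
  proof -
    have "f x y = \<phi> y * (indicator (cbox a b) x * pos_power k (\<tau> - (norm (x - y))\<^sup>2))" for x
      by (simp add: f_def norm_minus_commute)
    then show ?thesis by simp
  qed
  ultimately have "integral (cbox a b) (power_mean \<Omega> \<phi> \<tau> k)
      = (LINT y|?M. \<phi> y * (LINT x|lborel. indicator (cbox a b) x * pos_power k (\<tau> - (norm (x - y))\<^sup>2)))"
    using eq by simp
  then show ?thesis
    by (simp add: nmean_def[abs_def] box_weight_def)
qed

section \<open>The power kernels as an approximate identity\<close>

lemma integral_pos_power_mass:
  fixes y :: "'a::euclidean_space"
  assumes "\<tau> > 0"
  shows "(LINT x|lborel. pos_power k (\<tau> - (norm (x - y))\<^sup>2)) = kernel_mass TYPE('a) \<tau> k"
  using integral_pos_power(2)[of \<tau> k y] assms by (simp add: kernel_mass_def)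

lemma integrable_indicator_pos_power:
  fixes y :: "'a::euclidean_space"
  assumes "\<tau> > 0" "A \<in> sets borel"
  shows "integrable lborel (\<lambda>x. indicator A x * pos_power k (\<tau> - (norm (x - y))\<^sup>2))"
  using integrable_mult_indicator[OF _ integral_pos_power(1)[of \<tau> k y], of A] assms by simp

text \<open>At distance at least \<open>r\<close> the kernel is at most \<open>\<sigma> ^ k\<close>
  with \<open>\<sigma> < \<tau>\<close>, whereas for each \<open>\<theta> < 1\<close> its mass is
  eventually at least a positive constant times \<open>(\<theta> * \<tau>) ^ k\<close>.\<close>

lemma pos_power_tail:
  fixes y :: "'a::euclidean_space"
  assumes r: "r > 0" and \<tau>: "\<tau> > 0"
  shows "(\<lambda>k. (LINT x|lborel. indicator {x. r \<le> norm (x - y)} x * pos_power k (\<tau> - (norm (x - y))\<^sup>2))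
      / kernel_mass TYPE('a) \<tau> k) \<longlonglongrightarrow> 0"
    (is "(\<lambda>k. ?I k / _) \<longlonglongrightarrow> 0")
proof -
  have cl: "{x. r \<le> norm (x - y)} \<in> sets borel"
    by (intro borel_closed closed_Collect_le continuous_intros)
  have I0: "?I k \<ge> 0" for k by (simp add: pos_power_nonneg)
  define \<sigma> where "\<sigma> = max 0 (\<tau> - r\<^sup>2)"
  have \<sigma>: "0 \<le> \<sigma>" "\<sigma> < \<tau>" using r \<tau> by (auto simp: \<sigma>_def)
  define V where "V = measure lborel (ball y (sqrt \<tau>))"
  have Ik: "?I k \<le> \<sigma> ^ k * V" for k
  proof -
    have "?I k \<le> (LINT x|lborel. \<sigma> ^ k * indicator (ball y (sqrt \<tau>)) x)"
    proof (rule integral_mono)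
      show "integrable lborel (\<lambda>x. indicator {x. r \<le> norm (x - y)} x * pos_power k (\<tau> - (norm (x - y))\<^sup>2))"
        by (rule integrable_indicator_pos_power[OF \<tau> cl])
      show "integrable lborel (\<lambda>x. \<sigma> ^ k * indicator (ball y (sqrt \<tau>)) x :: real)"
        using emeasure_bounded_finite[OF bounded_ball, of y "sqrt \<tau>"] by simp
      fix x
      show "indicator {x. r \<le> norm (x - y)} x * pos_power k (\<tau> - (norm (x - y))\<^sup>2) \<le> \<sigma> ^ k * indicator (ball y (sqrt \<tau>)) x"
      proof (cases "r \<le> norm (x - y) \<and> (norm (x - y))\<^sup>2 < \<tau>")
        case True
        then have "r\<^sup>2 \<le> (norm (x - y))\<^sup>2" using r by (intro power_mono) auto
        then have "\<tau> - (norm (x - y))\<^sup>2 \<le> \<sigma>" by (simp add: \<sigma>_def)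
        moreover have "norm (x - y) < sqrt \<tau>" using True by (simp add: real_less_rsqrt)
        ultimately show ?thesis using True
          by (auto simp: pos_power_def dist_norm norm_minus_commute intro!: power_mono)
      next
        case False
        then show ?thesis using \<sigma> by (auto simp: pos_power_def)
      qed
    qed
    then show ?thesis by (simp add: V_def)
  qed
  \<comment> \<open>The midpoint between \<open>\<sigma> / \<tau>\<close> and \<open>1\<close>, so
    that the ratio \<open>\<sigma> / \<tau> / \<theta>\<close> stays below \<open>1\<close>.\<close>
  define \<theta> where "\<theta> = (1 + \<sigma> / \<tau>) / 2"
  have st: "0 \<le> \<sigma> / \<tau>" "\<sigma> / \<tau> < 1" using \<sigma> \<tau> by auto
  define \<rho> where "\<rho> = \<sigma> / \<tau>"
  have \<theta>: "0 < \<theta>" "\<theta> < 1" "\<sigma> / \<tau> < \<theta>"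
    using st unfolding \<theta>_def \<rho>_def[symmetric] by simp_all
  obtain N where N: "\<And>k. ball_moment DIM('a) N * \<theta> ^ k \<le> ball_moment DIM('a) (N + k)"
    using ball_moment_lower[OF \<theta>(1,2)] by blast
  define P where "P = \<tau> powr (real DIM('a) / 2)"
  have P: "P > 0" using \<tau> by (simp add: P_def)
  have bN: "ball_moment DIM('a) N > 0" by (rule ball_moment_pos)
  have V0: "V \<ge> 0" by (simp add: V_def)
  have bound: "?I k / kernel_mass TYPE('a) \<tau> k \<le> V / (P * ball_moment DIM('a) N) * (\<sigma> / \<tau> / \<theta>) ^ k" if k: "N \<le> k" for k
  proof -
    have "\<theta> ^ k \<le> \<theta> ^ (k - N)" using \<theta> by (intro power_decreasing) auto
    then have "ball_moment DIM('a) N * \<theta> ^ k \<le> ball_moment DIM('a) N * \<theta> ^ (k - N)"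
      using bN by (intro mult_left_mono) auto
    also have "\<dots> \<le> ball_moment DIM('a) k" using N[of "k - N"] k by simp
    finally have b: "ball_moment DIM('a) N * \<theta> ^ k \<le> ball_moment DIM('a) k" .
    have "?I k / kernel_mass TYPE('a) \<tau> k \<le> \<sigma> ^ k * V / (ball_moment DIM('a) N * \<theta> ^ k * \<tau> ^ k * P)"
      unfolding kernel_mass_eq[OF \<tau>] P_def[symmetric]
      using Ik[of k] b \<theta> \<tau> P bN V0 \<sigma> by (intro frac_le mult_right_mono mult_pos_pos mult_nonneg_nonneg) auto
    also have "\<dots> = V / (P * ball_moment DIM('a) N) * (\<sigma> / \<tau> / \<theta>) ^ k"
      by (simp add: power_divide power_mult_distrib mult_ac)
    finally show ?thesis .
  qed
  show ?thesis
  proof (rule real_tendsto_sandwich[of "\<lambda>_. 0"])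
    show "\<forall>\<^sub>F k in sequentially. 0 \<le> ?I k / kernel_mass TYPE('a) \<tau> k"
      using I0 kernel_mass_pos[OF \<tau>, where 'a = 'a] by (intro always_eventually allI divide_nonneg_pos) auto
    show "\<forall>\<^sub>F k in sequentially. ?I k / kernel_mass TYPE('a) \<tau> k \<le> V / (P * ball_moment DIM('a) N) * (\<sigma> / \<tau> / \<theta>) ^ k"
      using eventually_ge_at_top[of N] by eventually_elim (rule bound)
    have "norm (\<sigma> / \<tau> / \<theta>) = \<sigma> / \<tau> / \<theta>" using \<theta>(1) st(1) by (simp only: real_norm_def abs_of_nonneg divide_nonneg_pos)
    then have "norm (\<sigma> / \<tau> / \<theta>) < 1" using \<theta> by (simp only: pos_divide_less_eq mult_1)
    from tendsto_mult_left[OF LIMSEQ_power_zero[OF this], of "V / (P * ball_moment DIM('a) N)"]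
    show "(\<lambda>k. V / (P * ball_moment DIM('a) N) * (\<sigma> / \<tau> / \<theta>) ^ k) \<longlonglongrightarrow> 0" by simp
  qed simp
qed

lemma box_weight_bounds:
  fixes a b y :: "'a::euclidean_space"
  assumes \<tau>: "\<tau> > 0"
  shows "0 \<le> box_weight a b \<tau> k y" "box_weight a b \<tau> k y \<le> 1"
proof -
  note m = kernel_mass_pos[OF \<tau>, of k, where 'a = 'a]
  show "0 \<le> box_weight a b \<tau> k y"
    unfolding box_weight_def using m by (intro divide_nonneg_pos integral_nonneg) (auto simp: pos_power_nonneg)
  have "(LINT x|lborel. indicator (cbox a b) x * pos_power k (\<tau> - (norm (x - y))\<^sup>2))
      \<le> (LINT x|lborel. pos_power k (\<tau> - (norm (x - y))\<^sup>2))"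
    using \<tau> by (intro integral_mono integrable_indicator_pos_power integral_pos_power(1))
       (auto simp: indicator_def pos_power_nonneg)
  then show "box_weight a b \<tau> k y \<le> 1"
    using m by (simp add: box_weight_def integral_pos_power_mass[OF \<tau>])
qed

lemma box_weight_outside:
  fixes a b y :: "'a::euclidean_space"
  assumes \<tau>: "\<tau> > 0" and y: "y \<notin> cbox a b"
  shows "(\<lambda>k. box_weight a b \<tau> k y) \<longlonglongrightarrow> 0"
proof -
  obtain r where r: "r > 0" "ball y r \<subseteq> - cbox a b"
    using open_contains_ball[of "- cbox a b"] closed_cbox[of a b] y by (auto simp: open_Compl)
  have cl: "{x. r \<le> norm (x - y)} \<in> sets borel"
    by (intro borel_closed closed_Collect_le continuous_intros)
  show ?thesis
  proof (rule real_tendsto_sandwich[OF _ _ tendsto_const pos_power_tail[OF r(1) \<tau>]])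
    show "\<forall>\<^sub>F k in sequentially. 0 \<le> box_weight a b \<tau> k y" by (intro always_eventually allI box_weight_bounds \<tau>)
    have "box_weight a b \<tau> k y \<le>
      (LINT x|lborel. indicator {x. r \<le> norm (x - y)} x * pos_power k (\<tau> - (norm (x - y))\<^sup>2)) / kernel_mass TYPE('a) \<tau> k" for k
      unfolding box_weight_def
    proof (intro divide_right_mono integral_mono integrable_indicator_pos_power \<tau> cl)
      show "indicator (cbox a b) x * pos_power k (\<tau> - (norm (x - y))\<^sup>2)
          \<le> indicator {x. r \<le> norm (x - y)} x * pos_power k (\<tau> - (norm (x - y))\<^sup>2)" for x
      proof (intro mult_right_mono pos_power_nonneg)
        have "r \<le> norm (x - y)" if "x \<in> cbox a b"
          using that r(2) by (force simp: dist_norm norm_minus_commute)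
        then show "indicator (cbox a b) x \<le> (indicator {x. r \<le> norm (x - y)} x :: real)"
          by (simp add: indicator_def)
      qed
    qed (use kernel_mass_pos[OF \<tau>, of k, where 'a = 'a] in auto)
    then show "\<forall>\<^sub>F k in sequentially. box_weight a b \<tau> k y \<le>
      (LINT x|lborel. indicator {x. r \<le> norm (x - y)} x * pos_power k (\<tau> - (norm (x - y))\<^sup>2)) / kernel_mass TYPE('a) \<tau> k"
      by simp
  qed
qed

lemma box_weight_inside:
  fixes a b y :: "'a::euclidean_space"
  assumes \<tau>: "\<tau> > 0" and y: "y \<in> box a b"
  shows "(\<lambda>k. box_weight a b \<tau> k y) \<longlonglongrightarrow> 1"
proof -
  obtain r where r: "r > 0" "ball y r \<subseteq> cbox a b"
    using open_contains_ball[of "box a b"] y box_subset_cbox[of a b] by (metis open_box subset_trans)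
  let ?T = "\<lambda>k. (LINT x|lborel. indicator {x. r \<le> norm (x - y)} x * pos_power k (\<tau> - (norm (x - y))\<^sup>2)) / kernel_mass TYPE('a) \<tau> k"
  have cl: "{x. r \<le> norm (x - y)} \<in> sets borel"
    by (intro borel_closed closed_Collect_le continuous_intros)
  have T: "(\<lambda>k. 1 - ?T k) \<longlonglongrightarrow> 1"
    using tendsto_diff[OF tendsto_const[of 1] pos_power_tail[OF r(1) \<tau>, of y]] by simp
  show ?thesis
  proof (rule real_tendsto_sandwich[OF _ _ T tendsto_const])
    show "\<forall>\<^sub>F k in sequentially. box_weight a b \<tau> k y \<le> 1" by (intro always_eventually allI box_weight_bounds \<tau>)
    have "1 - ?T k \<le> box_weight a b \<tau> k y" for k
    proof -
      note m = kernel_mass_pos[OF \<tau>, of k, where 'a = 'a]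
      let ?p = "\<lambda>x. pos_power k (\<tau> - (norm (x - y))\<^sup>2)"
      have "kernel_mass TYPE('a) \<tau> k = (LINT x|lborel. ?p x)" by (rule integral_pos_power_mass[OF \<tau>, symmetric])
      also have "\<dots> \<le> (LINT x|lborel. indicator (cbox a b) x * ?p x + indicator {x. r \<le> norm (x - y)} x * ?p x)"
      proof (intro integral_mono Bochner_Integration.integrable_add integrable_indicator_pos_power \<tau> cl)
        show "integrable lborel ?p" using \<tau> by (intro integral_pos_power(1)) simp
        show "?p x \<le> indicator (cbox a b) x * ?p x + indicator {x. r \<le> norm (x - y)} x * ?p x" for x
          using r(2) pos_power_nonneg[of k "\<tau> - (norm (x - y))\<^sup>2"]
          by (cases "r \<le> norm (x - y)") (auto simp: indicator_def subset_iff dist_norm norm_minus_commute)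
      qed auto
      also have "\<dots> = (LINT x|lborel. indicator (cbox a b) x * ?p x) + (LINT x|lborel. indicator {x. r \<le> norm (x - y)} x * ?p x)"
        by (intro Bochner_Integration.integral_add integrable_indicator_pos_power \<tau> cl) auto
      finally have "1 \<le> ((LINT x|lborel. indicator (cbox a b) x * ?p x) + (LINT x|lborel. indicator {x. r \<le> norm (x - y)} x * ?p x)) / kernel_mass TYPE('a) \<tau> k"
        using m by (simp add: le_divide_eq)
      then show ?thesis by (simp add: box_weight_def add_divide_distrib)
    qed
    then show "\<forall>\<^sub>F k in sequentially. 1 - ?T k \<le> box_weight a b \<tau> k y" by simp
  qed
qed

lemma nmean_box_tendsto:
  fixes \<Omega> :: "'a::euclidean_space set"
  assumes \<Omega>: "bounded \<Omega>" "\<Omega> \<in> sets lebesgue" and i: "integrable (lebesgue_on \<Omega>) \<phi>" and \<tau>: "\<tau> > 0"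
  shows "(\<lambda>k. integral (cbox a b) (nmean \<Omega> \<phi> \<tau> (k + 2))) \<longlonglongrightarrow> (LINT y|lebesgue_on \<Omega>. \<phi> y * indicator (cbox a b) y)"
proof -
  let ?M = "lebesgue_on \<Omega>"
  have "box_weight a b \<tau> k \<in> borel_measurable borel" for k
    unfolding box_weight_def[abs_def] by measurable
  then have wm: "box_weight a b \<tau> k \<in> borel_measurable ?M" for k by (rule borel_lebesgue_on)
  have \<phi>: "\<phi> \<in> borel_measurable ?M" using i by simp
  have im: "(indicator (cbox a b) :: 'a \<Rightarrow> real) \<in> borel_measurable ?M" by (rule borel_lebesgue_on) simp
  \<comment> \<open>The limit of the weights is known only off the faces of the box, which form a
    null set.\<close>
  have "AE y in lebesgue. y \<notin> cbox a b - box a b"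
    using negligible_frontier_interval[of a b] by (intro AE_not_in) (simp add: negligible_iff_null_sets)
  then have ae: "AE y in ?M. y \<notin> cbox a b - box a b"
    using \<Omega>(2) by (simp add: AE_restrict_space_iff) (auto elim: eventually_mono)
  have "(\<lambda>k. LINT y|?M. \<phi> y * box_weight a b \<tau> (k + 2) y) \<longlonglongrightarrow> (LINT y|?M. \<phi> y * indicator (cbox a b) y)"
  proof (rule integral_dominated_convergence)
    show "integrable ?M (\<lambda>y. \<bar>\<phi> y\<bar>)" using i by simp
    show "AE y in ?M. (\<lambda>k. \<phi> y * box_weight a b \<tau> (k + 2) y) \<longlonglongrightarrow> \<phi> y * indicator (cbox a b) y"
      using ae
    proof eventually_elim
      case (elim y)
      have "(\<lambda>k. box_weight a b \<tau> k y) \<longlonglongrightarrow> indicator (cbox a b) y"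
        using elim box_weight_inside[OF \<tau>, of y a b] box_weight_outside[OF \<tau>, of y a b]
        by (cases "y \<in> cbox a b") auto
      then show ?case by (intro tendsto_mult tendsto_const LIMSEQ_ignore_initial_segment)
    qed
    show "AE y in ?M. norm (\<phi> y * box_weight a b \<tau> (k + 2) y) \<le> \<bar>\<phi> y\<bar>" for k
      using box_weight_bounds[OF \<tau>, of a b "k + 2"] by (intro AE_I2) (simp add: abs_mult mult_left_le)
  qed (use \<phi> wm im in \<open>auto intro!: borel_measurable_times\<close>)
  then show ?thesis by (simp add: nmean_box_integral[OF \<Omega> i \<tau>])
qed

section \<open>Functions determined almost everywhere by their box integrals\<close>

lemma negligible_if_box_integrals_zero:
  fixes f :: "'a::euclidean_space \<Rightarrow> real"
  assumes U: "open U" and z: "\<And>a b. cbox a b \<subseteq> U \<Longrightarrow> (f has_integral 0) (cbox a b)"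
  shows "negligible {x\<in>U. f x \<noteq> 0}"
proof -
  have box: "negligible {x\<in>cbox c d. f x \<noteq> 0}" if cd: "cbox c d \<subseteq> U" for c d
  proof -
    \<comment> \<open>Extended by zero, the function has integral zero over every box, since boxes
      intersect in boxes; differentiation of integrals over small cubes then applies on the whole
      space.\<close>
    define g where "g x = (if x \<in> cbox c d then f x else 0)" for x
    have g: "(g has_integral 0) (cbox a b)" for a b
    proof -
      obtain a' b' where ab: "cbox a b \<inter> cbox c d = cbox a' b'" using that[OF Int_interval] .
      moreover have "cbox a b \<inter> cbox c d \<subseteq> U" using cd by blast
      ultimately have "(f has_integral 0) (cbox a b \<inter> cbox c d)" using z[of a' b'] by simp
      then show ?thesis unfolding g_def by (simp add: has_integral_restrict_Int Int_commute)
    qed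
    obtain N where N: "negligible N" "\<And>x e. \<lbrakk>x \<notin> N; 0 < e\<rbrakk> \<Longrightarrow>
        \<exists>d>0. \<forall>h. 0 < h \<and> h < d \<longrightarrow> norm (integral (cbox x (x + h *\<^sub>R One)) g /\<^sub>R h ^ DIM('a) - g x) < e"
      using integrable_ccontinuous_explicit[of g] g by blast
    have gz: "g x = 0" if xN: "x \<notin> N" for x
    proof (rule ccontr)
      assume "g x \<noteq> 0"
      then obtain d where d: "d > 0" "\<forall>h. 0 < h \<and> h < d \<longrightarrow>
          norm (integral (cbox x (x + h *\<^sub>R One)) g /\<^sub>R h ^ DIM('a) - g x) < \<bar>g x\<bar>"
        using N(2)[OF xN, of "\<bar>g x\<bar>"] by auto
      have "integral (cbox x (x + (d / 2) *\<^sub>R One)) g = 0" using g by (rule integral_unique)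
      then show False using d(2)[rule_format, of "d / 2"] d(1) by simp
    qed
    have "x \<in> N" if "x \<in> cbox c d" "f x \<noteq> 0" for x
      using gz[of x] that by (auto simp: g_def)
    then have "{x\<in>cbox c d. f x \<noteq> 0} \<subseteq> N" by blast
    then show ?thesis using N(1) negligible_subset by blast
  qed
  obtain \<D> where D: "countable \<D>" "\<D> \<subseteq> Pow U" "\<And>X. X \<in> \<D> \<Longrightarrow> \<exists>a b. X = cbox a b" "\<Union>\<D> = U"
    using open_countable_Union_open_cbox[OF U] by metis
  have "{x\<in>U. f x \<noteq> 0} = (\<Union>X\<in>\<D>. {x\<in>X. f x \<noteq> 0})" using D(4) by auto
  moreover have "negligible (\<Union>X\<in>\<D>. {x\<in>X. f x \<noteq> 0})"
  proof (rule negligible_countable_Union)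
    fix N assume "N \<in> (\<lambda>X. {x\<in>X. f x \<noteq> 0}) ` \<D>"
    then obtain X where X: "X \<in> \<D>" "N = {x\<in>X. f x \<noteq> 0}" by auto
    then obtain a b where "X = cbox a b" using D(3) by blast
    with X D(2) show "negligible N" using box[of a b] by auto
  qed (use D(1) in simp)
  ultimately show ?thesis by simp
qed

text \<open>The uniform limit of the means and \<open>\<phi>\<close> have the same integral over
  every box inside the inner part.\<close>

lemma eigenfunction_local_rep:
  assumes \<Omega>: "bounded \<Omega>" "\<Omega> \<in> sets lebesgue"
    and w: "weak_eigenfunction \<Omega> l \<phi>" and i: "integrable (lebesgue_on \<Omega>) \<phi>"
    and \<tau>: "\<tau> > 0" "0 \<le> l" "l * \<tau> \<le> 1"
  shows "\<exists>h. continuous_on (inner_part \<Omega> \<tau>) h \<and> negligible {x\<in>inner_part \<Omega> \<tau>. \<phi> x \<noteq> h x}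
     \<and> (\<forall>x\<in>inner_part \<Omega> \<tau>. \<bar>h x\<bar> \<le> 2 * \<bar>nmean \<Omega> \<phi> \<tau> 2 x\<bar>)"
proof -
  let ?U = "inner_part \<Omega> \<tau>"
  obtain h where h: "uniform_limit ?U (\<lambda>j. nmean \<Omega> \<phi> \<tau> (j + 2)) h sequentially"
    "continuous_on ?U h" "\<And>x. x \<in> ?U \<Longrightarrow> \<bar>h x\<bar> \<le> 2 * \<bar>nmean \<Omega> \<phi> \<tau> 2 x\<bar>"
    using nmean_uniform_limit[OF w i \<tau>] by blast
  have "negligible {x\<in>?U. \<phi> x - h x \<noteq> 0}"
  proof (rule negligible_if_box_integrals_zero[OF open_inner_part])
    fix a b assume ab: "cbox a b \<subseteq> ?U"
    obtain I J where IJ: "\<And>n. (nmean \<Omega> \<phi> \<tau> (n + 2) has_integral I n) (cbox a b)"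
      "(h has_integral J) (cbox a b)" "I \<longlonglongrightarrow> J"
      using uniform_limit_integral_cbox[OF uniform_limit_on_subset[OF h(1) ab]] nmean_continuous[OF i]
      by (metis le_add2 one_le_numeral order_trans trivial_limit_sequentially)
    have "I = (\<lambda>n. integral (cbox a b) (nmean \<Omega> \<phi> \<tau> (n + 2)))"
      by (rule ext, rule integral_unique[OF IJ(1), symmetric])
    then have J: "J = (LINT y|lebesgue_on \<Omega>. \<phi> y * indicator (cbox a b) y)"
      using IJ(3) by (intro LIMSEQ_unique[OF _ nmean_box_tendsto[OF \<Omega> i \<tau>(1)]]) simp
    have sub: "cbox a b \<subseteq> \<Omega>" using ab inner_part_subset[of \<tau> \<Omega>] \<tau> by auto
    have "integrable (lebesgue_on \<Omega>) (\<lambda>y. indicator (cbox a b) y *\<^sub>R \<phi> y)"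
      by (rule integrable_mult_indicator[OF _ i]) (use sub in \<open>auto simp: sets_restrict_space_iff[of \<Omega> lebesgue] \<Omega>(2)\<close>)
    then have "((\<lambda>y. \<phi> y * indicator (cbox a b) y) has_integral J) \<Omega>"
      unfolding J using has_integral_integral_lebesgue_on \<Omega>(2) by (simp add: mult.commute)
    moreover have "(\<lambda>y. \<phi> y * indicator (cbox a b) y) = (\<lambda>y. if y \<in> cbox a b then \<phi> y else 0)"
      by (auto simp: indicator_def)
    ultimately have "(\<phi> has_integral J) (cbox a b)"
      by (simp only: has_integral_restrict[OF sub])
    from has_integral_diff[OF this IJ(2)] show "((\<lambda>x. \<phi> x - h x) has_integral 0) (cbox a b)" by simp
  qed
  then show ?thesis using h by auto
qed

section \<open>Gluing continuous representatives\<close>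

lemma continuous_negligible_eq:
  fixes f h :: "'a::euclidean_space \<Rightarrow> real"
  assumes "open W" "continuous_on W f" "continuous_on W h" "negligible {x\<in>W. f x \<noteq> h x}" "x \<in> W"
  shows "f x = h x"
proof (rule ccontr)
  assume ne: "f x \<noteq> h x"
  have "open (W \<inter> (\<lambda>x. f x - h x) -` (- {0}))"
    using assms by (intro continuous_open_preimage continuous_intros) auto
  moreover have "W \<inter> (\<lambda>x. f x - h x) -` (- {0}) = {x\<in>W. f x \<noteq> h x}" by auto
  ultimately have "\<not> negligible {x\<in>W. f x \<noteq> h x}"
    using ne assms(5) by (intro open_not_negligible) auto
  then show False using assms(4) by simp
qed

text \<open>Two local representatives agree on the overlap, because they are continuous and differ
  there only on a null set. Passing to a countable subcover keeps the total exceptional set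
  null.\<close>

lemma glue_continuous_reps:
  fixes f :: "'a::euclidean_space \<Rightarrow> real"
  assumes "\<And>x. x \<in> \<Omega> \<Longrightarrow> \<exists>V h. open V \<and> x \<in> V \<and> V \<subseteq> \<Omega> \<and> continuous_on V h \<and> negligible {z\<in>V. f z \<noteq> h z}"
  shows "\<exists>g. continuous_on \<Omega> g \<and> negligible {z\<in>\<Omega>. f z \<noteq> g z}"
proof -
  define Q where "Q x V h \<longleftrightarrow> open V \<and> x \<in> V \<and> V \<subseteq> \<Omega> \<and> continuous_on V h \<and> negligible {z\<in>V. f z \<noteq> h z}" for x V h
  have "\<forall>x\<in>\<Omega>. \<exists>V h. Q x V h" using assms unfolding Q_def by blast
  then obtain V h where "\<forall>x\<in>\<Omega>. Q x (V x) (h x)" by metis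
  then have V: "\<And>x. x \<in> \<Omega> \<Longrightarrow> open (V x) \<and> x \<in> V x \<and> V x \<subseteq> \<Omega> \<and> continuous_on (V x) (h x) \<and> negligible {z\<in>V x. f z \<noteq> h x z}"
    unfolding Q_def by blast
  define g where "g x = h x x" for x
  have gh: "g z = h x z" if x: "x \<in> \<Omega>" and z: "z \<in> V x" for x z
  proof -
    have z\<Omega>: "z \<in> \<Omega>" using V[OF x] z by auto
    have "negligible ({y\<in>V x. f y \<noteq> h x y} \<union> {y\<in>V z. f y \<noteq> h z y})"
      using V[OF x] V[OF z\<Omega>] by simp
    then have "negligible {y\<in>V z \<inter> V x. h z y \<noteq> h x y}" by (rule negligible_subset) auto
    then have "h z z = h x z"
      using V[OF x] V[OF z\<Omega>] z
      by (intro continuous_negligible_eq[of "V z \<inter> V x" "h z" "h x"]) (auto intro: continuous_on_subset)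
    then show ?thesis by (simp add: g_def)
  qed
  have "continuous_on \<Omega> g"
  proof (rule continuous_at_imp_continuous_on, rule ballI)
    fix x assume x: "x \<in> \<Omega>"
    have "continuous_on (V x) g"
      by (rule continuous_on_eq[of _ "h x"]) (use V[OF x] gh[OF x] in simp_all)
    then show "isCont g x" using V[OF x] by (simp add: continuous_on_eq_continuous_at)
  qed
  moreover have "negligible {z\<in>\<Omega>. f z \<noteq> g z}"
  proof -
    obtain \<F> where F: "\<F> \<subseteq> V ` \<Omega>" "countable \<F>" "\<Union>\<F> = \<Union>(V ` \<Omega>)"
      using Lindelof[of "V ` \<Omega>"] V by blast
    have "negligible (\<Union>X\<in>\<F>. {z\<in>X. f z \<noteq> g z})"
    proof (rule negligible_countable_Union)
      fix N assume "N \<in> (\<lambda>X. {z\<in>X. f z \<noteq> g z}) ` \<F>"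
      then obtain x where x: "x \<in> \<Omega>" "N = {z\<in>V x. f z \<noteq> g z}" using F(1) by auto
      then have "N = {z\<in>V x. f z \<noteq> h x z}" using gh[OF x(1)] by auto
      then show "negligible N" using V[OF x(1)] by simp
    qed (use F(2) in simp)
    moreover have "\<Omega> \<subseteq> \<Union>\<F>" unfolding F(3) using V by blast
    then have "{z\<in>\<Omega>. f z \<noteq> g z} \<subseteq> (\<Union>X\<in>\<F>. {z\<in>X. f z \<noteq> g z})" by blast
    ultimately show ?thesis by (rule negligible_subset)
  qed
  ultimately show ?thesis by blast
qed

text \<open>The admissible \<open>\<tau>\<close> shrink as \<open>l\<close> grows, and the local
  representatives depend on \<open>\<tau>\<close>. Gluing yields a single function that obeys the
  bound for all admissible \<open>\<tau>\<close> at once, as the dyadic counting requires.\<close>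

lemma eigenfunction_continuous_rep:
  assumes \<Omega>: "bounded \<Omega>" "open \<Omega>"
    and w: "weak_eigenfunction \<Omega> l \<phi>" and i: "integrable (lebesgue_on \<Omega>) \<phi>" and l: "0 \<le> l"
  shows "\<exists>g. continuous_on \<Omega> g \<and> negligible {x\<in>\<Omega>. \<phi> x \<noteq> g x}
     \<and> (\<forall>\<tau>>0. l * \<tau> \<le> 1 \<longrightarrow> (\<forall>x\<in>inner_part \<Omega> \<tau>. \<bar>g x\<bar> \<le> 2 * \<bar>nmean \<Omega> \<phi> \<tau> 2 x\<bar>))"
proof -
  have \<Omega>': "\<Omega> \<in> sets lebesgue" using \<Omega>(2) by simp
  have "\<exists>g. continuous_on \<Omega> g \<and> negligible {z\<in>\<Omega>. \<phi> z \<noteq> g z}"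
  proof (rule glue_continuous_reps)
    fix x assume "x \<in> \<Omega>"
    then obtain \<tau>0 where \<tau>0: "\<tau>0 > 0" "x \<in> inner_part \<Omega> \<tau>0" using inner_part_exhaust[OF \<Omega>(2,1)] by blast
    \<comment> \<open>\<open>l + 1\<close> instead of \<open>l\<close> covers the case
      \<open>l = 0\<close>.\<close>
    define \<tau> where "\<tau> = min \<tau>0 (1 / (l + 1))"
    have \<tau>: "\<tau> > 0" using \<tau>0 l by (simp add: \<tau>_def)
    have "l * \<tau> \<le> l * (1 / (l + 1))" using l by (intro mult_left_mono) (auto simp: \<tau>_def)
    also have "\<dots> \<le> 1" using l by simp
    finally have "l * \<tau> \<le> 1" .
    from eigenfunction_local_rep[OF \<Omega>(1) \<Omega>' w i \<tau> l this]
    obtain h where h: "continuous_on (inner_part \<Omega> \<tau>) h" "negligible {x\<in>inner_part \<Omega> \<tau>. \<phi> x \<noteq> h x}"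
      by blast
    have "x \<in> inner_part \<Omega> \<tau>" using inner_part_antimono[of \<tau> \<tau>0 \<Omega>] \<tau>0(2) by (auto simp: \<tau>_def)
    with h show "\<exists>V h. open V \<and> x \<in> V \<and> V \<subseteq> \<Omega> \<and> continuous_on V h \<and> negligible {z\<in>V. \<phi> z \<noteq> h z}"
      using open_inner_part[of \<Omega> \<tau>] inner_part_subset[of \<tau> \<Omega>, OF less_imp_le[OF \<tau>]] by blast
  qed
  then obtain g where g: "continuous_on \<Omega> g" "negligible {z\<in>\<Omega>. \<phi> z \<noteq> g z}" by blast
  have "\<bar>g x\<bar> \<le> 2 * \<bar>nmean \<Omega> \<phi> \<tau> 2 x\<bar>" if \<tau>: "\<tau> > 0" "l * \<tau> \<le> 1" and x: "x \<in> inner_part \<Omega> \<tau>" for \<tau> x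
  proof -
    obtain h where h: "continuous_on (inner_part \<Omega> \<tau>) h" "negligible {x\<in>inner_part \<Omega> \<tau>. \<phi> x \<noteq> h x}"
      "\<forall>x\<in>inner_part \<Omega> \<tau>. \<bar>h x\<bar> \<le> 2 * \<bar>nmean \<Omega> \<phi> \<tau> 2 x\<bar>"
      using eigenfunction_local_rep[OF \<Omega>(1) \<Omega>' w i \<tau>(1) l \<tau>(2)] by blast
    have sub: "inner_part \<Omega> \<tau> \<subseteq> \<Omega>" using \<tau> by (intro inner_part_subset) simp
    have "negligible ({x\<in>inner_part \<Omega> \<tau>. \<phi> x \<noteq> h x} \<union> {z\<in>\<Omega>. \<phi> z \<noteq> g z})" using g h by simp
    then have "negligible {y\<in>inner_part \<Omega> \<tau>. g y \<noteq> h y}" by (rule negligible_subset) (use sub in auto)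
    then have "g x = h x"
      by (intro continuous_negligible_eq[OF open_inner_part continuous_on_subset[OF g(1) sub] h(1) _ x])
    then show ?thesis using h(3) x by simp
  qed
  then show ?thesis using g by blast
qed

section \<open>Fourier coefficients and the spectral counting bound\<close>

lemma H1_weak_partial:
  assumes "f \<in> H1 \<Omega>" "i \<in> Basis"
  shows "weak_partial \<Omega> i f \<in> L2 \<Omega>" "has_weak_partial \<Omega> i f (weak_partial \<Omega> i f)"
proof -
  have "\<exists>w. w \<in> L2 \<Omega> \<and> has_weak_partial \<Omega> i f w" using assms by (auto simp: H1_def)
  then have "weak_partial \<Omega> i f \<in> L2 \<Omega> \<and> has_weak_partial \<Omega> i f (weak_partial \<Omega> i f)"
    unfolding weak_partial_def by (rule someI_ex)
  then show "weak_partial \<Omega> i f \<in> L2 \<Omega>" "has_weak_partial \<Omega> i f (weak_partial \<Omega> i f)" by auto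
qed

lemma H2_D:
  assumes "f \<in> H2 \<Omega>"
  shows "f \<in> H1 \<Omega>" "f \<in> L2 \<Omega>" "i \<in> Basis \<Longrightarrow> weak_partial \<Omega> i f \<in> H1 \<Omega>"
  using assms by (auto simp: H2_def H1_def)

lemma laplacian_L2: "f \<in> H2 \<Omega> \<Longrightarrow> laplacian \<Omega> f \<in> L2 \<Omega>"
  unfolding laplacian_def[abs_def] by (intro L2_sum H1_weak_partial(1) H2_D(3))

lemma test_function_dir_deriv:
  assumes t: "test_function \<Omega> \<psi>" and i: "i \<in> Basis"
  shows "test_function \<Omega> (dir_deriv i \<psi>)"
proof -
  obtain K where K: "compact K" "K \<subseteq> \<Omega>" "\<And>x. x \<notin> K \<Longrightarrow> \<psi> x = 0" and s: "smooth \<psi>"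
    using t by (auto simp: test_function_def)
  have "smooth (dir_deriv i \<psi>)"
    unfolding smooth_def
  proof (intro allI impI)
    fix vs x assume "set vs \<subseteq> (Basis :: 'a set)"
    then have "set (vs @ [i]) \<subseteq> Basis" using i by simp
    then have "foldr dir_deriv (vs @ [i]) \<psi> differentiable at x" using s unfolding smooth_def by blast
    then show "foldr dir_deriv vs (dir_deriv i \<psi>) differentiable at x" by simp
  qed
  moreover have "dir_deriv i \<psi> x = 0" if "x \<notin> K" for x
  proof -
    have "(\<psi> has_derivative (\<lambda>v. 0)) (at x)"
      by (rule has_derivative_transform_within_open[OF has_derivative_const[of 0], of "- K"])
         (use K that compact_imp_closed in auto)
    then show ?thesis by (rule dir_deriv_eqI)
  qed
  ultimately show ?thesis using K(1,2) by (auto simp: test_function_def)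
qed

lemma test_function_L2:
  assumes \<Omega>: "\<Omega> \<in> sets lebesgue" and t: "test_function \<Omega> \<psi>"
  shows "\<psi> \<in> L2 \<Omega>"
proof -
  obtain K where K: "compact K" "\<And>x. x \<notin> K \<Longrightarrow> \<psi> x = 0" and s: "smooth \<psi>"
    using t by (auto simp: test_function_def)
  have "\<psi> differentiable at x" for x
    using s[unfolded smooth_def, rule_format, of "[]" x] by simp
  then have c: "continuous_on UNIV \<psi>"
    by (intro continuous_at_imp_continuous_on ballI differentiable_imp_continuous_within)
  have m: "\<psi> \<in> borel_measurable borel" by (rule borel_measurable_continuous_onI[OF c])
  have "integrable lborel (\<lambda>x. indicator K x *\<^sub>R (\<psi> x)\<^sup>2)"
    by (rule borel_integrable_compact[OF K(1)]) (use c in \<open>auto intro!: continuous_intros intro: continuous_on_subset\<close>)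
  moreover have "(\<lambda>x. indicator K x *\<^sub>R (\<psi> x)\<^sup>2) = (\<lambda>x. (\<psi> x)\<^sup>2)"
    using K(2) by (auto simp: indicator_def fun_eq_iff)
  ultimately have "integrable lebesgue (\<lambda>x. (\<psi> x)\<^sup>2)"
    using m by (simp add: integrable_completion)
  from integrable_mult_indicator[OF \<Omega> this] have "integrable (lebesgue_on \<Omega>) (\<lambda>x. (\<psi> x)\<^sup>2)"
    using \<Omega> by (simp add: integrable_restrict_space)
  then show ?thesis using borel_lebesgue_on[OF m] by (simp add: L2_def)
qed

lemma laplacian_weak:
  assumes \<Omega>: "\<Omega> \<in> sets lebesgue" and f: "f \<in> H2 \<Omega>" and t: "test_function \<Omega> \<psi>"
  shows "l2_inner \<Omega> (laplacian \<Omega> f) \<psi> = - (\<Sum>i\<in>Basis. l2_inner \<Omega> (weak_partial \<Omega> i f) (dir_deriv i \<psi>))"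
proof -
  have "l2_inner \<Omega> (laplacian \<Omega> f) \<psi> = (\<Sum>i\<in>Basis. l2_inner \<Omega> (weak_partial \<Omega> i (weak_partial \<Omega> i f)) \<psi>)"
    unfolding laplacian_def[abs_def]
    by (rule l2_inner_sum_left) (use H2_D[OF f] H1_weak_partial test_function_L2[OF \<Omega> t] in auto)
  also have "\<dots> = (\<Sum>i\<in>Basis. - l2_inner \<Omega> (weak_partial \<Omega> i f) (dir_deriv i \<psi>))"
  proof (rule sum.cong)
    fix i :: 'a assume i: "i \<in> Basis"
    show "l2_inner \<Omega> (weak_partial \<Omega> i (weak_partial \<Omega> i f)) \<psi> = - l2_inner \<Omega> (weak_partial \<Omega> i f) (dir_deriv i \<psi>)"
      using H1_weak_partial(2)[OF H2_D(3)[OF f i] i] t by (simp add: has_weak_partial_def)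
  qed simp
  finally show ?thesis by (simp add: sum_negf)
qed

text \<open>Two integrations by parts, each an instance of the definition of a weak derivative, move
  the Laplacian onto the test function.\<close>

lemma Dirichlet_eigenfunction_weak:
  assumes \<Omega>: "\<Omega> \<in> sets lebesgue" and f: "f \<in> H2 \<Omega>"
    and e: "AE x in lebesgue_on \<Omega>. - laplacian \<Omega> f x = l * f x"
  shows "weak_eigenfunction \<Omega> l f"
  unfolding weak_eigenfunction_def
proof (intro conjI allI impI)
  show fL: "f \<in> L2 \<Omega>" by (rule H2_D(2)[OF f])
  fix \<psi> assume t: "test_function \<Omega> \<psi>"
  note tL = test_function_L2[OF \<Omega>]
  have t2: "test_function \<Omega> (dir_deriv i (dir_deriv i \<psi>))" if "i \<in> Basis" for i
    by (intro test_function_dir_deriv t that)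
  have "l2_inner \<Omega> f (\<lambda>y. \<Sum>i\<in>Basis. dir_deriv i (dir_deriv i \<psi>) y)
     = (\<Sum>i\<in>Basis. l2_inner \<Omega> (dir_deriv i (dir_deriv i \<psi>)) f)"
    by (subst l2_inner_commute, rule l2_inner_sum_left) (use tL t2 fL in auto)
  also have "\<dots> = (\<Sum>i\<in>Basis. - l2_inner \<Omega> (weak_partial \<Omega> i f) (dir_deriv i \<psi>))"
  proof (rule sum.cong)
    fix i :: 'a assume i: "i \<in> Basis"
    show "l2_inner \<Omega> (dir_deriv i (dir_deriv i \<psi>)) f = - l2_inner \<Omega> (weak_partial \<Omega> i f) (dir_deriv i \<psi>)"
      using H1_weak_partial(2)[OF H2_D(1)[OF f] i] test_function_dir_deriv[OF t i]
      by (simp add: has_weak_partial_def l2_inner_commute[of \<Omega> _ f])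
  qed simp
  also have "\<dots> = l2_inner \<Omega> (laplacian \<Omega> f) \<psi>" by (simp add: laplacian_weak[OF \<Omega> f t] sum_negf)
  also have "\<dots> = l2_inner \<Omega> (\<lambda>x. - l * f x) \<psi>"
    by (rule l2_inner_cong_AE_left)
       (use e laplacian_L2[OF f] L2_cmult[OF fL] tL[OF t] in \<open>auto dest: L2_D elim!: eventually_mono\<close>)
  also have "\<dots> = - l * l2_inner \<Omega> f \<psi>" by (rule l2_inner_cmult_left)
  finally show "l2_inner \<Omega> f (\<lambda>y. \<Sum>i\<in>Basis. dir_deriv i (dir_deriv i \<psi>) y) = - l * l2_inner \<Omega> f \<psi>" .
qed

text \<open>For a test function \<open>h\<close> this is the definition of weak derivatives, and
  both sides are continuous in \<open>h\<close> for the \<open>H1\<close> norm, in which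
  \<open>H10\<close> is the closure of the test functions. The boundary condition enters the proof
  here.\<close>

lemma Green_identity:
  assumes \<Omega>: "\<Omega> \<in> sets lebesgue" and f: "f \<in> H2 \<Omega>" and h: "h \<in> H10 \<Omega>"
  shows "l2_inner \<Omega> (laplacian \<Omega> f) h = - (\<Sum>i\<in>Basis. l2_inner \<Omega> (weak_partial \<Omega> i f) (weak_partial \<Omega> i h))"
proof -
  obtain \<psi> where \<psi>: "\<And>k::nat. test_function \<Omega> (\<psi> k)" "(\<lambda>k. l2_norm \<Omega> (\<lambda>x. \<psi> k x - h x)) \<longlonglongrightarrow> 0"
    "\<And>i. i \<in> Basis \<Longrightarrow> (\<lambda>k. l2_norm \<Omega> (\<lambda>x. dir_deriv i (\<psi> k) x - weak_partial \<Omega> i h x)) \<longlonglongrightarrow> 0"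
    and h1: "h \<in> H1 \<Omega>"
    using h by (auto simp: H10_def)
  have hL: "h \<in> L2 \<Omega>" using h1 by (simp add: H1_def)
  note tL = test_function_L2[OF \<Omega>]
  have "(\<lambda>k. l2_inner \<Omega> (\<psi> k) (laplacian \<Omega> f)) \<longlonglongrightarrow> l2_inner \<Omega> h (laplacian \<Omega> f)"
    by (rule l2_inner_tendsto[OF tL[OF \<psi>(1)] hL laplacian_L2[OF f] \<psi>(2)])
  moreover have "(\<lambda>k. l2_inner \<Omega> (\<psi> k) (laplacian \<Omega> f)) \<longlonglongrightarrow>
      - (\<Sum>i\<in>Basis. l2_inner \<Omega> (weak_partial \<Omega> i h) (weak_partial \<Omega> i f))"
  proof -
    have "l2_inner \<Omega> (\<psi> k) (laplacian \<Omega> f) = - (\<Sum>i\<in>Basis. l2_inner \<Omega> (dir_deriv i (\<psi> k)) (weak_partial \<Omega> i f))" for k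
      using laplacian_weak[OF \<Omega> f \<psi>(1)[of k]]
      by (simp add: l2_inner_commute[of \<Omega> "\<psi> k"] l2_inner_commute[of \<Omega> "weak_partial \<Omega> _ f"])
    moreover have "(\<lambda>k. l2_inner \<Omega> (dir_deriv i (\<psi> k)) (weak_partial \<Omega> i f)) \<longlonglongrightarrow> l2_inner \<Omega> (weak_partial \<Omega> i h) (weak_partial \<Omega> i f)"
      if i: "i \<in> Basis" for i
      by (rule l2_inner_tendsto[OF tL[OF test_function_dir_deriv[OF \<psi>(1) i]] H1_weak_partial(1)[OF h1 i]
            H1_weak_partial(1)[OF H2_D(1)[OF f] i] \<psi>(3)[OF i]])
    ultimately show ?thesis by (simp add: tendsto_minus tendsto_sum)
  qed
  ultimately have "l2_inner \<Omega> h (laplacian \<Omega> f) = - (\<Sum>i\<in>Basis. l2_inner \<Omega> (weak_partial \<Omega> i h) (weak_partial \<Omega> i f))"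
    by (rule LIMSEQ_unique)
  then show ?thesis
    by (simp add: l2_inner_commute[of \<Omega> h] l2_inner_commute[of \<Omega> "weak_partial \<Omega> _ h"])
qed

text \<open>Symmetry of the Dirichlet Laplacian, from Green's identity with the two functions in
  either order. Here \<open>u\<close> is an arbitrary element of the domain, later the solution at a
  fixed time.\<close>

lemma laplacian_Fourier_coeff:
  assumes \<Omega>: "\<Omega> \<in> sets lebesgue" and u: "u \<in> dirichlet_domain \<Omega>" and f: "f \<in> dirichlet_domain \<Omega>"
    and e: "AE x in lebesgue_on \<Omega>. - laplacian \<Omega> f x = l * f x"
  shows "l2_inner \<Omega> (laplacian \<Omega> u) f = - l * l2_inner \<Omega> u f"
proof -
  have u2: "u \<in> H2 \<Omega>" "u \<in> H10 \<Omega>" and f2: "f \<in> H2 \<Omega>" "f \<in> H10 \<Omega>"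
    using u f by (auto simp: dirichlet_domain_def)
  have "l2_inner \<Omega> (laplacian \<Omega> u) f = l2_inner \<Omega> (laplacian \<Omega> f) u"
    unfolding Green_identity[OF \<Omega> u2(1) f2(2)] Green_identity[OF \<Omega> f2(1) u2(2)]
    by (simp add: l2_inner_commute[of \<Omega> "weak_partial \<Omega> _ u"])
  also have "\<dots> = l2_inner \<Omega> (\<lambda>x. - l * f x) u"
    by (rule l2_inner_cong_AE_left)
       (use e laplacian_L2[OF f2(1)] L2_cmult[OF H2_D(2)[OF f2(1)]] H2_D(2)[OF u2(1)] in \<open>auto dest: L2_D elim!: eventually_mono\<close>)
  also have "\<dots> = - l * l2_inner \<Omega> u f"
    by (simp only: l2_inner_cmult_left l2_inner_commute[of \<Omega> f])
  finally show ?thesis .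
qed

section \<open>The counting bound\<close>

lemma mean_kernel_L2:
  fixes x :: "'a::euclidean_space"
  assumes \<Omega>: "bounded \<Omega>" "\<Omega> \<in> sets lebesgue" and \<tau>: "\<tau> > 0"
  defines "K \<equiv> \<lambda>y. pos_power 2 (\<tau> - (norm (y - x))\<^sup>2) / kernel_mass TYPE('a) \<tau> 2"
  shows "K \<in> L2 \<Omega>" and "l2_inner \<Omega> K K \<le> \<tau> powr (- real DIM('a) / 2) / ball_moment DIM('a) 2"
proof -
  define m where "m = kernel_mass TYPE('a) \<tau> 2"
  have m: "m > 0" by (simp add: m_def kernel_mass_pos[OF \<tau>])
  have K: "K y = pos_power 2 (\<tau> - (norm (y - x))\<^sup>2) / m" for y by (simp add: K_def m_def)
  have K0: "K y \<ge> 0" for y using m by (simp add: K pos_power_nonneg)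
  have Km: "K \<in> borel_measurable borel" unfolding K_def by measurable
  have Kle: "K y \<le> \<tau>\<^sup>2 / m" for y
    unfolding K using m \<tau> by (intro divide_right_mono) (auto simp: pos_power_def intro!: power_mono)
  have i1: "integrable lborel K"
    unfolding K_def using integral_pos_power(1)[of \<tau> 2 x] \<tau> by simp
  have I1: "integral\<^sup>L lborel K = 1"
    unfolding K_def using integral_pos_power_mass[OF \<tau>, of 2 x] m by (simp add: m_def)
  \<comment> \<open>The kernel has mass \<open>1\<close> and height at most
    \<open>\<tau>^2 / m\<close>, so its square has integral at most \<open>\<tau>^2 / m\<close>,
    which scales like \<open>\<tau> powr (- d / 2)\<close>.\<close>
  have KK': "K y * K y \<le> \<tau>\<^sup>2 / m * K y" for y
    by (rule mult_right_mono[OF Kle K0])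
  have KK: "norm (K y * K y) \<le> norm (\<tau>\<^sup>2 / m * K y)" for y
    using KK'[of y] K0[of y] by (simp only: real_norm_def) (metis abs_ge_self abs_of_nonneg mult_nonneg_nonneg order_trans)
  have i2: "integrable lborel (\<lambda>y. K y * K y)"
    by (rule Bochner_Integration.integrable_bound[of _ "\<lambda>y. \<tau>\<^sup>2 / m * K y"])
       (use i1 Km KK in auto)
  have i2': "integrable lebesgue (\<lambda>y. K y * K y)"
    using i2 Km by (simp add: integrable_completion)
  have "integrable (lebesgue_on \<Omega>) (\<lambda>y. K y * K y)"
    using \<Omega>(2) integrable_mult_indicator[OF \<Omega>(2) i2'] by (simp add: integrable_restrict_space)
  then show "K \<in> L2 \<Omega>" using borel_lebesgue_on[OF Km] by (simp add: L2_def power2_eq_square)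
  have "l2_inner \<Omega> K K = (LINT y|lebesgue. indicator \<Omega> y *\<^sub>R (K y * K y))"
    unfolding l2_inner_def using \<Omega>(2) by (intro integral_restrict_space) simp
  also have "\<dots> \<le> (LINT y|lebesgue. K y * K y)"
    by (rule integral_mono[OF integrable_mult_indicator[OF \<Omega>(2) i2'] i2']) (simp add: indicator_def)
  also have "\<dots> = (LINT y|lborel. K y * K y)" using Km by (intro integral_completion) auto
  also have "\<dots> \<le> (LINT y|lborel. \<tau>\<^sup>2 / m * K y)"
    by (rule integral_mono[OF i2 _ KK']) (use i1 in simp)
  also have "\<dots> = \<tau>\<^sup>2 / m" by (simp add: I1)
  also have "\<dots> = \<tau> powr (- real DIM('a) / 2) / ball_moment DIM('a) 2"
  proof -
    have "\<tau> powr (- real DIM('a) / 2) = inverse (\<tau> powr (real DIM('a) / 2))"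
      by (simp only: powr_minus minus_divide_left[symmetric])
    then show ?thesis
      unfolding m_def kernel_mass_eq[OF \<tau>] using \<tau> by (simp only: divide_inverse inverse_mult_distrib) simp
  qed
  finally show "l2_inner \<Omega> K K \<le> \<tau> powr (- real DIM('a) / 2) / ball_moment DIM('a) 2" .
qed

lemma nmean_Bessel:
  fixes x :: "'a::euclidean_space"
  assumes \<Omega>: "bounded \<Omega>" "\<Omega> \<in> sets lebesgue" and on: "orthonormal \<Omega> \<phi>" and \<tau>: "\<tau> > 0" and I: "finite I"
  shows "(\<Sum>n\<in>I. (nmean \<Omega> (\<phi> n) \<tau> 2 x)\<^sup>2) \<le> \<tau> powr (- real DIM('a) / 2) / ball_moment DIM('a) 2"
proof -
  let ?K = "\<lambda>y. pos_power 2 (\<tau> - (norm (y - x))\<^sup>2) / kernel_mass TYPE('a) \<tau> 2"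
  have "nmean \<Omega> (\<phi> n) \<tau> 2 x = l2_inner \<Omega> ?K (\<phi> n)" for n
    by (simp add: nmean_def power_mean_def l2_inner_def mult.commute)
  then show ?thesis
    using order_trans[OF Bessel_inequality[OF on I mean_kernel_L2(1)[OF \<Omega> \<tau>]] mean_kernel_L2(2)[OF \<Omega> \<tau>]] by simp
qed

text \<open>A counting bound of order \<open>\<lambda>\<^sup>s\<close> makes the weights \<open>\<lambda>\<^sub>n\<^sup>-\<^sup>p\<close> with \<open>p > s\<close> summable, by grouping dyadically.\<close>

lemma weighted_sum_bound:
  fixes lam :: "nat \<Rightarrow> real"
  assumes l0: "0 < l0" "\<And>n. l0 \<le> lam n" and \<tau>0: "0 < \<tau>0" and ps: "s < p" "0 < p" and C: "0 \<le> C"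
  shows "\<exists>S. \<forall>a. (\<forall>n. 0 \<le> a n) \<longrightarrow>
     (\<forall>\<tau> I. 0 < \<tau> \<longrightarrow> \<tau> \<le> \<tau>0 \<longrightarrow> finite I \<longrightarrow> (\<forall>n\<in>I. lam n * \<tau> \<le> 1) \<longrightarrow> (\<Sum>n\<in>I. a n) \<le> C * \<tau> powr (- s)) \<longrightarrow>
     (\<forall>N. (\<Sum>n<N. lam n powr (- p) * a n) \<le> S)"
proof -
  define \<tau> where "\<tau> j = \<tau>0 / 2 ^ j" for j :: nat
  have \<tau>: "0 < \<tau> j" "\<tau> j \<le> \<tau>0" for j
    using \<tau>0 by (auto simp: \<tau>_def divide_le_eq)
  have ex: "\<exists>j. lam n * \<tau> j \<le> 1" for n
  proof -
    obtain j where "lam n * \<tau>0 < 2 ^ j" using real_arch_pow[of 2 "lam n * \<tau>0"] by auto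
    then show ?thesis by (intro exI[of _ j]) (simp add: \<tau>_def)
  qed
  \<comment> \<open>The dyadic block of \<open>n\<close>: \<open>lam n\<close> is at most
    \<open>2 ^ J n / \<tau>0\<close> and, if \<open>J n > 0\<close>, more than half of that.\<close>
  define J where "J n = (LEAST j. lam n * \<tau> j \<le> 1)" for n
  have J: "lam n * \<tau> (J n) \<le> 1" for n unfolding J_def by (rule LeastI_ex[OF ex])
  define q where "q = 2 powr (- p)"
  \<comment> \<open>The first summand serves the block \<open>J n = 0\<close>, where the lower bound
    \<open>l0\<close> is used, the second all later blocks.\<close>
  define D where "D = l0 powr (- p) + (2 * \<tau>0) powr p"
  have D0: "D \<ge> 0" by (simp add: D_def)
  have q0: "q > 0" by (simp add: q_def)
  have pow2: "((2::real) ^ j) powr z = (2 powr z) ^ j" for z :: real and j :: nat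
  proof -
    have "((2::real) ^ j) powr z = (2 powr real j) powr z" by (simp add: powr_realpow)
    also have "\<dots> = (2 powr z) powr real j" by (simp only: powr_powr mult.commute)
    also have "\<dots> = (2 powr z) ^ j" by (simp add: powr_realpow)
    finally show ?thesis .
  qed
  have qj: "q ^ j = (2 ^ j) powr (- p)" for j :: nat
    by (simp only: q_def pow2)
  have w: "lam n powr (- p) \<le> D * q ^ J n" for n
  proof (cases "J n")
    case 0
    have "lam n powr (- p) \<le> l0 powr (- p)" using l0 ps by (intro powr_mono2') auto
    then show ?thesis using 0 by (simp add: D_def add_increasing2)
  next
    case (Suc i)
    then have "\<not> lam n * \<tau> i \<le> 1" unfolding J_def by (metis lessI not_less_Least)
    then have "2 ^ i / \<tau>0 < lam n" using \<tau>0 by (simp add: \<tau>_def field_simps)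
    then have "lam n powr (- p) \<le> (2 ^ i / \<tau>0) powr (- p)"
      using ps \<tau>0 by (intro powr_mono2') auto
    also have "2 ^ i / \<tau>0 = 2 ^ Suc i / (2 * \<tau>0)" by simp
    also have "(2 ^ Suc i / (2 * \<tau>0)) powr (- p) = (2 * \<tau>0) powr p * q ^ Suc i"
      unfolding qj using \<tau>0 by (subst powr_divide) (auto simp: powr_minus divide_inverse)
    also have "\<dots> \<le> D * q ^ Suc i" using q0 by (intro mult_right_mono) (auto simp: D_def)
    finally show ?thesis using Suc by simp
  qed
  define r where "r = q * 2 powr s"
  have r: "0 < r" "r < 1"
  proof -
    show "0 < r" by (simp add: r_def q0)
    have "r = 2 powr (s - p)" by (simp add: r_def q_def powr_add[symmetric])
    also have "\<dots> < 2 powr 0" using ps by (intro powr_less_mono) auto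
    finally show "r < 1" by simp
  qed
  have \<tau>s: "q ^ j * \<tau> j powr (- s) = \<tau>0 powr (- s) * r ^ j" for j
  proof -
    have "\<tau> j powr (- s) = \<tau>0 powr (- s) * (2 powr s) ^ j"
      unfolding \<tau>_def using \<tau>0 by (subst powr_divide) (auto simp: powr_minus divide_inverse pow2)
    then show ?thesis by (simp add: r_def power_mult_distrib)
  qed
  show ?thesis
  \<comment> \<open>The constant does not involve \<open>a\<close>. This matters because
    \<open>a n\<close> will be the squared value of the \<open>n\<close>-th eigenfunction at a
    varying point.\<close>
  proof (rule exI[of _ "D * (C * \<tau>0 powr (- s)) * (1 / (1 - r))"], intro allI impI)
    fix a :: "nat \<Rightarrow> real" and N
    assume a: "\<forall>n. 0 \<le> a n" and H: "\<forall>\<tau> I. 0 < \<tau> \<longrightarrow> \<tau> \<le> \<tau>0 \<longrightarrow> finite I \<longrightarrow> (\<forall>n\<in>I. lam n * \<tau> \<le> 1) \<longrightarrow> (\<Sum>n\<in>I. a n) \<le> C * \<tau> powr (- s)"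
    define B where "B = Max (insert 0 (J ` {..<N}))"
    have JB: "J ` {..<N} \<subseteq> {..B}" by (auto simp: B_def)
    have "(\<Sum>n<N. lam n powr (- p) * a n) \<le> (\<Sum>n<N. D * q ^ J n * a n)"
      using a by (intro sum_mono mult_right_mono w) auto
    also have "\<dots> = (\<Sum>j\<le>B. \<Sum>n\<in>{n\<in>{..<N}. J n = j}. D * q ^ J n * a n)"
      by (rule sum.group[symmetric]) (use JB in auto)
    also have "\<dots> \<le> (\<Sum>j\<le>B. D * (C * \<tau>0 powr (- s)) * r ^ j)"
    proof (rule sum_mono)
      fix j
      have "(\<Sum>n\<in>{n\<in>{..<N}. J n = j}. D * q ^ J n * a n) = D * q ^ j * (\<Sum>n\<in>{n\<in>{..<N}. J n = j}. a n)"
        by (simp add: sum_distrib_left)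
      also have "\<dots> \<le> D * q ^ j * (C * \<tau> j powr (- s))"
      proof (rule mult_left_mono)
        show "(\<Sum>n\<in>{n\<in>{..<N}. J n = j}. a n) \<le> C * \<tau> j powr (- s)"
          using H[rule_format, of "\<tau> j" "{n\<in>{..<N}. J n = j}"] \<tau>[of j] J by auto
      qed (use D0 q0 in simp)
      also have "\<dots> = D * (C * \<tau>0 powr (- s)) * r ^ j" using \<tau>s[of j] by (simp add: mult_ac)
      finally show "(\<Sum>n\<in>{n\<in>{..<N}. J n = j}. D * q ^ J n * a n) \<le> D * (C * \<tau>0 powr (- s)) * r ^ j" .
    qed
    also have "\<dots> = D * (C * \<tau>0 powr (- s)) * (\<Sum>j\<le>B. r ^ j)" by (simp add: sum_distrib_left)
    also have "\<dots> \<le> D * (C * \<tau>0 powr (- s)) * (1 / (1 - r))"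
    proof (rule mult_left_mono)
      have "(\<Sum>j<Suc B. r ^ j) \<le> (\<Sum>j. r ^ j)"
        using r by (intro sum_le_suminf summable_geometric) auto
      then show "(\<Sum>j\<le>B. r ^ j) \<le> 1 / (1 - r)" using r by (simp add: suminf_geometric lessThan_Suc_atMost)
    qed (use D0 C in simp)
    finally show "(\<Sum>n<N. lam n powr (- p) * a n) \<le> D * (C * \<tau>0 powr (- s)) * (1 / (1 - r))" .
  qed
qed

section \<open>Point values of eigenfunction series\<close>

lemma AE_lebesgue_on_iff_negligible:
  assumes S: "S \<in> sets lebesgue"
  shows "(AE x in lebesgue_on S. P x) \<longleftrightarrow> negligible {x\<in>S. \<not> P x}"
proof -
  have "(AE x in lebesgue_on S. P x) \<longleftrightarrow> (AE x in lebesgue. x \<in> S \<longrightarrow> P x)"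
    using S by (simp add: AE_restrict_space_iff)
  also have "\<dots> \<longleftrightarrow> {x\<in>S. \<not> P x} \<in> null_sets lebesgue"
    by (subst completion.AE_iff_null_sets) (auto intro!: arg_cong[where f = "\<lambda>A. A \<in> null_sets lebesgue"])
  finally show ?thesis by (simp add: negligible_iff_null_sets)
qed

lemma point_value_eqI:
  assumes \<Omega>: "open \<Omega>" and h: "continuous_on \<Omega> h" and n: "negligible {x\<in>\<Omega>. f x \<noteq> h x}" and x: "x \<in> \<Omega>"
  shows "point_value \<Omega> f x = h x"
  unfolding point_value_def
proof (rule the_equality)
  have S: "\<Omega> \<in> sets lebesgue" using \<Omega> by simp
  show "\<exists>h'. continuous_on \<Omega> h' \<and> (AE z in lebesgue_on \<Omega>. f z = h' z) \<and> h' x = h x"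
    using h n by (intro exI[of _ h]) (simp add: AE_lebesgue_on_iff_negligible[OF S])
  fix y assume "\<exists>h'. continuous_on \<Omega> h' \<and> (AE z in lebesgue_on \<Omega>. f z = h' z) \<and> h' x = y"
  then obtain h' where h': "continuous_on \<Omega> h'" "negligible {z\<in>\<Omega>. f z \<noteq> h' z}" "h' x = y"
    by (auto simp: AE_lebesgue_on_iff_negligible[OF S])
  have "negligible ({x\<in>\<Omega>. f x \<noteq> h x} \<union> {z\<in>\<Omega>. f z \<noteq> h' z})" using n h'(2) by simp
  then have "negligible {z\<in>\<Omega>. h' z \<noteq> h z}" by (rule negligible_subset) auto
  from continuous_negligible_eq[OF \<Omega> h'(1) h this x] show "y = h x" using h'(3) by simp
qed

text \<open>Lebesgue measure is complete, so measurability survives changes on null sets. This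
  serves the point values in time, whose series is known only for almost every
  \<open>t\<close>.\<close>

lemma borel_measurable_lebesgue_on_AE:
  fixes f g :: "'a::euclidean_space \<Rightarrow> real"
  assumes S: "S \<in> sets lebesgue" and f: "f \<in> borel_measurable (lebesgue_on S)"
    and ae: "AE x in lebesgue_on S. g x = f x"
  shows "g \<in> borel_measurable (lebesgue_on S)"
proof -
  have "f measurable_on S" using f by (simp add: measurable_on_iff_borel_measurable[OF S])
  then have "g measurable_on S"
    by (rule measurable_on_spike[of _ _ "{x\<in>S. g x \<noteq> f x}"]) (use ae in \<open>auto simp: AE_lebesgue_on_iff_negligible[OF S]\<close>)
  then show ?thesis by (simp add: measurable_on_iff_borel_measurable[OF S])
qed

text \<open>In the following context \<open>\<psi> n\<close> is the continuous representative of \<open>\<phi> n\<close>.\<close>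

context
  fixes \<Omega> :: "'a::euclidean_space set" and lam :: "nat \<Rightarrow> real" and \<phi> \<psi> :: "nat \<Rightarrow> 'a \<Rightarrow> real" and \<gamma> :: real
  assumes op: "open \<Omega>" and bd: "bounded \<Omega>" and on: "orthonormal \<Omega> \<phi>"
    and dense: "\<And>f e. f \<in> L2 \<Omega> \<Longrightarrow> 0 < e \<Longrightarrow> \<exists>N c. l2_norm \<Omega> (\<lambda>x. f x - (\<Sum>n<N::nat. c n * \<phi> n x)) < e"
    and lam0: "\<And>n. 0 < lam n"
    and \<psi>c: "\<And>n. continuous_on \<Omega> (\<psi> n)" and \<psi>\<phi>: "\<And>n. negligible {x\<in>\<Omega>. \<phi> n x \<noteq> \<psi> n x}"
    and sumb: "\<And>\<tau>. 0 < \<tau> \<Longrightarrow> \<exists>S. \<forall>x\<in>inner_part \<Omega> \<tau>. \<forall>N. (\<Sum>n<N. lam n powr (- (2 * \<gamma>)) * (\<psi> n x)\<^sup>2) \<le> S"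
begin

text \<open>Each term is split with the factors \<open>lam n powr \<gamma>\<close> and
  \<open>lam n powr (- \<gamma>)\<close>. Arbitrary finite index sets are allowed so that tails of
  the series can be estimated as well.\<close>

lemma weighted_Cauchy_Schwarz:
  assumes S: "\<forall>N. (\<Sum>n<N. lam n powr (- (2 * \<gamma>)) * (\<psi> n x)\<^sup>2) \<le> S" and I: "finite I"
  shows "(\<Sum>n\<in>I. \<bar>c n * \<psi> n x\<bar>) \<le> sqrt (\<Sum>n\<in>I. (lam n powr \<gamma> * c n)\<^sup>2) * sqrt S"
proof -
  obtain N where N: "I \<subseteq> {..<N}" using finite_nat_iff_bounded I by blast
  have "(\<Sum>n\<in>I. \<bar>c n * \<psi> n x\<bar>) = (\<Sum>n\<in>I. (lam n powr \<gamma> * \<bar>c n\<bar>) * (lam n powr (- \<gamma>) * \<bar>\<psi> n x\<bar>))"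
    using lam0 by (intro sum.cong) (auto simp: powr_minus abs_mult order_less_imp_not_eq2)
  also have "\<dots> \<le> sqrt ((\<Sum>n\<in>I. (lam n powr \<gamma> * \<bar>c n\<bar>)\<^sup>2) * (\<Sum>n\<in>I. (lam n powr (- \<gamma>) * \<bar>\<psi> n x\<bar>)\<^sup>2))"
    by (rule real_le_rsqrt[OF Cauchy_Schwarz_ineq_sum])
  also have "\<dots> = sqrt (\<Sum>n\<in>I. (lam n powr \<gamma> * c n)\<^sup>2) * sqrt (\<Sum>n\<in>I. lam n powr (- (2 * \<gamma>)) * (\<psi> n x)\<^sup>2)"
  proof -
    have "(lam n powr (- \<gamma>))\<^sup>2 = lam n powr (- (2 * \<gamma>))" for n
      by (simp add: power2_eq_square powr_add[symmetric])
    then show ?thesis by (simp add: real_sqrt_mult power_mult_distrib)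
  qed
  also have "\<dots> \<le> sqrt (\<Sum>n\<in>I. (lam n powr \<gamma> * c n)\<^sup>2) * sqrt S"
  proof (intro mult_left_mono real_sqrt_le_mono)
    have "(\<Sum>n\<in>I. lam n powr (- (2 * \<gamma>)) * (\<psi> n x)\<^sup>2) \<le> (\<Sum>n<N. lam n powr (- (2 * \<gamma>)) * (\<psi> n x)\<^sup>2)"
      using N by (intro sum_mono2) auto
    then show "(\<Sum>n\<in>I. lam n powr (- (2 * \<gamma>)) * (\<psi> n x)\<^sup>2) \<le> S" using S[rule_format, of N] by simp
  qed (simp add: sum_nonneg)
  finally show ?thesis .
qed

lemma eigen_series_summable:
  assumes c: "summable (\<lambda>n. (lam n powr \<gamma> * c n)\<^sup>2)" and x: "x \<in> \<Omega>"
  shows "summable (\<lambda>n. \<bar>c n * \<psi> n x\<bar>)"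
proof -
  obtain \<tau> where \<tau>: "0 < \<tau>" "x \<in> inner_part \<Omega> \<tau>" using inner_part_exhaust[OF op bd x] by blast
  obtain S where S: "\<forall>N. (\<Sum>n<N. lam n powr (- (2 * \<gamma>)) * (\<psi> n x)\<^sup>2) \<le> S" using sumb[OF \<tau>(1)] \<tau>(2) by blast
  show ?thesis
  proof (rule summableI_nonneg_bounded)
    fix N
    have "0 \<le> S" using S[rule_format, of 0] by simp
    moreover have "(\<Sum>n<N. (lam n powr \<gamma> * c n)\<^sup>2) \<le> (\<Sum>n. (lam n powr \<gamma> * c n)\<^sup>2)"
      by (rule sum_le_suminf[OF c]) auto
    ultimately show "(\<Sum>n<N. \<bar>c n * \<psi> n x\<bar>) \<le> sqrt (\<Sum>n. (lam n powr \<gamma> * c n)\<^sup>2) * sqrt S"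
      using weighted_Cauchy_Schwarz[OF S, of "{..<N}" c]
      by (meson finite_lessThan mult_right_mono order_trans real_sqrt_ge_zero real_sqrt_le_mono)
  qed simp
qed

lemma eigen_series_uniform:
  assumes c: "summable (\<lambda>n. (lam n powr \<gamma> * c n)\<^sup>2)" and \<tau>: "0 < \<tau>"
  shows "uniform_limit (inner_part \<Omega> \<tau>) (\<lambda>N x. \<Sum>n<N. c n * \<psi> n x) (\<lambda>x. \<Sum>n. c n * \<psi> n x) sequentially"
proof -
  obtain S0 where S0: "\<And>x. x \<in> inner_part \<Omega> \<tau> \<Longrightarrow> \<forall>N. (\<Sum>n<N. lam n powr (- (2 * \<gamma>)) * (\<psi> n x)\<^sup>2) \<le> S0"
    using sumb[OF \<tau>] by blast
  \<comment> \<open>Raised to at least \<open>1\<close> so that the tolerance \<open>e^2 / S\<close>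
    below is positive.\<close>
  define S where "S = max S0 1"
  have S: "\<forall>N. (\<Sum>n<N. lam n powr (- (2 * \<gamma>)) * (\<psi> n x)\<^sup>2) \<le> S" if "x \<in> inner_part \<Omega> \<tau>" for x
    using S0[OF that] by (auto simp: S_def intro: order_trans)
  have S1: "S > 0" by (simp add: S_def)
  have "uniformly_Cauchy_on (inner_part \<Omega> \<tau>) (\<lambda>N x. \<Sum>n<N. c n * \<psi> n x)"
  proof (rule uniformly_Cauchy_onI')
    fix e :: real assume e: "0 < e"
    have "0 < e\<^sup>2 / S" using e S1 by simp
    then obtain M where M: "\<And>m n. M \<le> m \<Longrightarrow> norm (\<Sum>k=m..<n. (lam k powr \<gamma> * c k)\<^sup>2) < e\<^sup>2 / S"
      using c unfolding summable_Cauchy by blast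
    have "dist (\<Sum>k<m. c k * \<psi> k x) (\<Sum>k<n. c k * \<psi> k x) < e"
      if x: "x \<in> inner_part \<Omega> \<tau>" and m: "M \<le> m" and n: "m < n" for x m n
    proof -
      have "dist (\<Sum>k<m. c k * \<psi> k x) (\<Sum>k<n. c k * \<psi> k x) = \<bar>\<Sum>k=m..<n. c k * \<psi> k x\<bar>"
        using n sum_diff_nat_ivl[of 0 m n "\<lambda>k. c k * \<psi> k x"]
        by (simp add: dist_real_def atLeast0LessThan abs_minus_commute)
      also have "\<dots> \<le> (\<Sum>k=m..<n. \<bar>c k * \<psi> k x\<bar>)" by (rule sum_abs)
      also have "\<dots> \<le> sqrt (\<Sum>k=m..<n. (lam k powr \<gamma> * c k)\<^sup>2) * sqrt S"
        by (rule weighted_Cauchy_Schwarz[OF S[OF x]]) simp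
      also have "\<dots> < sqrt (e\<^sup>2 / S) * sqrt S"
        using M[OF m, of n] S1 by (intro mult_strict_right_mono real_sqrt_less_mono) auto
      also have "\<dots> = e" using S1 e by (simp add: real_sqrt_divide)
      finally show ?thesis .
    qed
    then show "\<exists>M. \<forall>x\<in>inner_part \<Omega> \<tau>. \<forall>m\<ge>M. \<forall>n>m. dist (\<Sum>k<m. c k * \<psi> k x) (\<Sum>k<n. c k * \<psi> k x) < e"
      by blast
  qed
  then have "uniformly_convergent_on (inner_part \<Omega> \<tau>) (\<lambda>N x. \<Sum>n<N. c n * \<psi> n x)"
    by (rule Cauchy_uniformly_convergent)
  then show ?thesis
    by (simp add: uniformly_convergent_uniform_limit_iff suminf_eq_lim)
qed

lemma eigen_series_continuous:
  assumes c: "summable (\<lambda>n. (lam n powr \<gamma> * c n)\<^sup>2)"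
  shows "continuous_on \<Omega> (\<lambda>x. \<Sum>n. c n * \<psi> n x)"
proof (rule continuous_at_imp_continuous_on, rule ballI)
  fix x assume "x \<in> \<Omega>"
  then obtain \<tau> where \<tau>: "0 < \<tau>" "x \<in> inner_part \<Omega> \<tau>" using inner_part_exhaust[OF op bd] by blast
  have sub: "inner_part \<Omega> \<tau> \<subseteq> \<Omega>" using \<tau>(1) by (intro inner_part_subset) simp
  have "continuous_on (inner_part \<Omega> \<tau>) (\<lambda>x. \<Sum>n. c n * \<psi> n x)"
  proof (rule uniform_limit_theorem[OF _ eigen_series_uniform[OF c \<tau>(1)]])
    show "\<forall>\<^sub>F N in sequentially. continuous_on (inner_part \<Omega> \<tau>) (\<lambda>x. \<Sum>n<N. c n * \<psi> n x)"
      by (intro always_eventually allI continuous_intros continuous_on_subset[OF \<psi>c sub])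
  qed simp
  then show "isCont (\<lambda>x. \<Sum>n. c n * \<psi> n x) x"
    using \<tau>(2) continuous_on_eq_continuous_at[OF open_inner_part] by blast
qed

lemma L2_set_integral:
  assumes f: "f \<in> L2 \<Omega>" and K: "cbox a b \<subseteq> \<Omega>"
  shows "(f has_integral l2_inner \<Omega> f (indicator (cbox a b))) (cbox a b)"
    and "(indicator (cbox a b) :: 'a \<Rightarrow> real) \<in> L2 \<Omega>"
proof -
  have \<Omega>: "\<Omega> \<in> sets lebesgue" using op by simp
  have sq: "(indicator (cbox a b) x :: real)\<^sup>2 = indicator (cbox a b) x" for x :: 'a by (simp add: indicator_def)
  have "integrable lebesgue (indicator (cbox a b) :: 'a \<Rightarrow> real)"
    using lmeasurable_cbox[of a b] by (intro integrable_real_indicator) (auto simp: fmeasurable_def)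
  from integrable_mult_indicator[OF \<Omega> this]
  have "integrable (lebesgue_on \<Omega>) (indicator (cbox a b) :: 'a \<Rightarrow> real)"
    using \<Omega> by (simp add: integrable_restrict_space)
  then show iL: "(indicator (cbox a b) :: 'a \<Rightarrow> real) \<in> L2 \<Omega>" by (simp add: L2_def sq)
  have "((\<lambda>x. f x * indicator (cbox a b) x) has_integral l2_inner \<Omega> f (indicator (cbox a b))) \<Omega>"
    unfolding l2_inner_def by (rule has_integral_integral_lebesgue_on[OF L2_mult_integrable[OF f iL] \<Omega>])
  moreover have "(\<lambda>x. f x * indicator (cbox a b) x) = (\<lambda>x. if x \<in> cbox a b then f x else 0)"
    by (auto simp: indicator_def)
  ultimately show "(f has_integral l2_inner \<Omega> f (indicator (cbox a b))) (cbox a b)"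
    by (simp only: has_integral_restrict[OF K])
qed

text \<open>The partial sums converge to \<open>f\<close> in \<open>L2\<close> and to the series
  uniformly on inner parts. Both modes of convergence pass to integrals over boxes, so the two
  limits agree almost everywhere.\<close>

lemma eigen_series_AE:
  assumes f: "f \<in> L2 \<Omega>" and c: "summable (\<lambda>n. (lam n powr \<gamma> * l2_inner \<Omega> f (\<phi> n))\<^sup>2)"
  shows "negligible {x\<in>\<Omega>. f x \<noteq> (\<Sum>n. l2_inner \<Omega> f (\<phi> n) * \<psi> n x)}"
proof -
  let ?c = "\<lambda>n. l2_inner \<Omega> f (\<phi> n)"
  let ?h = "\<lambda>x. \<Sum>n. ?c n * \<psi> n x"
  have part: "negligible {x\<in>inner_part \<Omega> \<tau>. f x - ?h x \<noteq> 0}" if \<tau>: "0 < \<tau>" for \<tau>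
  proof (rule negligible_if_box_integrals_zero[OF open_inner_part])
    fix a b assume ab: "cbox a b \<subseteq> inner_part \<Omega> \<tau>"
    have sub: "cbox a b \<subseteq> \<Omega>" using ab inner_part_subset[of \<tau> \<Omega>] \<tau> by auto
    let ?F = "\<lambda>N x. \<Sum>n<N. ?c n * \<psi> n x" and ?P = "\<lambda>N x. \<Sum>n<N. ?c n * \<phi> n x"
    have cont: "continuous_on (cbox a b) (?F N)" for N
      by (intro continuous_intros continuous_on_subset[OF \<psi>c sub])
    obtain I J where IJ: "\<And>N. (?F N has_integral I N) (cbox a b)" "(?h has_integral J) (cbox a b)" "I \<longlonglongrightarrow> J"
      by (rule uniform_limit_integral_cbox[OF uniform_limit_on_subset[OF eigen_series_uniform[OF c \<tau>] ab] cont trivial_limit_sequentially])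
         (rule that; assumption)
    have PL: "?P N \<in> L2 \<Omega>" for N by (rule orthonormal_comb_L2[OF on])
    have "I N = l2_inner \<Omega> (?P N) (indicator (cbox a b))" for N
    proof -
      have "negligible (\<Union>n<N. {x\<in>\<Omega>. \<phi> n x \<noteq> \<psi> n x})" using \<psi>\<phi> by (intro negligible_Union) auto
      then have "(?F N has_integral l2_inner \<Omega> (?P N) (indicator (cbox a b))) (cbox a b)"
        by (rule has_integral_spike[OF _ _ L2_set_integral(1)[OF PL sub]])
           (use sub in \<open>auto intro!: sum.cong\<close>)
      then show ?thesis using IJ(1)[of N] has_integral_unique by blast
    qed
    then have I: "I = (\<lambda>N. l2_inner \<Omega> (?P N) (indicator (cbox a b)))" by (rule ext)
    have "(\<lambda>N. l2_norm \<Omega> (\<lambda>x. f x - ?P N x)) \<longlonglongrightarrow> 0"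
      by (rule Fourier_expansion[OF on f dense[OF f]])
    moreover have "l2_norm \<Omega> (\<lambda>x. f x - ?P N x) = l2_norm \<Omega> (\<lambda>x. ?P N x - f x)" for N
      by (simp add: l2_norm_def l2_inner_def power2_eq_square[symmetric] power2_commute)
    ultimately have Pf: "(\<lambda>N. l2_norm \<Omega> (\<lambda>x. ?P N x - f x)) \<longlonglongrightarrow> 0" by simp
    have "J = l2_inner \<Omega> f (indicator (cbox a b))"
      by (rule LIMSEQ_unique[OF IJ(3)[unfolded I] l2_inner_tendsto[OF PL f L2_set_integral(2)[OF f sub] Pf]])
    from has_integral_diff[OF L2_set_integral(1)[OF f sub] IJ(2)[unfolded this]]
    show "((\<lambda>x. f x - ?h x) has_integral 0) (cbox a b)" by simp
  qed
  \<comment> \<open>Countably many inner parts exhaust the domain, so the exceptional sets add up to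
    a null set.\<close>
  have "{x\<in>\<Omega>. f x \<noteq> ?h x} \<subseteq> (\<Union>m. {x\<in>inner_part \<Omega> (1 / real (Suc m)). f x - ?h x \<noteq> 0})"
  proof
    fix x assume x: "x \<in> {x\<in>\<Omega>. f x \<noteq> ?h x}"
    then obtain \<tau> where \<tau>: "0 < \<tau>" "x \<in> inner_part \<Omega> \<tau>" using inner_part_exhaust[OF op bd] by blast
    obtain m where "1 / real (Suc m) < \<tau>" using nat_approx_posE[OF \<tau>(1)] by blast
    then have "x \<in> inner_part \<Omega> (1 / real (Suc m))" using inner_part_antimono[of "1 / real (Suc m)" \<tau> \<Omega>] \<tau>(2) by auto
    then show "x \<in> (\<Union>m. {x\<in>inner_part \<Omega> (1 / real (Suc m)). f x - ?h x \<noteq> 0})" using x by auto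
  qed
  moreover have "negligible (\<Union>m. {x\<in>inner_part \<Omega> (1 / real (Suc m)). f x - ?h x \<noteq> 0})"
    by (rule negligible_countable_Union) (auto intro: part[simplified])
  ultimately show ?thesis by (rule negligible_subset[rotated])
qed

lemma point_value_eigen_series:
  assumes "f \<in> L2 \<Omega>" "summable (\<lambda>n. (lam n powr \<gamma> * l2_inner \<Omega> f (\<phi> n))\<^sup>2)" "x \<in> \<Omega>"
  shows "point_value \<Omega> f x = (\<Sum>n. l2_inner \<Omega> f (\<phi> n) * \<psi> n x)"
  by (rule point_value_eqI[OF op eigen_series_continuous eigen_series_AE]) (use assms in auto)

end

section \<open>Continuous representatives for the Dirichlet eigensystem\<close>

lemma dirichlet_eigensystem_D:
  assumes "dirichlet_eigensystem \<Omega> lam \<phi>"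
  shows "orthonormal \<Omega> \<phi>" "0 < lam 0" "lam 0 \<le> lam n" "\<phi> n \<in> dirichlet_domain \<Omega>"
    "AE x in lebesgue_on \<Omega>. - laplacian \<Omega> (\<phi> n) x = lam n * \<phi> n x"
    "\<And>f e. f \<in> L2 \<Omega> \<Longrightarrow> 0 < e \<Longrightarrow> \<exists>N c. l2_norm \<Omega> (\<lambda>x. f x - (\<Sum>n<N::nat. c n * \<phi> n x)) < e"
  using assms H2_D(2)
  by (auto simp: dirichlet_eigensystem_def orthonormal_def dirichlet_domain_def monoD)

lemma eigenfunction_reps:
  fixes \<Omega> :: "'a::euclidean_space set"
  assumes \<Omega>: "open \<Omega>" "bounded \<Omega>" and es: "dirichlet_eigensystem \<Omega> lam \<phi>" and \<gamma>: "\<gamma> > real DIM('a) / 4"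
  obtains \<psi> where "\<And>n. continuous_on \<Omega> (\<psi> n)" "\<And>n. negligible {x\<in>\<Omega>. \<phi> n x \<noteq> \<psi> n x}"
    "\<And>\<tau>. 0 < \<tau> \<Longrightarrow> \<exists>S. \<forall>x\<in>inner_part \<Omega> \<tau>. \<forall>N. (\<Sum>n<N. lam n powr (- (2 * \<gamma>)) * (\<psi> n x)\<^sup>2) \<le> S"
proof -
  note E = dirichlet_eigensystem_D[OF es]
  have \<Omega>': "\<Omega> \<in> sets lebesgue" using \<Omega> by simp
  have lpos: "0 < lam n" for n using E(2) E(3)[of n] by linarith
  define Q where "Q n g \<longleftrightarrow> continuous_on \<Omega> g \<and> negligible {x\<in>\<Omega>. \<phi> n x \<noteq> g x}
     \<and> (\<forall>\<tau>>0. lam n * \<tau> \<le> 1 \<longrightarrow> (\<forall>x\<in>inner_part \<Omega> \<tau>. \<bar>g x\<bar> \<le> 2 * \<bar>nmean \<Omega> (\<phi> n) \<tau> 2 x\<bar>))" for n g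
  have "\<exists>g. Q n g" for n
    unfolding Q_def
  proof (rule eigenfunction_continuous_rep[OF \<Omega>(2,1)])
    show "weak_eigenfunction \<Omega> (lam n) (\<phi> n)"
      using E(4)[of n] by (intro Dirichlet_eigenfunction_weak[OF \<Omega>' _ E(5)]) (simp add: dirichlet_domain_def)
    show "integrable (lebesgue_on \<Omega>) (\<phi> n)"
      by (rule L2_integrable[OF \<Omega>(2) \<Omega>' orthonormal_L2[OF E(1)]])
  qed (use lpos[of n] in simp)
  then obtain \<psi> where "\<And>n. Q n (\<psi> n)" by metis
  then have \<psi>: "\<And>n. continuous_on \<Omega> (\<psi> n) \<and> negligible {x\<in>\<Omega>. \<phi> n x \<noteq> \<psi> n x}
     \<and> (\<forall>\<tau>>0. lam n * \<tau> \<le> 1 \<longrightarrow> (\<forall>x\<in>inner_part \<Omega> \<tau>. \<bar>\<psi> n x\<bar> \<le> 2 * \<bar>nmean \<Omega> (\<phi> n) \<tau> 2 x\<bar>))"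
    unfolding Q_def .
  show thesis
  proof (rule that[of \<psi>])
    show "continuous_on \<Omega> (\<psi> n)" "negligible {x\<in>\<Omega>. \<phi> n x \<noteq> \<psi> n x}" for n using \<psi>[of n] by simp_all
    fix \<tau>0 :: real assume \<tau>0: "0 < \<tau>0"
    \<comment> \<open>The \<open>4\<close> is the square of the factor \<open>2\<close> in the
      pointwise bound by means.\<close>
    define C where "C = 4 / ball_moment DIM('a) 2"
    define s where "s = real DIM('a) / 2"
    have C: "0 \<le> C" using ball_moment_pos[of "DIM('a)" 2] by (simp add: C_def)
    have p: "s < 2 * \<gamma>" "0 < 2 * \<gamma>" using \<gamma> by (auto simp: s_def intro: le_less_trans[rotated])
    from weighted_sum_bound[OF E(2,3) \<tau>0 p C] obtain S where S: "\<forall>a. (\<forall>n. 0 \<le> a n) \<longrightarrow>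
     (\<forall>\<tau> I. 0 < \<tau> \<longrightarrow> \<tau> \<le> \<tau>0 \<longrightarrow> finite I \<longrightarrow> (\<forall>n\<in>I. lam n * \<tau> \<le> 1) \<longrightarrow> (\<Sum>n\<in>I. a n) \<le> C * \<tau> powr (- s)) \<longrightarrow>
     (\<forall>N. (\<Sum>n<N. lam n powr (- (2 * \<gamma>)) * a n) \<le> S)"
      by (rule exE)
    have "(\<Sum>n<N. lam n powr (- (2 * \<gamma>)) * (\<psi> n x)\<^sup>2) \<le> S" if x: "x \<in> inner_part \<Omega> \<tau>0" for x N
    proof (rule S[rule_format])
      fix \<tau> I assume \<tau>: "0 < \<tau>" "\<tau> \<le> \<tau>0" and I: "finite I" "\<And>n. n \<in> I \<Longrightarrow> lam n * \<tau> \<le> 1"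
      have x': "x \<in> inner_part \<Omega> \<tau>" using inner_part_antimono[OF \<tau>(2)] x by auto
      have "(\<Sum>n\<in>I. (\<psi> n x)\<^sup>2) \<le> (\<Sum>n\<in>I. 4 * (nmean \<Omega> (\<phi> n) \<tau> 2 x)\<^sup>2)"
      proof (rule sum_mono)
        fix n assume "n \<in> I"
        then have "\<bar>\<psi> n x\<bar> \<le> 2 * \<bar>nmean \<Omega> (\<phi> n) \<tau> 2 x\<bar>" using \<psi>[of n] \<tau>(1) I(2)[of n] x' by simp
        then have "\<bar>\<psi> n x\<bar>\<^sup>2 \<le> (2 * \<bar>nmean \<Omega> (\<phi> n) \<tau> 2 x\<bar>)\<^sup>2" by (intro power_mono) auto
        then show "(\<psi> n x)\<^sup>2 \<le> 4 * (nmean \<Omega> (\<phi> n) \<tau> 2 x)\<^sup>2" by (simp add: power_mult_distrib)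
      qed
      also have "\<dots> = 4 * (\<Sum>n\<in>I. (nmean \<Omega> (\<phi> n) \<tau> 2 x)\<^sup>2)" by (simp add: sum_distrib_left)
      also have "\<dots> \<le> 4 * (\<tau> powr (- real DIM('a) / 2) / ball_moment DIM('a) 2)"
        by (intro mult_left_mono nmean_Bessel[OF \<Omega>(2) \<Omega>' E(1) \<tau>(1) I(1)]) simp
      finally show "(\<Sum>n\<in>I. (\<psi> n x)\<^sup>2) \<le> C * \<tau> powr (- s)" by (simp add: C_def s_def)
    qed simp
    then show "\<exists>S. \<forall>x\<in>inner_part \<Omega> \<tau>0. \<forall>N. (\<Sum>n<N. lam n powr (- (2 * \<gamma>)) * (\<psi> n x)\<^sup>2) \<le> S" by blast
  qed
qed

section \<open>The two-sided estimate\<close>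

lemma duhamel_coeff_ml_kernel:
  "duhamel_coeff \<alpha> l \<rho> t = (LINT s|lebesgue_on {0..t}. ml_kernel \<alpha> l s * \<rho> (t - s))"
  by (simp add: duhamel_coeff_def ml_kernel_def)

lemma sup_norm_on_upper:
  assumes "continuous_on {0..T} \<rho>" "t \<in> {0..T::real}"
  shows "\<bar>\<rho> t\<bar> \<le> sup_norm_on {0..T} \<rho>"
proof -
  have "continuous_on {0..T} (\<lambda>t. \<bar>\<rho> t\<bar>)" using assms(1) by (intro continuous_intros)
  then have "compact ((\<lambda>t. \<bar>\<rho> t\<bar>) ` {0..T})" by (rule compact_continuous_image) simp
  then have "bdd_above ((\<lambda>t. \<bar>\<rho> t\<bar>) ` {0..T})" by (intro bounded_imp_bdd_above compact_imp_bounded)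
  then show ?thesis unfolding sup_norm_on_def using assms(2) by (rule cSUP_upper2) simp_all
qed

lemma sup_norm_on_le:
  assumes "0 \<le> T" "\<And>t. t \<in> {0..T::real} \<Longrightarrow> \<bar>\<rho> t\<bar> \<le> c"
  shows "sup_norm_on {0..T} \<rho> \<le> c"
  unfolding sup_norm_on_def using assms by (intro cSUP_least) auto

text \<open>Being equal to \<open>min f c\<close> almost everywhere, the continuous function
  \<open>f\<close> equals it on the open interval; the endpoints follow by closure.\<close>

lemma continuous_AE_le_imp_le:
  fixes f :: "real \<Rightarrow> real"
  assumes T: "0 < T" and f: "continuous_on {0..T} f" and ae: "AE t in lebesgue_on {0<..<T}. f t \<le> c"
    and t: "t \<in> {0..T}"
  shows "f t \<le> c"
proof -
  have f': "continuous_on {0<..<T} f" by (rule continuous_on_subset[OF f]) auto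
  have n: "negligible {t\<in>{0<..<T}. f t \<noteq> min (f t) c}"
    using ae by (simp add: AE_lebesgue_on_iff_negligible min_def) (auto elim: negligible_subset)
  have "f s \<le> c" if "s \<in> {0<..<T}" for s
  proof -
    have "f s = min (f s) c"
      by (rule continuous_negligible_eq[OF open_greaterThanLessThan f' _ n that])
         (intro continuous_on_min f' continuous_on_const)
    then show ?thesis by (metis min.cobounded2)
  qed
  moreover have "closure {0<..<T} = {0..T}" using T by simp
  ultimately show ?thesis
    using continuous_le_on_closure[of "{0<..<T}" f t c] f t by simp
qed

text \<open>Young's inequality in a weighted norm: \<open>exp (- m t)\<close> is split as
  \<open>exp (- m (t - s)) * exp (- m s)\<close>, one factor for \<open>\<rho>\<close> and one for
  the kernel. The integral is extended up to \<open>T\<close> so that the bound does not depend on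
  \<open>t\<close>; \<open>m = 0\<close> gives the unweighted estimate.\<close>

lemma ml_kernel_conv_bound:
  assumes a: "0 < \<alpha>" "\<alpha> < 1" and l: "0 < l" and t: "0 < t" "t \<le> T" and m: "0 \<le> m"
    and \<rho>: "continuous_on {0..T} \<rho>" and Q: "\<And>s. s \<in> {0..T} \<Longrightarrow> exp (- m * s) * \<bar>\<rho> s\<bar> \<le> Q"
  shows "exp (- m * t) * \<bar>l * duhamel_coeff \<alpha> l \<rho> t\<bar>
     \<le> Q * (LINT s|lebesgue_on {0..T}. exp (- m * s) * (l * ml_kernel \<alpha> l s))"
proof -
  define k where "k s = l * ml_kernel \<alpha> l s" for s
  have k0: "0 \<le> k s" for s using ml_kernel_nonneg[OF a, of l s] l by (simp add: k_def)
  have T: "0 < T" using t by simp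
  have Q0: "0 \<le> Q" using Q[of 0] T by (simp add: order_trans[OF abs_ge_zero])
  have kt: "integrable (lebesgue_on {0..t}) k" and kT: "integrable (lebesgue_on {0..T}) k"
    unfolding k_def by (rule ml_kernel_integrable(1)[OF a l]; use t in simp)+
  have em: "(\<lambda>s. exp (- m * s)) \<in> borel_measurable (lebesgue_on {0..r})" for r
    by (intro continuous_imp_measurable_on_sets_lebesgue continuous_intros) auto
  have ek: "integrable (lebesgue_on {0..r}) (\<lambda>s. exp (- m * s) * k s)" if "integrable (lebesgue_on {0..r}) k" for r
  proof (rule Bochner_Integration.integrable_bound[OF that])
    show "(\<lambda>s. exp (- m * s) * k s) \<in> borel_measurable (lebesgue_on {0..r})"
      using that em by (intro borel_measurable_times) auto
    show "AE s in lebesgue_on {0..r}. norm (exp (- m * s) * k s) \<le> norm (k s)"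
      using m k0 by (intro AE_I2) (auto simp: abs_mult mult_le_cancel_right1 intro!: mult_left_le_one_le)
  qed
  have \<rho>c: "continuous_on {0..t} (\<lambda>s. \<rho> (t - s))"
    by (rule continuous_on_compose2[OF \<rho>]) (use t in \<open>auto intro!: continuous_intros\<close>)
  have \<rho>m: "(\<lambda>s. \<rho> (t - s)) \<in> borel_measurable (lebesgue_on {0..t})"
    by (rule continuous_imp_measurable_on_sets_lebesgue[OF \<rho>c]) simp
  have bnd: "\<bar>k s * \<rho> (t - s)\<bar> \<le> (exp (m * t) * Q) * (exp (- m * s) * k s)" if "s \<in> {0..t}" for s
  proof -
    have "\<bar>\<rho> (t - s)\<bar> = exp (m * (t - s)) * (exp (- m * (t - s)) * \<bar>\<rho> (t - s)\<bar>)"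
      by (simp add: exp_minus)
    also have "\<dots> \<le> exp (m * (t - s)) * Q" using Q[of "t - s"] that t by (intro mult_left_mono) auto
    also have "\<dots> = exp (m * t) * Q * exp (- m * s)"
      by (simp add: right_diff_distrib exp_diff exp_minus divide_inverse)
    finally have "k s * \<bar>\<rho> (t - s)\<bar> \<le> k s * (exp (m * t) * Q * exp (- m * s))" using k0 by (rule mult_left_mono)
    then show ?thesis using k0[of s] by (simp add: abs_mult mult_ac)
  qed
  have int: "integrable (lebesgue_on {0..t}) (\<lambda>s. k s * \<rho> (t - s))"
  proof (rule Bochner_Integration.integrable_bound[of _ "\<lambda>s. (exp (m * t) * Q) * (exp (- m * s) * k s)"])
    show "integrable (lebesgue_on {0..t}) (\<lambda>s. (exp (m * t) * Q) * (exp (- m * s) * k s))"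
      by (intro integrable_mult_right ek kt)
    show "(\<lambda>s. k s * \<rho> (t - s)) \<in> borel_measurable (lebesgue_on {0..t})"
      using kt \<rho>m by (intro borel_measurable_times) auto
    show "AE s in lebesgue_on {0..t}. norm (k s * \<rho> (t - s)) \<le> norm ((exp (m * t) * Q) * (exp (- m * s) * k s))"
      using bnd by (intro AE_I2) (simp only: real_norm_def, metis abs_ge_self order_trans atLeastAtMost_iff space_lebesgue_on)
  qed
  have "l * duhamel_coeff \<alpha> l \<rho> t = (LINT s|lebesgue_on {0..t}. k s * \<rho> (t - s))"
  proof -
    have "(LINT s|lebesgue_on {0..t}. k s * \<rho> (t - s)) = (LINT s|lebesgue_on {0..t}. l * (ml_kernel \<alpha> l s * \<rho> (t - s)))"
      by (simp add: k_def mult.assoc)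
    then show ?thesis by (simp add: duhamel_coeff_ml_kernel)
  qed
  then have "\<bar>l * duhamel_coeff \<alpha> l \<rho> t\<bar> \<le> (LINT s|lebesgue_on {0..t}. \<bar>k s * \<rho> (t - s)\<bar>)"
    by (simp add: integral_abs_bound)
  also have "\<dots> \<le> (LINT s|lebesgue_on {0..t}. (exp (m * t) * Q) * (exp (- m * s) * k s))"
    by (rule integral_mono) (use int ek[OF kt] bnd in auto)
  also have "\<dots> = (exp (m * t) * Q) * (LINT s|lebesgue_on {0..t}. exp (- m * s) * k s)"
    by simp
  also have "\<dots> \<le> (exp (m * t) * Q) * (LINT s|lebesgue_on {0..T}. exp (- m * s) * k s)"
  proof (rule mult_left_mono)
    have "integral {0..t} (\<lambda>s. exp (- m * s) * k s) \<le> integral {0..T} (\<lambda>s. exp (- m * s) * k s)"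
      by (rule integral_subset_le) (use t k0 integrable_on_lebesgue_on[OF ek[OF kt]] integrable_on_lebesgue_on[OF ek[OF kT]] in auto)
    then show "(LINT s|lebesgue_on {0..t}. exp (- m * s) * k s) \<le> (LINT s|lebesgue_on {0..T}. exp (- m * s) * k s)"
      using lebesgue_integral_eq_integral[OF ek[OF kt]] lebesgue_integral_eq_integral[OF ek[OF kT]] by simp
  qed (use Q0 in simp)
  finally have "exp (- m * t) * \<bar>l * duhamel_coeff \<alpha> l \<rho> t\<bar>
      \<le> exp (- m * t) * ((exp (m * t) * Q) * (LINT s|lebesgue_on {0..T}. exp (- m * s) * k s))"
    by (rule mult_left_mono) simp
  also have "\<dots> = Q * (LINT s|lebesgue_on {0..T}. exp (- m * s) * k s)"
    by (simp add: mult.assoc[symmetric] exp_minus)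
  finally show ?thesis by (simp add: k_def)
qed

text \<open>The weights \<open>exp (- m s)\<close> tend to \<open>0\<close> except at
  \<open>s = 0\<close>, and the integrable kernel dominates.\<close>

lemma ml_kernel_weighted_integral:
  assumes a: "0 < \<alpha>" "\<alpha> < 1" and l: "0 < l" and T: "0 < T"
  defines "\<delta> \<equiv> \<lambda>m::nat. (LINT s|lebesgue_on {0..T}. exp (- real m * s) * (l * ml_kernel \<alpha> l s))"
  shows "0 \<le> \<delta> m" "\<delta> m \<le> 1" "\<delta> \<longlonglongrightarrow> 0"
proof -
  define k where "k s = l * ml_kernel \<alpha> l s" for s
  have k0: "0 \<le> k s" for s using ml_kernel_nonneg[OF a, of l s] l by (simp add: k_def)
  have ki: "integrable (lebesgue_on {0..T}) k" unfolding k_def by (rule ml_kernel_integrable(1)[OF a l T])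
  have \<delta>: "\<delta> m = (LINT s|lebesgue_on {0..T}. exp (- real m * s) * k s)" for m by (simp add: \<delta>_def k_def)
  have em: "(\<lambda>s. exp (- real m * s)) \<in> borel_measurable (lebesgue_on {0..T})" for m
    by (intro continuous_imp_measurable_on_sets_lebesgue continuous_intros) auto
  have ekm: "(\<lambda>s. exp (- real m * s) * k s) \<in> borel_measurable (lebesgue_on {0..T})" for m
    using em ki by (intro borel_measurable_times) auto
  have le: "exp (- real m * s) * k s \<le> k s" if "s \<in> {0..T}" for s m
    using k0[of s] that by (intro mult_left_le_one_le) auto
  have ek: "integrable (lebesgue_on {0..T}) (\<lambda>s. exp (- real m * s) * k s)" for m
    by (rule Bochner_Integration.integrable_bound[OF ki ekm]) (use k0 le in \<open>auto intro!: AE_I2 simp: abs_mult\<close>)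
  show "0 \<le> \<delta> m" unfolding \<delta> using k0 by (intro integral_nonneg_AE AE_I2) simp
  have "\<delta> m \<le> integral\<^sup>L (lebesgue_on {0..T}) k"
    unfolding \<delta> by (rule integral_mono[OF ek ki]) (use le in auto)
  also have "\<dots> \<le> 1" unfolding k_def by (rule ml_kernel_integrable(2)[OF a l T])
  finally show "\<delta> m \<le> 1" .
  have "\<delta> \<longlonglongrightarrow> integral\<^sup>L (lebesgue_on {0..T}) (\<lambda>s. 0)"
    unfolding \<delta>
  proof (rule integral_dominated_convergence[OF _ _ ki])
    have "AE s in lebesgue_on {0..T}. s \<noteq> 0"
      by (subst AE_lebesgue_on_iff_negligible) (auto intro: negligible_subset[of "{0}"])
    then show "AE s in lebesgue_on {0..T}. (\<lambda>m. exp (- real m * s) * k s) \<longlonglongrightarrow> 0"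
      using AE_space
    proof eventually_elim
      case (elim s)
      then have s: "s > 0" by simp
      have "(\<lambda>m. exp (- s) ^ m) \<longlonglongrightarrow> 0" by (rule LIMSEQ_power_zero) (use s in simp)
      moreover have "exp (- s) ^ m = exp (- real m * s)" for m by (simp add: exp_of_nat_mult[symmetric])
      ultimately have "(\<lambda>m. exp (- real m * s)) \<longlonglongrightarrow> 0" by simp
      from tendsto_mult_right[OF this, of "k s"] show ?case by simp
    qed
    show "AE s in lebesgue_on {0..T}. norm (exp (- real m * s) * k s) \<le> k s" for m
      using k0 le by (intro AE_I2) (auto simp: abs_mult)
  qed (use ekm in auto)
  then show "\<delta> \<longlonglongrightarrow> 0" by simp
qed


lemma solution_Fourier_coeff:
  assumes on: "orthonormal \<Omega> \<phi>" and u: "u \<in> L2 \<Omega>"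
    and lim: "(\<lambda>N. l2_norm \<Omega> (\<lambda>x. u x - (\<Sum>n<N. c n * \<phi> n x))) \<longlonglongrightarrow> 0"
  shows "l2_inner \<Omega> u (\<phi> m) = c m"
proof -
  have "l2_norm \<Omega> (\<lambda>x. u x - (\<Sum>n<N. c n * \<phi> n x)) = l2_norm \<Omega> (\<lambda>x. (\<Sum>n<N. c n * \<phi> n x) - u x)" for N
    by (simp add: l2_norm_def l2_inner_def power2_eq_square[symmetric] power2_commute)
  with lim have "(\<lambda>N. l2_norm \<Omega> (\<lambda>x. (\<Sum>n<N. c n * \<phi> n x) - u x)) \<longlonglongrightarrow> 0" by simp
  then have "(\<lambda>N. l2_inner \<Omega> (\<lambda>x. \<Sum>n<N. c n * \<phi> n x) (\<phi> m)) \<longlonglongrightarrow> l2_inner \<Omega> u (\<phi> m)"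
    by (rule l2_inner_tendsto[OF orthonormal_comb_L2[OF on] u orthonormal_L2[OF on]])
  moreover have "(\<lambda>N. l2_inner \<Omega> (\<lambda>x. \<Sum>n<N. c n * \<phi> n x) (\<phi> m)) \<longlonglongrightarrow> c m"
  proof (rule tendsto_eventually)
    show "\<forall>\<^sub>F N in sequentially. l2_inner \<Omega> (\<lambda>x. \<Sum>n<N. c n * \<phi> n x) (\<phi> m) = c m"
      using eventually_gt_at_top[of m] by eventually_elim (simp add: orthonormal_comb_inner[OF on])
  qed
  ultimately show ?thesis by (rule LIMSEQ_unique)
qed

theorem theorem3p1:
  fixes \<Omega> :: "'a::euclidean_space set" and T \<alpha> \<gamma> :: real and x0 :: 'a
    and lam :: "nat \<Rightarrow> real" and \<phi> :: "nat \<Rightarrow> 'a \<Rightarrow> real" and g :: "'a \<Rightarrow> real"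
  assumes "smooth_bounded_domain \<Omega>"
    and "dirichlet_eigensystem \<Omega> lam \<phi>"
    and "0 < T" and "0 < \<alpha>" and "\<alpha> < 1"
    and "x0 \<in> \<Omega>"
    and "\<gamma> > real DIM('a) / 4"
    and "g \<in> frac_domain \<Omega> lam \<phi> \<gamma>"
    and "point_value \<Omega> g x0 \<noteq> 0"
  shows "\<exists>C>0. \<forall>\<rho> u. continuous_on {0..T} \<rho> \<longrightarrow> is_solution \<Omega> lam \<phi> T \<alpha> \<gamma> g \<rho> u \<longrightarrow>
           ereal (1 / C) * Linfty_norm T (\<lambda>t. point_value \<Omega> (caputo_deriv_sol \<Omega> g \<rho> u t) x0)
             \<le> ereal (sup_norm_on {0..T} \<rho>) \<and>
           ereal (sup_norm_on {0..T} \<rho>)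
             \<le> ereal C * Linfty_norm T (\<lambda>t. point_value \<Omega> (caputo_deriv_sol \<Omega> g \<rho> u t) x0)"
proof -
  have op: "open \<Omega>" and bd: "bounded \<Omega>" using assms(1) by (auto simp: smooth_bounded_domain_def)
  have \<Omega>: "\<Omega> \<in> sets lebesgue" using op by simp
  note a = assms(4,5) and T = assms(3)
  note E = dirichlet_eigensystem_D[OF assms(2)]
  have lpos: "0 < lam n" for n using E(2) E(3)[of n] by linarith
  obtain \<psi> where \<psi>: "\<And>n. continuous_on \<Omega> (\<psi> n)" "\<And>n. negligible {x\<in>\<Omega>. \<phi> n x \<noteq> \<psi> n x}"
    "\<And>\<tau>. 0 < \<tau> \<Longrightarrow> \<exists>S. \<forall>x\<in>inner_part \<Omega> \<tau>. \<forall>N. (\<Sum>n<N. lam n powr (- (2 * \<gamma>)) * (\<psi> n x)\<^sup>2) \<le> S"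
    by (rule eigenfunction_reps[OF op bd assms(2,7)]) (rule that; assumption)
  define gn where "gn n = l2_inner \<Omega> g (\<phi> n)" for n
  have gL: "g \<in> L2 \<Omega>" and gs: "summable (\<lambda>n. (lam n powr \<gamma> * gn n)\<^sup>2)"
    using assms(8) by (auto simp: frac_domain_def gn_def)
  have pv: "point_value \<Omega> f x0 = (\<Sum>n. l2_inner \<Omega> f (\<phi> n) * \<psi> n x0)"
    if "f \<in> L2 \<Omega>" "summable (\<lambda>n. (lam n powr \<gamma> * l2_inner \<Omega> f (\<phi> n))\<^sup>2)" for f
    by (rule point_value_eigen_series[OF op bd E(1) E(6) lpos \<psi> that assms(6)])
  define b where "b n = gn n * \<psi> n x0" for n
  have sb: "summable (\<lambda>n. \<bar>b n\<bar>)"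
    unfolding b_def by (rule eigen_series_summable[OF op bd E(1) E(6) lpos \<psi> gs assms(6)])
  define G where "G = point_value \<Omega> g x0"
  have G: "G = (\<Sum>n. b n)" unfolding G_def b_def gn_def by (rule pv[OF gL gs[unfolded gn_def]])
  have G0: "\<bar>G\<bar> > 0" using assms(9) by (simp add: G_def)
  define A where "A = (\<Sum>n. \<bar>b n\<bar>)"
  have A0: "A \<ge> 0" unfolding A_def by (rule suminf_nonneg[OF sb]) simp
  define \<delta> where "\<delta> n m = (LINT s|lebesgue_on {0..T}. exp (- real m * s) * (lam n * ml_kernel \<alpha> (lam n) s))" for n m
  note \<delta> = ml_kernel_weighted_integral[OF a lpos T, folded \<delta>_def]
  \<comment> \<open>Dominated convergence for series, with majorant \<open>|b n|\<close> because
    \<open>\<delta> n m\<close> lies between \<open>0\<close> and \<open>1\<close>.\<close>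
  have "(\<lambda>m. \<Sum>n. \<bar>b n\<bar> * \<delta> n m) \<longlonglongrightarrow> (\<Sum>n. 0)"
  proof (rule tannerys_theorem[THEN conjunct2, THEN conjunct2])
    show "(\<lambda>m. \<bar>b n\<bar> * \<delta> n m) \<longlonglongrightarrow> 0" for n using tendsto_mult_left[OF \<delta>(3)[of n], of "\<bar>b n\<bar>"] by simp
    show "\<forall>\<^sub>F (n, m) in sequentially \<times>\<^sub>F sequentially. norm (\<bar>b n\<bar> * \<delta> n m) \<le> \<bar>b n\<bar>"
      using \<delta>(1,2) by (intro always_eventually) (auto simp: abs_mult intro!: mult_right_le_one_le)
  qed (use sb in auto)
  then have "(\<lambda>m. \<Sum>n. \<bar>b n\<bar> * \<delta> n m) \<longlonglongrightarrow> 0" by simp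
  from order_tendstoD(2)[OF this, of "\<bar>G\<bar> / 2"] G0
  obtain m where m: "(\<Sum>n. \<bar>b n\<bar> * \<delta> n m) < \<bar>G\<bar> / 2" by (auto simp: eventually_sequentially)
  \<comment> \<open>\<open>2 * A\<close> comes from \<open>|\<rho> t - U n t| \<le> 2 * R\<close>.
    The second entry comes from absorbing half of \<open>|G|\<close> and from undoing the weight
    \<open>exp (- m t)\<close> on \<open>{0..T}\<close>.\<close>
  define C where "C = max (2 * A + 1) (2 * exp (real m * T) / \<bar>G\<bar>)"
  have C0: "C > 0" using A0 by (simp add: C_def)
  show ?thesis
  proof (intro exI[of _ C] conjI C0 allI impI)
    fix \<rho> u assume \<rho>: "continuous_on {0..T} \<rho>" and sol: "is_solution \<Omega> lam \<phi> T \<alpha> \<gamma> g \<rho> u"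
    define R where "R = sup_norm_on {0..T} \<rho>"
    have R: "\<bar>\<rho> t\<bar> \<le> R" if "t \<in> {0..T}" for t unfolding R_def by (rule sup_norm_on_upper[OF \<rho> that])
    have R0: "0 \<le> R" using R[of 0] T by simp
    define U where "U n t = lam n * duhamel_coeff \<alpha> (lam n) \<rho> t" for n t
    define v where "v t = point_value \<Omega> (caputo_deriv_sol \<Omega> g \<rho> u t) x0" for t
    \<comment> \<open>The convolution bound with \<open>m = 0\<close>, where the mass
      \<open>\<delta> n 0\<close> is at most \<open>1\<close>.\<close>
    have UR: "\<bar>U n t\<bar> \<le> R" if t: "t \<in> {0<..<T}" for n t
    proof -
      have "exp (- 0 * t) * \<bar>lam n * duhamel_coeff \<alpha> (lam n) \<rho> t\<bar>
          \<le> R * (LINT s|lebesgue_on {0..T}. exp (- 0 * s) * (lam n * ml_kernel \<alpha> (lam n) s))"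
        by (rule ml_kernel_conv_bound[OF a lpos _ _ _ \<rho>]) (use t R in auto)
      also have "\<dots> = R * \<delta> n 0" by (simp add: \<delta>_def)
      also have "\<dots> \<le> R" using \<delta>(1,2)[of n 0] R0 by (intro mult_left_le) auto
      finally show ?thesis by (simp add: U_def)
    qed
    have UQ: "exp (- real m * t) * \<bar>U n t\<bar> \<le> Q * \<delta> n m"
      if t: "t \<in> {0<..<T}" and Q: "\<And>s. s \<in> {0..T} \<Longrightarrow> exp (- real m * s) * \<bar>\<rho> s\<bar> \<le> Q" for n t Q
      unfolding U_def \<delta>_def by (rule ml_kernel_conv_bound[OF a lpos _ _ _ \<rho> Q]) (use t in auto)
    have term_bound: "\<bar>(\<rho> t - U n t) * b n\<bar> \<le> 2 * R * \<bar>b n\<bar>" if t: "t \<in> {0<..<T}" for n t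
      using UR[OF t, of n] R[of t] t by (auto simp: abs_mult intro!: mult_right_mono)
    have sV: "summable (\<lambda>n. \<bar>(\<rho> t - U n t) * b n\<bar>)" if t: "t \<in> {0<..<T}" for t
      by (rule summable_comparison_test'[OF summable_mult[OF sb, of "2 * R"], of 0]) (use term_bound[OF t] in simp)
    have solAE: "AE t in lebesgue_on {0<..<T}. u t \<in> dirichlet_domain \<Omega> \<and>
        (\<forall>n. l2_inner \<Omega> (u t) (\<phi> n) = duhamel_coeff \<alpha> (lam n) \<rho> t * gn n)"
    proof -
      have "AE t in lebesgue_on {0<..<T}.
        u t \<in> dirichlet_domain \<Omega> \<and>
        (\<lambda>N. l2_norm \<Omega> (\<lambda>x. u t x - (\<Sum>n<N. duhamel_coeff \<alpha> (lam n) \<rho> t * gn n * \<phi> n x))) \<longlonglongrightarrow> 0"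
        using sol by (simp add: is_solution_def gn_def)
      then show ?thesis
      proof eventually_elim
        case (elim t)
        then have uL: "u t \<in> L2 \<Omega>" using H2_D(2) by (auto simp: dirichlet_domain_def)
        from elim solution_Fourier_coeff[OF E(1) uL elim[THEN conjunct2]] show ?case by simp
      qed
    qed
    have vAE: "AE t in lebesgue_on {0<..<T}. v t = (\<Sum>n. (\<rho> t - U n t) * b n)"
      using solAE AE_space
    proof eventually_elim
      case (elim t)
      then have t: "t \<in> {0<..<T}" and uD: "u t \<in> dirichlet_domain \<Omega>"
        and uc: "\<And>n. l2_inner \<Omega> (u t) (\<phi> n) = duhamel_coeff \<alpha> (lam n) \<rho> t * gn n" by auto
      have lL: "laplacian \<Omega> (u t) \<in> L2 \<Omega>" using uD by (intro laplacian_L2) (simp add: dirichlet_domain_def)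
      have gL': "(\<lambda>x. \<rho> t * g x) \<in> L2 \<Omega>" by (rule L2_cmult[OF gL])
      have w: "caputo_deriv_sol \<Omega> g \<rho> u t = (\<lambda>x. laplacian \<Omega> (u t) x + \<rho> t * g x)"
        by (simp add: caputo_deriv_sol_def fun_eq_iff mult.commute)
      have wL: "caputo_deriv_sol \<Omega> g \<rho> u t \<in> L2 \<Omega>" unfolding w by (rule L2_add[OF lL gL'])
      have wc: "l2_inner \<Omega> (caputo_deriv_sol \<Omega> g \<rho> u t) (\<phi> n) = (\<rho> t - U n t) * gn n" for n
      proof -
        have "l2_inner \<Omega> (caputo_deriv_sol \<Omega> g \<rho> u t) (\<phi> n)
           = l2_inner \<Omega> (laplacian \<Omega> (u t)) (\<phi> n) + \<rho> t * gn n"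
          unfolding w l2_inner_add_left[OF lL gL' orthonormal_L2[OF E(1)]] by (simp add: l2_inner_cmult_left gn_def)
        also have "l2_inner \<Omega> (laplacian \<Omega> (u t)) (\<phi> n) = - lam n * l2_inner \<Omega> (u t) (\<phi> n)"
          by (rule laplacian_Fourier_coeff[OF \<Omega> uD E(4) E(5)])
        finally show ?thesis by (simp add: uc U_def algebra_simps)
      qed
      \<comment> \<open>The multipliers \<open>\<rho> t - U n t\<close> are bounded in
        \<open>n\<close>, so the order \<open>\<gamma>\<close> of \<open>g\<close> is inherited and
        the point-value formula applies.\<close>
      have "summable (\<lambda>n. (lam n powr \<gamma> * ((\<rho> t - U n t) * gn n))\<^sup>2)"
      proof (rule summable_comparison_test'[OF summable_mult[OF gs, of "(2 * R)\<^sup>2"], of 0])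
        fix n
        have "\<bar>\<rho> t - U n t\<bar> \<le> 2 * R" using UR[OF t, of n] R[of t] t by auto
        then have "(\<rho> t - U n t)\<^sup>2 \<le> (2 * R)\<^sup>2" using power_mono[of "\<bar>\<rho> t - U n t\<bar>" "2 * R" 2] by simp
        then have "(\<rho> t - U n t)\<^sup>2 * (lam n powr \<gamma> * gn n)\<^sup>2 \<le> (2 * R)\<^sup>2 * (lam n powr \<gamma> * gn n)\<^sup>2"
          by (rule mult_right_mono) simp
        then show "norm ((lam n powr \<gamma> * ((\<rho> t - U n t) * gn n))\<^sup>2) \<le> (2 * R)\<^sup>2 * (lam n powr \<gamma> * gn n)\<^sup>2"
          by (simp add: power_mult_distrib mult_ac)
      qed
      then have "v t = (\<Sum>n. (\<rho> t - U n t) * gn n * \<psi> n x0)"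
        unfolding v_def by (subst pv[OF wL]) (simp_all add: wc)
      then show ?case by (simp add: b_def mult.assoc)
    qed
    have vm: "v \<in> borel_measurable (lebesgue_on {0<..<T})"
    proof (rule borel_measurable_lebesgue_on_AE)
      \<comment> \<open>The Fourier coefficients of \<open>u\<close> are measurable in
        \<open>t\<close> by the definition of \<open>Linfty_frac\<close>, taken with epsilon equal
        to \<open>1\<close>. Written through them, the series is measurable without any study of the
        Duhamel integrals as functions of \<open>t\<close>.\<close>
      define V where "V t = (\<Sum>n. (\<rho> t * gn n - lam n * l2_inner \<Omega> (u t) (\<phi> n)) * \<psi> n x0)" for t
      have "u \<in> Linfty_frac \<Omega> lam \<phi> T (\<gamma> + 1 - 1)"
        using sol unfolding is_solution_def by (metis zero_less_one order_refl)
      then have "(\<lambda>t. l2_inner \<Omega> (u t) (\<phi> n)) \<in> borel_measurable (lebesgue_on {0<..<T})" for n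
        by (simp add: Linfty_frac_def)
      moreover have "\<rho> \<in> borel_measurable (lebesgue_on {0<..<T})"
        by (intro continuous_imp_measurable_on_sets_lebesgue continuous_on_subset[OF \<rho>]) auto
      ultimately show "V \<in> borel_measurable (lebesgue_on {0<..<T})"
        unfolding V_def[abs_def]
        by (intro borel_measurable_suminf borel_measurable_times borel_measurable_diff borel_measurable_const)
      show "AE t in lebesgue_on {0<..<T}. v t = V t"
        using vAE solAE
      proof eventually_elim
        case (elim t)
        have "(\<rho> t - U n t) * b n = (\<rho> t * gn n - lam n * l2_inner \<Omega> (u t) (\<phi> n)) * \<psi> n x0" for n
          using elim by (simp add: b_def U_def algebra_simps)
        then show ?case using elim by (simp add: V_def)
      qed
    qed simp
    define L where "L = Linfty_norm T v"
    have vbound: "AE t in lebesgue_on {0<..<T}. \<bar>v t\<bar> \<le> 2 * R * A"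
      using vAE AE_space
    proof eventually_elim
      case (elim t)
      then have t: "t \<in> {0<..<T}" by simp
      have "\<bar>v t\<bar> \<le> (\<Sum>n. \<bar>(\<rho> t - U n t) * b n\<bar>)" unfolding elim(1) by (rule summable_rabs[OF sV[OF t]])
      also have "\<dots> \<le> (\<Sum>n. 2 * R * \<bar>b n\<bar>)"
        by (rule suminf_le[OF term_bound[OF t] sV[OF t] summable_mult[OF sb]])
      also have "\<dots> = 2 * R * A" unfolding A_def by (rule suminf_mult[OF sb])
      finally show ?case .
    qed
    have L_le: "L \<le> ereal (2 * R * A)"
      unfolding L_def Linfty_norm_def
      by (rule esssup_I) (use vm vbound in auto)
    have L_AE: "AE t in lebesgue_on {0<..<T}. ereal \<bar>v t\<bar> \<le> L"
      unfolding L_def Linfty_norm_def by (rule esssup_AE)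
    \<comment> \<open>A negative essential supremum would make the whole interval a null
      set.\<close>
    have L0: "0 \<le> L"
    proof (rule ccontr)
      assume "\<not> 0 \<le> L"
      then have "\<not> ereal \<bar>v t\<bar> \<le> L" for t by (metis abs_ge_zero ereal_less_eq(5) order_trans)
      with L_AE have "AE t in lebesgue_on {0<..<T}. False" by simp
      then have "negligible {t\<in>{0<..<T}. \<not> False}" by (subst (asm) AE_lebesgue_on_iff_negligible) simp_all
      then have "negligible {0<..<T}" by (simp only: not_False_eq_True simp_thms Collect_mem_eq)
      then show False using open_not_negligible[of "{0<..<T}"] T by simp
    qed
    obtain K where K: "L = ereal K" "0 \<le> K"
      using L_le L0 by (cases L) auto
    have "K \<le> 2 * R * A" using L_le K by simp
    also have "\<dots> = R * (2 * A)" by simp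
    also have "\<dots> \<le> R * C" by (rule mult_left_mono[OF _ R0]) (simp add: C_def)
    finally have "1 / C * K \<le> R" using C0 by (simp add: field_simps)
    then show "ereal (1 / C) * Linfty_norm T (\<lambda>t. point_value \<Omega> (caputo_deriv_sol \<Omega> g \<rho> u t) x0)
        \<le> ereal (sup_norm_on {0..T} \<rho>)"
      using K(1) by (simp add: L_def v_def[abs_def] R_def)
    \<comment> \<open>The weighted sup norm of \<open>\<rho>\<close>. In it the memory term is
      bounded by \<open>Q * |G| / 2\<close>, whereas the unweighted estimate gives only
      \<open>R * A\<close>.\<close>
    define Q where "Q = sup_norm_on {0..T} (\<lambda>t. exp (- real m * t) * \<rho> t)"
    have wc: "continuous_on {0..T} (\<lambda>t. exp (- real m * t) * \<rho> t)" by (intro continuous_intros \<rho>)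
    have Q: "exp (- real m * t) * \<bar>\<rho> t\<bar> \<le> Q" if "t \<in> {0..T}" for t
      using sup_norm_on_upper[OF wc that] by (simp add: Q_def abs_mult)
    have Q0: "0 \<le> Q" using Q[of 0] T by simp
    have sd: "summable (\<lambda>n. \<bar>b n\<bar> * \<delta> n m)"
      by (rule summable_comparison_test'[OF sb, of 0]) (use \<delta>(1,2) in \<open>auto simp: abs_mult intro!: mult_right_le_one_le\<close>)
    have "AE t in lebesgue_on {0<..<T}. exp (- real m * t) * \<bar>\<rho> t\<bar> * \<bar>G\<bar> \<le> K + Q * (\<bar>G\<bar> / 2)"
      using vAE L_AE AE_space
    proof eventually_elim
      case (elim t)
      then have t: "t \<in> {0<..<T}" by simp
      define e where "e = exp (- real m * t)"
      have e: "0 \<le> e" "e \<le> 1" using t by (auto simp: e_def)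
      have sU: "summable (\<lambda>n. \<bar>U n t * b n\<bar>)"
        by (rule summable_comparison_test'[OF summable_mult[OF sb, of R], of 0])
           (use UR[OF t] in \<open>auto simp: abs_mult intro!: mult_right_mono\<close>)
      \<comment> \<open>The instantaneous parts of the coefficients sum to
        \<open>\<rho> t * G\<close>; what remains is the memory term, to be absorbed.\<close>
      have "v t = \<rho> t * G - (\<Sum>n. U n t * b n)"
      proof -
        have "(\<Sum>n. \<rho> t * b n - U n t * b n) = (\<Sum>n. \<rho> t * b n) - (\<Sum>n. U n t * b n)"
          by (rule suminf_diff[symmetric]) (use summable_rabs_cancel[OF sb] summable_rabs_cancel[OF sU] in \<open>auto intro: summable_mult\<close>)
        moreover have "(\<Sum>n. \<rho> t * b n) = \<rho> t * G" unfolding G by (rule suminf_mult[OF summable_rabs_cancel[OF sb]])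
        ultimately show ?thesis unfolding elim(1) by (simp add: left_diff_distrib)
      qed
      then have "\<bar>\<rho> t * G\<bar> \<le> \<bar>v t\<bar> + \<bar>\<Sum>n. U n t * b n\<bar>" by linarith
      also have "\<dots> \<le> K + (\<Sum>n. \<bar>U n t * b n\<bar>)"
        using elim(2) K(1) summable_rabs[OF sU] by simp
      finally have "e * \<bar>\<rho> t * G\<bar> \<le> e * (K + (\<Sum>n. \<bar>U n t * b n\<bar>))" using e(1) by (rule mult_left_mono)
      also have "\<dots> \<le> K + (\<Sum>n. e * \<bar>U n t * b n\<bar>)"
        using e K(2) mult_left_le_one_le[of K e] by (simp add: distrib_left suminf_mult[OF sU])
      also have "(\<Sum>n. e * \<bar>U n t * b n\<bar>) \<le> (\<Sum>n. Q * (\<bar>b n\<bar> * \<delta> n m))"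
      proof (rule suminf_le)
        fix n
        have "e * \<bar>U n t\<bar> * \<bar>b n\<bar> \<le> Q * \<delta> n m * \<bar>b n\<bar>"
          unfolding e_def by (intro mult_right_mono UQ[OF t Q]) auto
        then show "e * \<bar>U n t * b n\<bar> \<le> Q * (\<bar>b n\<bar> * \<delta> n m)" by (simp add: abs_mult mult_ac)
      qed (intro summable_mult sU sd)+
      also have "(\<Sum>n. Q * (\<bar>b n\<bar> * \<delta> n m)) = Q * (\<Sum>n. \<bar>b n\<bar> * \<delta> n m)" by (rule suminf_mult[OF sd])
      also have "\<dots> \<le> Q * (\<bar>G\<bar> / 2)" using m Q0 by (intro mult_left_mono) auto
      finally show ?case by (simp add: e_def abs_mult mult.assoc)
    qed
    \<comment> \<open>Continuity of \<open>\<rho>\<close> extends the estimate from almost every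
      time to every time, as is needed to bound the supremum \<open>Q\<close>.\<close>
    then have main: "exp (- real m * t) * \<bar>\<rho> t\<bar> * \<bar>G\<bar> \<le> K + Q * (\<bar>G\<bar> / 2)" if "t \<in> {0..T}" for t
      by (intro continuous_AE_le_imp_le[OF T _ _ that]) (auto intro!: continuous_intros \<rho>)
    \<comment> \<open>\<open>Q\<close> reappears on the right with factor one half; being a finite
      number, it can be moved to the left.\<close>
    have "Q \<le> (K + Q * (\<bar>G\<bar> / 2)) / \<bar>G\<bar>"
      unfolding Q_def
    proof (rule sup_norm_on_le)
      fix t assume "t \<in> {0..T}"
      from main[OF this] show "\<bar>exp (- real m * t) * \<rho> t\<bar> \<le> (K + sup_norm_on {0..T} (\<lambda>t. exp (- real m * t) * \<rho> t) * (\<bar>G\<bar> / 2)) / \<bar>G\<bar>"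
        using G0 by (simp add: pos_le_divide_eq abs_mult Q_def)
    qed (use T in simp)
    then have "Q * \<bar>G\<bar> \<le> K + Q * (\<bar>G\<bar> / 2)" using G0 by (simp add: pos_le_divide_eq)
    then have Q2: "Q \<le> 2 * K / \<bar>G\<bar>" using G0 by (simp add: pos_le_divide_eq)
    have "R \<le> C * K"
      unfolding R_def
    proof (rule sup_norm_on_le)
      fix t assume t: "t \<in> {0..T}"
      have "\<bar>\<rho> t\<bar> = exp (real m * t) * (exp (- real m * t) * \<bar>\<rho> t\<bar>)" by (simp add: exp_minus)
      also have "\<dots> \<le> exp (real m * T) * Q" using Q[OF t] Q0 t by (intro mult_mono) (auto intro: mult_left_mono)
      also have "\<dots> \<le> exp (real m * T) * (2 * K / \<bar>G\<bar>)" using Q2 by (intro mult_left_mono) auto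
      also have "\<dots> = (2 * exp (real m * T) / \<bar>G\<bar>) * K" by simp
      also have "\<dots> \<le> C * K" using K(2) by (intro mult_right_mono) (auto simp: C_def)
      finally show "\<bar>\<rho> t\<bar> \<le> C * K" .
    qed (use T in simp)
    then show "ereal (sup_norm_on {0..T} \<rho>)
        \<le> ereal C * Linfty_norm T (\<lambda>t. point_value \<Omega> (caputo_deriv_sol \<Omega> g \<rho> u t) x0)"
      using K(1) by (simp add: L_def v_def[abs_def] R_def)
  qed
qed

end
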